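(* Let $p\ge 3$ be a prime, $1\le i\le p-1$, $r\ge i(p+1)+p$, $r\equiv a\bmod (p-1)$ with $a\in\{1,2,\dots,p-1\}$, and let $r_0$ be the constant term in the base $p$-expansion of $r$. Then the quotient $Q(i)$ of $V_r$ is irreducible (as a $\Gamma$-module) if and only if either (1) $i=a-1$ or $i=a$, and $r_0\in\{a,a+1,\dots,p-1\}$; or (2) $i=p-1$, $a=1$ and $r_0=0$.
   Context: Let $\Gamma=\mathrm{GL}_2(\mathbb{F}_p)$. $V_r$ is the $\mathbb{F}_p$-space of homogeneous polynomials $F(X,Y)$ of degree $r$ over $\mathbb{F}_p$, with action $\begin{pmatrix} a&b\\c&d\end{pmatrix}\cdot F(X,Y)=F(aX+cY,\,bX+dY)$. $X_{r-i}=X_{r-i,\,r}\subseteq V_r$ is the $\mathbb{F}_p[\Gamma]$-submodule generated by $X^{r-i}Y^{i}$. Let $\theta=X^pY-XY^p$ and, for $m\ge0$, $V_r^{(m)}=\{F\in V_r:\theta^m\mid F\}$, a $\Gamma$-submodule of $V_r$. $Q(i)=V_r/(X_{r-i}+V_r^{(i+1)})$. *)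

theory Defs
  imports
    "HOL-Algebra.Module"
    "HOL-Algebra.AbelCoset"
    "HOL-Analysis.Determinants"
    "Berlekamp_Zassenhaus.Finite_Field"
begin

section \<open>Modules with a linear action\<close>

text \<open>
  Vector spaces are HOL-Algebra modules over a field structure \<open>K\<close>, extended by an action
  \<open>act\<close>.  The fields \<open>mult\<close> and \<open>one\<close> inherited from the record \<open>module\<close> play no role and are
  left unspecified.  A group enters only through its set \<open>G\<close> of elements: the
  \<open>K[G]\<close>-submodules are the \<open>K\<close>-submodules stable under every element of \<open>G\<close>.
\<close>

record ('k, 'g, 'v) gmodule = "('k, 'v) module" +
  act :: "'g \<Rightarrow> 'v \<Rightarrow> 'v"

definition gsubmodule ::
    "'k ring \<Rightarrow> 'g set \<Rightarrow> ('k, 'g, 'v) gmodule \<Rightarrow> 'v set \<Rightarrow> bool" where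
  "gsubmodule K G M H \<longleftrightarrow> submodule H K M \<and> (\<forall>g\<in>G. \<forall>v\<in>H. act M g v \<in> H)"

definition gspan ::
    "'k ring \<Rightarrow> 'g set \<Rightarrow> ('k, 'g, 'v) gmodule \<Rightarrow> 'v set \<Rightarrow> 'v set" where
  "gspan K G M S = \<Inter> {H. gsubmodule K G M H \<and> S \<subseteq> H}"

text \<open>
  The quotient by a submodule \<open>W\<close>.  All the cosets in the unions below coincide, so the unions
  are the cosets of \<open>c \<odot> v\<close> and \<open>g \<cdot> v\<close> for any representative \<open>v\<close> of \<open>C\<close>; HOL-Algebra
  defines the multiplication of a quotient ring in the same way.
\<close>

definition gquotient ::
    "('k, 'g, 'v) gmodule \<Rightarrow> 'v set \<Rightarrow> ('k, 'g, 'v set) gmodule" where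
  "gquotient M W =
     \<lparr>carrier = a_rcosets\<^bsub>M\<^esub> W, monoid.mult = undefined, one = undefined,
      zero = W, add = (<+>\<^bsub>M\<^esub>),
      module.smult = (\<lambda>c C. \<Union>v\<in>C. W +>\<^bsub>M\<^esub> (c \<odot>\<^bsub>M\<^esub> v)),
      act = (\<lambda>g C. \<Union>v\<in>C. W +>\<^bsub>M\<^esub> (act M g v))\<rparr>"

definition girreducible :: "'k ring \<Rightarrow> 'g set \<Rightarrow> ('k, 'g, 'v) gmodule \<Rightarrow> bool" where
  "girreducible K G M \<longleftrightarrow>
     carrier M \<noteq> {\<zero>\<^bsub>M\<^esub>} \<and>
     (\<forall>H. gsubmodule K G M H \<longrightarrow> H = {\<zero>\<^bsub>M\<^esub>} \<or> H = carrier M)"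


section \<open>The field with \<open>p\<close> elements and its general linear group\<close>

text \<open>
  The type \<open>'p mod_ring\<close> consists of the integers modulo \<open>CARD('p)\<close>, which is prime for
  \<open>'p\<close> of class \<open>prime_card\<close>; up to isomorphism every finite prime field is of this form.
\<close>

definition Fp :: "('p::prime_card) mod_ring ring" where
  "Fp = \<lparr>carrier = UNIV, monoid.mult = (*), one = 1, zero = 0, add = (+)\<rparr>"

definition GL2 :: "(('p::prime_card) mod_ring ^ 2 ^ 2) set" where
  "GL2 = {A. invertible A}"


section \<open>Binary forms\<close>

text \<open>
  A polynomial in \<open>X, Y\<close> is a polynomial in \<open>X\<close> over the polynomials in \<open>Y\<close>:
  the coefficient of \<open>X^m Y^n\<close> in \<open>F\<close> is \<open>coeff (coeff F m) n\<close>.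
\<close>

definition varX :: "('a::comm_ring_1) poly poly" where
  "varX = [:0, 1:]"

definition varY :: "('a::comm_ring_1) poly poly" where
  "varY = [:[:0, 1:]:]"

definition const2 :: "'a::comm_ring_1 \<Rightarrow> 'a poly poly" where
  "const2 c = [:[:c:]:]"

text \<open>\<open>subst2 P Q F\<close> is \<open>F(P, Q)\<close>.\<close>

definition subst2 ::
    "('a::comm_ring_1) poly poly \<Rightarrow> 'a poly poly \<Rightarrow> 'a poly poly \<Rightarrow> 'a poly poly" where
  "subst2 P Q F = poly (map_poly (\<lambda>q. poly (map_poly const2 q) Q) F) P"

definition forms :: "nat \<Rightarrow> ('a::comm_ring_1) poly poly set" where
  "forms r = {F. \<forall>m n. coeff (coeff F m) n \<noteq> 0 \<longrightarrow> m + n = r}"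

definition Vmod ::
    "nat \<Rightarrow> (('p::prime_card) mod_ring, 'p mod_ring ^ 2 ^ 2, 'p mod_ring poly poly) gmodule"
  where
  "Vmod r =
     \<lparr>carrier = forms r, monoid.mult = undefined, one = undefined, zero = 0, add = (+),
      module.smult = (\<lambda>c F. const2 c * F),
      act = (\<lambda>A. subst2 (const2 (A $ 1 $ 1) * varX + const2 (A $ 2 $ 1) * varY)
                        (const2 (A $ 1 $ 2) * varX + const2 (A $ 2 $ 2) * varY))\<rparr>"

text \<open>\<open>Xsub r i\<close> is \<open>X\<^bsub>r-i\<^esub>\<close>, the submodule of \<open>V\<^bsub>r\<^esub>\<close> generated by \<open>X^(r-i) Y^i\<close> (for \<open>i \<le> r\<close>).\<close>

definition Xsub :: "nat \<Rightarrow> nat \<Rightarrow> ('p::prime_card) mod_ring poly poly set" where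
  "Xsub r i = gspan Fp GL2 (Vmod r) {varX ^ (r - i) * varY ^ i}"

definition theta :: "('p::prime_card) mod_ring poly poly" where
  "theta = varX ^ CARD('p) * varY - varX * varY ^ CARD('p)"

definition Vfilt :: "nat \<Rightarrow> nat \<Rightarrow> ('p::prime_card) mod_ring poly poly set" where
  "Vfilt r m = {F \<in> carrier (Vmod r). theta ^ m dvd F}"

definition Qmod ::
    "nat \<Rightarrow> nat \<Rightarrow> (('p::prime_card) mod_ring, 'p mod_ring ^ 2 ^ 2, 'p mod_ring poly poly set) gmodule"
  where
  "Qmod r i = gquotient (Vmod r) (Xsub r i <+>\<^bsub>Vmod r\<^esub> Vfilt r (i + 1))"

end

theory Submission
  imports Defs
begin

text \<open>
  Write \<open>W = X\<^bsub>r-i\<^esub> + V^(i+1)\<close>, so that \<open>Q(i) = V_r / W\<close>.  The proof works in the dual space: a functional on \<open>V_r\<close>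
  is a function \<open>g\<close> on \<open>{0..r}\<close>, the value at \<open>n\<close> being that on \<open>X^(r-n) Y^n\<close>.  Passing to annihilators
  reverses inclusions between stable subspaces, so \<open>Q(i)\<close> is irreducible iff the annihilator of \<open>W\<close> is
  nonzero and each of its nonzero elements lies in the annihilator of no stable subspace strictly larger
  than \<open>W\<close> (\<open>separating_functional\<close>, \<open>irreducibleI\<close>, \<open>reducible_by_subspace\<close>).

  The annihilator of \<open>W\<close> is explicit.  Diagonal matrices split it according to the residue class \<open>w\<close> of \<open>n\<close>
  modulo \<open>p - 1\<close> (\<open>annih_class\<close>).  Pairing with multiples of \<open>\<theta>^m\<close> takes \<open>m\<close>-th differences along such a
  class, in which the step \<open>p - 1\<close> is \<open>-1\<close> in the field; so the annihilator of \<open>V^(m)\<close> consists of the functions which on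
  each class, for \<open>m \<le> n \<le> r - m\<close>, are a polynomial in \<open>n\<close> of degree below \<open>m\<close> (\<open>Vfilt_annih_iff_poly\<close>).
  Being zero on the orbit of \<open>X^(r-i) Y^i\<close> means vanishing for \<open>n \<le> i\<close> and \<open>n \<ge> r - i\<close>, together with the
  \<open>i + 1\<close> row equations \<open>\<Sum>n. (r-j choose n) g n = 0\<close>, \<open>j \<le> i\<close>, in each class.  Altogether, a class-\<open>w\<close>
  element of the annihilator is a polynomial of degree at most \<open>i\<close>, cut off near both ends, that solves the
  rows (\<open>annih_relations_class\<close>, \<open>cut_poly_annih_relations\<close>).

  For reducibility it suffices to find one nonzero element of the annihilator that vanishes on a stable
  subspace \<open>S\<close> and another one that does not.  Two choices of \<open>S\<close> do: an earlier step \<open>V^(m)\<close> of the filtration,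
  which separates polynomials by degree, and the span of the monomials in which the last base-\<open>p\<close> digit of the
  exponent of \<open>Y\<close> is at most \<open>r0\<close>, which separates them by their zeros.  The elements are
  binomial coefficients \<open>(r + q - n choose e)\<close>, whose rows follow from Vandermonde's identity and
  the values of class sums of binomial coefficients modulo \<open>p\<close>, and, for \<open>i = p - 1\<close>, indicator functions of a
  last digit.

  For irreducibility, Lucas's theorem turns the rows into equations on the last digit \<open>c\<close> of \<open>n\<close>: when
  \<open>i \<le> r0\<close> they say that the polynomial \<open>P\<close> is orthogonal to all polynomials of degree at most \<open>i\<close> for the
  weight \<open>(r0 choose c) * digit_sum 0 w c\<close> (\<open>digit_orthogonality\<close>).  A weight with small support forces
  \<open>P\<close> to vanish on it; a weight that detects degree \<open>a\<close> bounds the degree of \<open>P\<close>.  For \<open>r0 = 0\<close>,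
  \<open>i = p - 1\<close> the rows instead form a triangular system for the values of \<open>P\<close>, which leaves indicator functions of a
  last digit.  In these cases the solutions of each class
  are at most a line, spanned by some \<open>F c\<close> with \<open>c\<close> in an interval of consecutive classes.  The
  substitution of \<open>X + Y\<close> for \<open>Y\<close> carries \<open>F c\<close> to a function with a nonzero part in class \<open>c + 1\<close>, and exchanging
  \<open>X\<close> and \<open>Y\<close> carries the last class of the interval back to the first.  Hence every nonzero functional
  generates all of them (\<open>irreducible_by_chain\<close>).  Only for \<open>i = a = p - 1\<close> does one class, that of \<open>0\<close>, carry a
  plane, and the same argument is run with more care.
\<close>

section \<open>Substitution in binary forms and the matrix action\<close>

lemma comm_ring_hom_const2: "comm_ring_hom (const2 :: 'a::comm_ring_1 \<Rightarrow> 'a poly poly)"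
  by unfold_locales (auto simp: const2_def one_pCons)

lemma comm_ring_hom_subst2:
  fixes P Q :: "'a::comm_ring_1 poly poly"
  shows "comm_ring_hom (subst2 P Q)"
proof -
  interpret c: map_poly_comm_ring_hom "const2 :: 'a \<Rightarrow> 'a poly poly"
    by (simp add: map_poly_comm_ring_hom_def comm_ring_hom_const2)
  have "comm_ring_hom (\<lambda>q. poly (map_poly const2 q) Q)"
    by unfold_locales (simp_all add: c.hom_add c.hom_mult)
  then interpret h: map_poly_comm_ring_hom "\<lambda>q. poly (map_poly const2 q) Q"
    by (simp add: map_poly_comm_ring_hom_def)
  show ?thesis
    unfolding subst2_def by unfold_locales (simp_all add: h.hom_add h.hom_mult)
qed

lemma subst2_add: "subst2 P Q (F + G) = subst2 P Q F + subst2 P Q G"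
  and subst2_mult: "subst2 P Q (F * G) = subst2 P Q F * subst2 P Q G"
  and subst2_power: "subst2 P Q (F ^ n) = subst2 P Q F ^ n"
  and subst2_diff: "subst2 P Q (F - G) = subst2 P Q F - subst2 P Q G"
  and subst2_0: "subst2 P Q 0 = 0"
  and subst2_sum: "subst2 P Q (sum f A) = (\<Sum>x\<in>A. subst2 P Q (f x))"
proof -
  interpret comm_ring_hom "subst2 P Q" by (rule comm_ring_hom_subst2)
  show "subst2 P Q (F + G) = subst2 P Q F + subst2 P Q G"
    "subst2 P Q (F * G) = subst2 P Q F * subst2 P Q G"
    "subst2 P Q (F ^ n) = subst2 P Q F ^ n"
    "subst2 P Q (F - G) = subst2 P Q F - subst2 P Q G"
    "subst2 P Q 0 = 0" "subst2 P Q (sum f A) = (\<Sum>x\<in>A. subst2 P Q (f x))"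
    by (simp_all add: hom_add hom_mult hom_power hom_minus hom_sum)
qed

lemma map_poly_linear: "h 0 = 0 \<Longrightarrow> map_poly h [:a, b:] = [:h a, h b:]"
  by (auto simp: poly_eq_iff coeff_map_poly coeff_pCons split: nat.splits)

lemma map_poly_const: "h 0 = 0 \<Longrightarrow> map_poly h [:a:] = [:h a:]"
  by (auto simp: poly_eq_iff coeff_map_poly coeff_pCons split: nat.splits)

lemma subst2_const2: "subst2 P Q (const2 c) = const2 c"
  by (simp add: subst2_def const2_def map_poly_const)

lemma subst2_varX: "subst2 P Q varX = P"
  by (simp add: subst2_def varX_def map_poly_linear const2_def map_poly_const flip: one_pCons)

lemma subst2_varY: "subst2 P Q varY = Q"
  by (simp add: subst2_def varY_def map_poly_linear map_poly_const const2_def flip: one_pCons)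

lemmas subst2_simps = subst2_add subst2_mult subst2_power subst2_diff subst2_0 subst2_const2
  subst2_varX subst2_varY

lemma const2_add: "const2 (a + b) = const2 a + const2 b"
  and const2_mult: "const2 (a * b) = const2 a * const2 b"
  and const2_0: "const2 0 = 0" and const2_1: "const2 1 = 1"
  and const2_diff: "const2 (a - b) = const2 a - const2 b"
  and const2_minus: "const2 (- a) = - const2 a"
  and const2_power: "const2 (a ^ n) = const2 a ^ n"
  by (simp_all add: const2_def poly_const_pow one_pCons)

lemma const2_of_nat: "const2 (of_nat n) = of_nat n"
  by (simp add: const2_def of_nat_poly)

lemma coeff_const2_mult: "coeff (coeff (const2 c * F) m) n = c * coeff (coeff F m) n"
  by (simp add: const2_def)

text \<open>
  A monomial of \<open>V_r\<close> is determined by its exponent of \<open>Y\<close>, which is the second argument.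
\<close>

definition bmono :: "nat \<Rightarrow> nat \<Rightarrow> 'a::comm_ring_1 poly poly" where
  "bmono m n = varX ^ m * varY ^ n"

lemma bmono_eq_monom: "bmono m n = monom (monom 1 n) m"
proof -
  have X: "(varX :: 'a poly poly) ^ m = monom 1 m"
    by (simp add: varX_def monom_altdef)
  have "(varY :: 'a poly poly) ^ n = [:[:0, 1:] ^ n:]"
    by (simp add: varY_def poly_const_pow)
  then show ?thesis
    by (simp add: bmono_def X monom_altdef mult.commute)
qed

lemma coeff_bmono: "coeff (coeff (bmono m n) k) l = (if k = m \<and> l = n then 1 else 0)"
  by (simp add: bmono_eq_monom)

lemma bmono_mult: "bmono m n * bmono m' n' = bmono (m + m') (n + n')"
  by (simp add: bmono_def power_add)

lemma poly_poly_eqI: "(\<And>m n. coeff (coeff F m) n = coeff (coeff G m) n) \<Longrightarrow> F = G"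
  by (simp add: poly_eq_iff)

lemma form_expand:
  assumes "F \<in> forms r"
  shows "F = (\<Sum>n\<le>r. const2 (coeff (coeff F (r - n)) n) * bmono (r - n) n)"
proof (rule poly_poly_eqI)
  fix k l
  have "coeff (coeff (\<Sum>n\<le>r. const2 (coeff (coeff F (r - n)) n) * bmono (r - n) n) k) l
    = (\<Sum>n\<le>r. coeff (coeff F (r - n)) n * (if k = r - n \<and> l = n then 1 else 0))"
    by (simp add: coeff_sum coeff_const2_mult coeff_bmono)
  also have "\<dots> = (\<Sum>n\<in>{..r}. if n = l then (if k = r - l then coeff (coeff F k) l else 0) else 0)"
    by (intro sum.cong) auto
  also have "\<dots> = (if l \<le> r \<and> k = r - l then coeff (coeff F k) l else 0)"
    by simp
  also have "\<dots> = coeff (coeff F k) l"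
    using assms unfolding forms_def by (metis (mono_tags, lifting) diff_add_inverse2 le_add2 mem_Collect_eq)
  finally show "coeff (coeff F k) l = coeff (coeff (\<Sum>n\<le>r. const2 (coeff (coeff F (r - n)) n) * bmono (r - n) n) k) l" ..
qed

lemma poly_poly_expand:
  fixes F :: "'a::comm_ring_1 poly poly"
  shows "\<exists>S. finite S \<and> F = (\<Sum>(m,n)\<in>S. const2 (coeff (coeff F m) n) * bmono m n)"
proof -
  define D where "D = Max (degree ` coeff F ` {..degree F})"
  define S where "S = {..degree F} \<times> {..D}"
  have D: "coeff (coeff F m) n = 0" if "n > D \<or> m > degree F" for m n
  proof (cases "m > degree F")
    case False
    then have "degree (coeff F m) \<le> D"
      unfolding D_def by (intro Max_ge) auto
    with that False show ?thesis by (simp add: coeff_eq_0)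
  qed (simp add: coeff_eq_0)
  have "F = (\<Sum>(m,n)\<in>S. const2 (coeff (coeff F m) n) * bmono m n)"
  proof (rule poly_poly_eqI)
    fix k l
    have "coeff (coeff (\<Sum>(m,n)\<in>S. const2 (coeff (coeff F m) n) * bmono m n) k) l
      = (\<Sum>x\<in>S. if x = (k,l) then coeff (coeff F k) l else 0)"
      by (auto simp: coeff_sum coeff_const2_mult coeff_bmono intro!: sum.cong)
    also have "\<dots> = coeff (coeff F k) l"
      using D[of l k] by (auto simp: S_def)
    finally show "coeff (coeff F k) l
      = coeff (coeff (\<Sum>(m,n)\<in>S. const2 (coeff (coeff F m) n) * bmono m n) k) l" ..
  qed
  then show ?thesis by (intro exI[of _ S]) (simp add: S_def)
qed

text \<open>
  The action of \<open>Vmod r\<close>, which does not depend on \<open>r\<close>.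
\<close>

definition gact :: "'p::prime_card mod_ring ^ 2 ^ 2 \<Rightarrow> 'p mod_ring poly poly \<Rightarrow> 'p mod_ring poly poly" where
  "gact A = subst2 (const2 (A $ 1 $ 1) * varX + const2 (A $ 2 $ 1) * varY)
                   (const2 (A $ 1 $ 2) * varX + const2 (A $ 2 $ 2) * varY)"

lemma gact_bmono:
  "gact A (bmono m n) = (const2 (A $ 1 $ 1) * varX + const2 (A $ 2 $ 1) * varY) ^ m
     * (const2 (A $ 1 $ 2) * varX + const2 (A $ 2 $ 2) * varY) ^ n"
  by (simp add: gact_def bmono_def subst2_simps)

lemma gact_add: "gact A (F + G) = gact A F + gact A G"
  and gact_const2_mult: "gact A (const2 c * F) = const2 c * gact A F"
  and gact_mult: "gact A (F * G) = gact A F * gact A G"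
  and gact_power: "gact A (F ^ n) = gact A F ^ n"
  and gact_sum: "gact A (sum f S) = (\<Sum>x\<in>S. gact A (f x))"
  and gact_0: "gact A 0 = 0"
  by (simp_all add: gact_def subst2_simps subst2_sum)

text \<open>
  Both sides are ring homomorphisms fixing constants and agree on \<open>X\<close> and \<open>Y\<close>, hence on monomials.
\<close>

lemma subst2_compose: "subst2 P Q (subst2 P' Q' F) = subst2 (subst2 P Q P') (subst2 P Q Q') F"
proof -
  obtain S where S: "F = (\<Sum>(m,n)\<in>S. const2 (coeff (coeff F m) n) * bmono m n)"
    using poly_poly_expand by blast
  show ?thesis
    by (subst (1 2) S) (auto simp: subst2_sum subst2_simps bmono_def intro!: sum.cong)
qed

lemma gact_gact: "gact A (gact B F) = gact (A ** B) F"
  unfolding gact_def subst2_compose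
  by (intro arg_cong2[where f = "\<lambda>P Q. subst2 P Q F"])
    (simp_all add: subst2_simps matrix_matrix_mult_def sum_2 const2_add const2_mult algebra_simps)

lemma gact_id: "gact (mat 1) F = F"
proof -
  obtain S where S: "F = (\<Sum>(m,n)\<in>S. const2 (coeff (coeff F m) n) * bmono m n)"
    using poly_poly_expand by blast
  show ?thesis
    by (subst (1 2) S) (auto simp: gact_sum gact_const2_mult gact_bmono mat_def const2_0 const2_1
        bmono_def[symmetric] intro!: sum.cong)
qed

lemma forms_0: "0 \<in> forms r" and forms_add: "F \<in> forms r \<Longrightarrow> G \<in> forms r \<Longrightarrow> F + G \<in> forms r"
  and forms_uminus: "F \<in> forms r \<Longrightarrow> - F \<in> forms r"
  and forms_const2_mult: "F \<in> forms r \<Longrightarrow> const2 c * F \<in> forms r"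
  unfolding forms_def by (auto simp: coeff_const2_mult, metis add.right_neutral, metis mult_zero_right)

lemma forms_sum: "(\<And>x. x \<in> S \<Longrightarrow> f x \<in> forms r) \<Longrightarrow> sum f S \<in> forms r"
  by (induction S rule: infinite_finite_induct) (auto simp: forms_0 forms_add)

lemma forms_bmono: "m + n = r \<Longrightarrow> bmono m n \<in> forms r"
  by (auto simp: forms_def coeff_bmono split: if_splits)

lemma forms_mult:
  fixes F G :: "'a::comm_ring_1 poly poly"
  assumes F: "F \<in> forms r" and G: "G \<in> forms s"
  shows "F * G \<in> forms (r + s)"
  by (subst form_expand[OF F], subst form_expand[OF G])
    (auto simp: sum_product bmono_mult mult.assoc mult.left_commute[of "bmono _ _"]
      intro!: forms_sum forms_const2_mult forms_bmono)

lemma forms_power: "F \<in> forms r \<Longrightarrow> F ^ n \<in> forms (r * n)"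
proof (induction n)
  case 0
  then show ?case using forms_bmono[of 0 0 0, where 'a='a] by (simp add: bmono_def)
qed (use forms_mult in fastforce)

lemma forms_linear: "const2 a * varX + const2 c * varY \<in> forms 1"
  using forms_bmono[of 1 0 1] forms_bmono[of 0 1 1]
  by (auto simp: bmono_def intro!: forms_add forms_const2_mult)

lemma gact_forms:
  assumes "F \<in> forms r" shows "gact A F \<in> forms r"
proof -
  have "gact A (bmono (r - n) n) \<in> forms r" if "n \<le> r" for n
    using forms_mult[OF forms_power[OF forms_linear, of _ _ "r - n"] forms_power[OF forms_linear, of _ _ n]] that
    by (simp add: gact_bmono)
  then show ?thesis
    by (subst form_expand[OF assms])
      (auto simp: gact_sum gact_const2_mult intro!: forms_sum forms_const2_mult)
qed

section \<open>Submodules as stable subspaces\<close>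

text \<open>
  The \<open>\<Gamma>\<close>-submodules of \<open>V_r\<close> in elementary terms, free of the module and group records.
\<close>

definition stable_subspace :: "nat \<Rightarrow> 'p::prime_card mod_ring poly poly set \<Rightarrow> bool" where
  "stable_subspace r H \<longleftrightarrow> H \<subseteq> forms r \<and> 0 \<in> H \<and> (\<forall>F\<in>H. \<forall>G\<in>H. F + G \<in> H) \<and>
     (\<forall>c. \<forall>F\<in>H. const2 c * F \<in> H) \<and> (\<forall>A\<in>GL2. \<forall>F\<in>H. gact A F \<in> H)"

lemma Vmod_simps:
  "carrier (Vmod r) = forms r" "zero (Vmod r) = 0" "add (Vmod r) = (+)"
  "module.smult (Vmod r) = (\<lambda>c F. const2 c * F)" "act (Vmod r) = gact"
  by (simp_all add: Vmod_def gact_def[abs_def])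

lemma stable_subspace_uminus: "stable_subspace r H \<Longrightarrow> F \<in> H \<Longrightarrow> - F \<in> H"
  unfolding stable_subspace_def
  by (metis const2_1 const2_minus mult_1 mult_minus_left)

lemma m_inv_add_monoid_Vmod:
  assumes "F \<in> forms r"
  shows "m_inv (add_monoid (Vmod r)) F = - F"
  unfolding m_inv_def
  by (rule the_equality) (use assms in \<open>auto simp: Vmod_simps forms_uminus eq_neg_iff_add_eq_0\<close>)

lemma gsubmodule_Vmod_iff: "gsubmodule Fp GL2 (Vmod r) H \<longleftrightarrow> stable_subspace r H"
proof
  assume "gsubmodule Fp GL2 (Vmod r) H"
  then have sub: "submodule H Fp (Vmod r)" and ac: "\<forall>A\<in>GL2. \<forall>v\<in>H. gact A v \<in> H"
    by (auto simp: gsubmodule_def Vmod_simps)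
  then interpret submodule H Fp "Vmod r" by simp
  show "stable_subspace r H"
    using subset one_closed m_closed smult_closed ac
    by (auto simp: stable_subspace_def Vmod_simps Fp_def)
next
  assume H: "stable_subspace r H"
  have "submodule H Fp (Vmod r)"
  proof (intro submodule.intro subgroup.intro submodule_axioms.intro)
    show "inv\<^bsub>add_monoid (Vmod r)\<^esub> x \<in> H" if "x \<in> H" for x
      using that H stable_subspace_uminus[OF H that]
      by (subst m_inv_add_monoid_Vmod) (auto simp: stable_subspace_def)
  qed (use H in \<open>auto simp: stable_subspace_def Vmod_simps\<close>)
  with H show "gsubmodule Fp GL2 (Vmod r) H"
    by (auto simp: gsubmodule_def stable_subspace_def Vmod_simps)
qed

text \<open>
  The correspondence theorem: submodules of a quotient by \<open>W\<close> are the sets of cosets of the stable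
  subspaces between \<open>W\<close> and \<open>V_r\<close>.
\<close>

lemma girreducible_quotient_iff:
  assumes W: "stable_subspace r W"
  shows "girreducible Fp GL2 (gquotient (Vmod r) W) \<longleftrightarrow>
    W \<noteq> forms r \<and> (\<forall>H. stable_subspace r H \<and> W \<subseteq> H \<longrightarrow> H = W \<or> H = forms r)"
proof -
  define cos where "cos v = {w + v | w. w \<in> W}" for v
  define Q where "Q = gquotient (Vmod r) W"
  have Wsub: "W \<subseteq> forms r" and W0: "0 \<in> W"
    and Wadd: "\<And>F G. F \<in> W \<Longrightarrow> G \<in> W \<Longrightarrow> F + G \<in> W"
    and Wsm: "\<And>c F. F \<in> W \<Longrightarrow> const2 c * F \<in> W"
    and Wact: "\<And>A F. A \<in> GL2 \<Longrightarrow> F \<in> W \<Longrightarrow> gact A F \<in> W"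
    using W by (auto simp: stable_subspace_def)
  have Wminus: "\<And>F. F \<in> W \<Longrightarrow> - F \<in> W" using stable_subspace_uminus[OF W] .
  have Wdiff: "F - G \<in> W" if "F \<in> W" "G \<in> W" for F G
    using Wadd[OF that(1) Wminus[OF that(2)]] by simp
  have cos_iff: "u \<in> cos v \<longleftrightarrow> u - v \<in> W" for u v
    by (auto simp: cos_def intro!: exI[of _ "u - v"])
  have cos_eq: "cos u = cos v \<longleftrightarrow> u - v \<in> W" for u v
  proof
    assume "cos u = cos v"
    then show "u - v \<in> W" using cos_iff[of u v] cos_iff[of u u] W0 by simp
  next
    assume uv: "u - v \<in> W"
    have "x - u \<in> W \<longleftrightarrow> x - v \<in> W" for x
      using Wadd[OF _ uv, of "x - u"] Wdiff[OF _ uv, of "x - v"] by auto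
    then show "cos u = cos v" by (auto simp: cos_iff)
  qed
  have rcos: "W +>\<^bsub>Vmod r\<^esub> v = cos v" for v
    by (auto simp: a_r_coset_def r_coset_def cos_def Vmod_simps)
  have carr: "carrier Q = cos ` forms r"
    unfolding Q_def gquotient_def A_RCOSETS_def RCOSETS_def rcos[unfolded a_r_coset_def]
    by (auto simp: Vmod_simps)
  have zer: "\<zero>\<^bsub>Q\<^esub> = cos 0"
    by (auto simp: Q_def gquotient_def cos_def)
  have addQ: "cos u \<oplus>\<^bsub>Q\<^esub> cos v = cos (u + v)" for u v
  proof -
    have "cos u \<oplus>\<^bsub>Q\<^esub> cos v = {x + y | x y. x \<in> cos u \<and> y \<in> cos v}"
      by (auto simp: Q_def gquotient_def set_add_def set_mult_def Vmod_simps)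
    also have "\<dots> = cos (u + v)"
    proof (intro equalityI subsetI)
      fix z assume "z \<in> {x + y | x y. x \<in> cos u \<and> y \<in> cos v}"
      then obtain x y where "z = x + y" "x - u \<in> W" "y - v \<in> W" by (auto simp: cos_iff)
      then show "z \<in> cos (u + v)" using Wadd[of "x - u" "y - v"] by (simp add: cos_iff algebra_simps)
    next
      fix z assume "z \<in> cos (u + v)"
      then have "z = (z - v) + v \<and> z - v \<in> cos u \<and> v \<in> cos v"
        using W0 by (simp add: cos_iff algebra_simps)
      then show "z \<in> {x + y | x y. x \<in> cos u \<and> y \<in> cos v}" by blast
    qed
    finally show ?thesis .
  qed
  have smQ: "c \<odot>\<^bsub>Q\<^esub> cos v = cos (const2 c * v)" for c v
  proof -
    have m: "v \<in> cos v" by (simp add: cos_iff W0)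
    have e: "\<forall>u\<in>cos v. cos (const2 c * u) = cos (const2 c * v)"
    proof
      fix u assume "u \<in> cos v"
      then have "const2 c * u - const2 c * v \<in> W"
        using Wsm[of "u - v" c] unfolding cos_iff right_diff_distrib by blast
      then show "cos (const2 c * u) = cos (const2 c * v)" unfolding cos_eq .
    qed
    show ?thesis
      unfolding Q_def gquotient_def
      by (simp only: gmodule.simps module.simps Vmod_simps rcos UN_constant_eq[OF m e])
  qed
  have actQ: "act Q A (cos v) = cos (gact A v)" if "A \<in> GL2" for A v
  proof -
    have m: "v \<in> cos v" by (simp add: cos_iff W0)
    have e: "\<forall>u\<in>cos v. cos (gact A u) = cos (gact A v)"
    proof
      fix u assume "u \<in> cos v"
      then have "gact A u - gact A v \<in> W"
        using Wact[OF that, of "u - v"] unfolding cos_iff gact_def subst2_diff by blast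
      then show "cos (gact A u) = cos (gact A v)" unfolding cos_eq .
    qed
    show ?thesis
      unfolding Q_def gquotient_def
      by (simp only: gmodule.simps module.simps Vmod_simps rcos UN_constant_eq[OF m e])
  qed
  have inv: "m_inv (add_monoid Q) (cos v) = cos (- v)" if v: "v \<in> forms r" for v
    unfolding m_inv_def
  proof (rule the_equality)
    show "cos (- v) \<in> carrier (add_monoid Q) \<and>
      cos v \<otimes>\<^bsub>add_monoid Q\<^esub> cos (- v) = \<one>\<^bsub>add_monoid Q\<^esub> \<and>
      cos (- v) \<otimes>\<^bsub>add_monoid Q\<^esub> cos v = \<one>\<^bsub>add_monoid Q\<^esub>"
      using v by (auto simp: carr forms_uminus addQ zer)
  next
    fix y assume y: "y \<in> carrier (add_monoid Q) \<and>
      cos v \<otimes>\<^bsub>add_monoid Q\<^esub> y = \<one>\<^bsub>add_monoid Q\<^esub> \<and>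
      y \<otimes>\<^bsub>add_monoid Q\<^esub> cos v = \<one>\<^bsub>add_monoid Q\<^esub>"
    then obtain u where u: "y = cos u" by (auto simp: carr)
    with y have "cos (v + u) = cos 0" by (simp add: addQ zer)
    then show "y = cos (- v)" by (simp add: u cos_eq add.commute)
  qed
  have pull: "stable_subspace r {v \<in> forms r. cos v \<in> K}" if K: "gsubmodule Fp GL2 Q K" for K
  proof -
    from K interpret submodule K Fp Q by (simp add: gsubmodule_def)
    have "cos 0 \<in> K" using one_closed by (simp add: zer)
    moreover have "cos (u + v) \<in> K" if "cos u \<in> K" "cos v \<in> K" for u v
      using m_closed[OF that] by (simp add: addQ)
    moreover have "cos (const2 c * v) \<in> K" if "cos v \<in> K" for c v
      using smult_closed[of c, OF _ that] by (simp add: smQ Fp_def)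
    moreover have "cos (gact A v) \<in> K" if "cos v \<in> K" "A \<in> GL2" for A v
    proof -
      have "act Q A (cos v) \<in> K" using K that by (simp add: gsubmodule_def)
      then show ?thesis by (simp only: actQ[OF that(2)])
    qed
    ultimately show ?thesis
      by (auto simp: stable_subspace_def forms_0 forms_add forms_const2_mult gact_forms)
  qed
  have push: "gsubmodule Fp GL2 Q (cos ` H)" if H: "stable_subspace r H" for H
  proof -
    have sub: "H \<subseteq> forms r" using H by (simp add: stable_subspace_def)
    have "submodule (cos ` H) Fp Q"
    proof (intro submodule.intro subgroup.intro submodule_axioms.intro)
      show "cos ` H \<subseteq> carrier (add_monoid Q)" using sub by (auto simp: carr)
      show "x \<otimes>\<^bsub>add_monoid Q\<^esub> y \<in> cos ` H" if "x \<in> cos ` H" "y \<in> cos ` H" for x y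
        using that H by (auto simp: addQ stable_subspace_def)
      show "\<one>\<^bsub>add_monoid Q\<^esub> \<in> cos ` H" using H by (auto simp: zer stable_subspace_def)
      show "inv\<^bsub>add_monoid Q\<^esub> x \<in> cos ` H" if "x \<in> cos ` H" for x
        using that sub stable_subspace_uminus[OF H] by (auto simp: inv subset_iff)
      show "c \<odot>\<^bsub>Q\<^esub> x \<in> cos ` H" if "c \<in> carrier Fp" "x \<in> cos ` H" for c x
        using that H by (auto simp: smQ stable_subspace_def)
    qed
    moreover have "act Q A x \<in> cos ` H" if "A \<in> GL2" "x \<in> cos ` H" for A x
      using that H by (auto simp: actQ stable_subspace_def)
    ultimately show ?thesis by (simp add: gsubmodule_def)
  qed
  have triv: "carrier Q = {\<zero>\<^bsub>Q\<^esub>} \<longleftrightarrow> W = forms r"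
  proof
    assume "carrier Q = {\<zero>\<^bsub>Q\<^esub>}"
    then have "cos v = cos 0" if "v \<in> forms r" for v using that by (auto simp: carr zer)
    then show "W = forms r" using Wsub by (auto simp: cos_eq)
  next
    assume "W = forms r"
    then have "cos v = cos 0" if "v \<in> forms r" for v using that by (simp add: cos_eq)
    then show "carrier Q = {\<zero>\<^bsub>Q\<^esub>}" using forms_0 by (auto simp: carr zer)
  qed
  show ?thesis
    unfolding girreducible_def Q_def[symmetric] triv
  proof (intro conj_cong refl iffI allI impI)
    fix H
    assume K: "\<forall>K. gsubmodule Fp GL2 Q K \<longrightarrow> K = {\<zero>\<^bsub>Q\<^esub>} \<or> K = carrier Q"
      and H: "stable_subspace r H \<and> W \<subseteq> H"
    then have "cos ` H = {cos 0} \<or> cos ` H = cos ` forms r"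
      using push[of H] by (simp add: zer carr)
    then show "H = W \<or> H = forms r"
    proof
      assume "cos ` H = {cos 0}"
      then have "H \<subseteq> W" by (auto simp: cos_eq image_subset_iff dest!: equalityD1)
      then show ?thesis using H by blast
    next
      assume e: "cos ` H = cos ` forms r"
      have "v \<in> H" if "v \<in> forms r" for v
      proof -
        from e that obtain u where u: "u \<in> H" "cos v = cos u" by blast
        then have "v - u \<in> H" using H by (auto simp: cos_eq)
        then have "v - u + u \<in> H" using u H unfolding stable_subspace_def by blast
        then show ?thesis by simp
      qed
      then show ?thesis using H by (auto simp: stable_subspace_def)
    qed
  next
    fix K
    assume H: "\<forall>H. stable_subspace r H \<and> W \<subseteq> H \<longrightarrow> H = W \<or> H = forms r"
      and K: "gsubmodule Fp GL2 Q K"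
    define H' where "H' = {v \<in> forms r. cos v \<in> K}"
    from K interpret submodule K Fp Q by (simp add: gsubmodule_def)
    have K0: "cos 0 \<in> K" using one_closed by (simp add: zer)
    have KH: "K = cos ` H'" using subset by (auto simp: H'_def carr)
    have "W \<subseteq> H'"
    proof
      fix w assume "w \<in> W"
      then have "cos w = cos 0" by (simp add: cos_eq)
      then show "w \<in> H'" using K0 \<open>w \<in> W\<close> Wsub by (auto simp: H'_def)
    qed
    then have "H' = W \<or> H' = forms r" using H pull[OF K] by (simp add: H'_def)
    then show "K = {\<zero>\<^bsub>Q\<^esub>} \<or> K = carrier Q"
    proof
      assume "H' = W"
      moreover have "cos x = cos 0" if "x \<in> W" for x using that cos_eq[of x 0] by simp
      ultimately have "K \<subseteq> {cos 0}" unfolding KH by blast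
      then show ?thesis using K0 by (auto simp: zer)
    qed (simp add: KH carr)
  qed
qed

lemma gspan_Vmod: 
  assumes "S \<subseteq> forms r"
  shows "stable_subspace r (gspan Fp GL2 (Vmod r) S)" "S \<subseteq> gspan Fp GL2 (Vmod r) S"
    "\<And>H. stable_subspace r H \<Longrightarrow> S \<subseteq> H \<Longrightarrow> gspan Fp GL2 (Vmod r) S \<subseteq> H"
proof -
  have "stable_subspace r (forms r :: 'a mod_ring poly poly set)"
    by (auto simp: stable_subspace_def forms_0 forms_add forms_const2_mult gact_forms)
  with assms show "stable_subspace r (gspan Fp GL2 (Vmod r) S)"
    unfolding gspan_def gsubmodule_Vmod_iff stable_subspace_def[of r "\<Inter> _"]
    by (auto simp: stable_subspace_def)
qed (auto simp: gspan_def gsubmodule_Vmod_iff)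

section \<open>Stability of the relations of the quotient\<close>

text \<open>
  \<open>\<theta>\<close> is the Dickson invariant: by Frobenius, \<open>(aX + cY)^p = aX^p + cY^p\<close>, so a matrix acts on it
  as on the determinant form \<open>X^p Y - X Y^p\<close> of the two rows \<open>(X, Y)\<close> and \<open>(X^p, Y^p)\<close>.
\<close>

lemma theta_gact: "gact A theta = const2 (A $ 1 $ 1 * A $ 2 $ 2 - A $ 2 $ 1 * A $ 1 $ 2) * theta"
  for A :: "'p::prime_card mod_ring ^ 2 ^ 2"
proof -
  have det: "(a * Xp + b * Yp) * (c * X + d * Y) - (a * X + b * Y) * (c * Xp + d * Yp)
    = (a * d - b * c) * (Xp * Y - X * Yp)" for a b c d X Y Xp Yp :: "'p mod_ring poly poly"
    by (simp add: algebra_simps)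
  have fermat: "c ^ CARD('p) = c" for c :: "'p mod_ring"
  proof (cases "c = 0")
    case False
    then show ?thesis using finite_field_power_card_eq_same[of c] by simp
  qed simp
  have fr: "(const2 a * varX + const2 b * varY) ^ CARD('p)
    = const2 a * varX ^ CARD('p) + const2 b * varY ^ CARD('p)" for a b :: "'p mod_ring"
  proof -
    have "(const2 a * varX + const2 b * varY) ^ CARD('p)
      = (const2 a * varX) ^ CARD('p) + (const2 b * varY) ^ CARD('p)"
      by (rule freshmans_dream) (simp_all add: prime_card)
    then show ?thesis by (simp add: power_mult_distrib fermat flip: const2_power)
  qed
  show ?thesis
    unfolding gact_def theta_def subst2_simps fr const2_diff const2_mult by (rule det)
qed

lemma theta_forms: "theta \<in> (forms (CARD('p) + 1) :: 'p::prime_card mod_ring poly poly set)"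
proof -
  have e: "theta = bmono CARD('p) 1 + const2 (- 1) * (bmono 1 CARD('p) :: 'p mod_ring poly poly)"
    by (simp add: theta_def bmono_def const2_minus const2_1)
  show ?thesis unfolding e by (auto intro!: forms_add forms_const2_mult forms_bmono)
qed

lemma stable_subspace_Vfilt: "stable_subspace r (Vfilt r m)"
proof -
  have "theta ^ m dvd gact A F" if d: "theta ^ m dvd F" for A :: "'a mod_ring ^ 2 ^ 2" and F
  proof -
    from d obtain G where "F = theta ^ m * G" by (rule dvdE)
    then show ?thesis by (simp add: gact_mult gact_power theta_gact power_mult_distrib)
  qed
  then show ?thesis
    by (auto simp: stable_subspace_def Vfilt_def Vmod_simps forms_0 forms_add forms_const2_mult
      gact_forms)
qed

lemma bmono_in_forms_Xsub: "i \<le> r \<Longrightarrow> {varX ^ (r - i) * varY ^ i} \<subseteq> forms r"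
  using forms_bmono[of "r - i" i r] by (simp add: bmono_def)

text \<open>
  The subspace \<open>X\<^bsub>r-i\<^esub> + V^(i+1)\<close> by which \<open>Qmod r i\<close> is the quotient.
\<close>

definition relations :: "nat \<Rightarrow> nat \<Rightarrow> 'p::prime_card mod_ring poly poly set" where
  "relations r i = {F + G | F G. F \<in> Xsub r i \<and> G \<in> Vfilt r (i + 1)}"

lemma Qmod_eq: "Qmod r i = gquotient (Vmod r) (relations r i)"
proof -
  have "Xsub r i <+>\<^bsub>Vmod r\<^esub> Vfilt r (i + 1) = relations r i"
    by (auto simp: relations_def set_add_def set_mult_def Vmod_simps)
  then show ?thesis unfolding Qmod_def by (rule arg_cong)
qed

lemma stable_subspace_sum:
  fixes H K :: "'p::prime_card mod_ring poly poly set"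
  assumes "stable_subspace r H" "stable_subspace r K"
  shows "stable_subspace r {F + G | F G. F \<in> H \<and> G \<in> K}"
  unfolding stable_subspace_def
proof (intro conjI ballI allI)
  show "{F + G | F G. F \<in> H \<and> G \<in> K} \<subseteq> forms r"
  proof
    fix F assume "F \<in> {F + G | F G. F \<in> H \<and> G \<in> K}"
    then obtain a b where e: "F = a + b" and m: "a \<in> H" "b \<in> K" by blast
    have "a \<in> forms r" "b \<in> forms r"
      using assms m unfolding stable_subspace_def by blast+
    then show "F \<in> forms r" unfolding e by (rule forms_add)
  qed
  show "0 \<in> {F + G | F G. F \<in> H \<and> G \<in> K}"
  proof -
    have "0 = 0 + (0::'p mod_ring poly poly) \<and> 0 \<in> H \<and> 0 \<in> K"
      using assms by (simp add: stable_subspace_def)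
    then show ?thesis by blast
  qed
next
  fix F G assume "F \<in> {F + G | F G. F \<in> H \<and> G \<in> K}" "G \<in> {F + G | F G. F \<in> H \<and> G \<in> K}"
  then obtain a b c d where e: "F = a + b" "G = c + d" and m: "a \<in> H" "b \<in> K" "c \<in> H" "d \<in> K"
    by blast
  have "F + G = (a + c) + (b + d)" unfolding e by (simp add: add_ac)
  moreover have "a + c \<in> H" "b + d \<in> K"
    using assms m unfolding stable_subspace_def by blast+
  ultimately show "F + G \<in> {F + G | F G. F \<in> H \<and> G \<in> K}" by blast
next
  fix c F assume "F \<in> {F + G | F G. F \<in> H \<and> G \<in> K}"
  then obtain a b where e: "F = a + b" and m: "a \<in> H" "b \<in> K" by blast
  have "const2 c * F = const2 c * a + const2 c * b" unfolding e by (rule distrib_left)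
  moreover have "const2 c * a \<in> H" "const2 c * b \<in> K"
    using assms m unfolding stable_subspace_def by blast+
  ultimately show "const2 c * F \<in> {F + G | F G. F \<in> H \<and> G \<in> K}" by blast
next
  fix A :: "'p mod_ring ^ 2 ^ 2" and F assume A: "A \<in> GL2" and "F \<in> {F + G | F G. F \<in> H \<and> G \<in> K}"
  then obtain a b where e: "F = a + b" and m: "a \<in> H" "b \<in> K" by blast
  have "gact A F = gact A a + gact A b" unfolding e by (rule gact_add)
  moreover have "gact A a \<in> H" "gact A b \<in> K"
    using assms m A unfolding stable_subspace_def by blast+
  ultimately show "gact A F \<in> {F + G | F G. F \<in> H \<and> G \<in> K}" by blast
qed

lemma stable_subspace_relations:
  assumes "i \<le> r" shows "stable_subspace r (relations r i)"
  unfolding relations_def Xsub_def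
  using stable_subspace_sum[OF gspan_Vmod(1)[OF bmono_in_forms_Xsub[OF assms]] stable_subspace_Vfilt] .

section \<open>Duality between forms and functions on exponents\<close>

text \<open>
  A functional on \<open>V_r\<close> is stored through its values \<open>g n\<close> on the monomials \<open>X^(r-n) Y^n\<close>; values at
  \<open>n > r\<close> are irrelevant, which is why equalities of functionals are only asserted for \<open>n \<le> r\<close>.
\<close>

definition pairing :: "nat \<Rightarrow> (nat \<Rightarrow> 'a::comm_ring_1) \<Rightarrow> 'a poly poly \<Rightarrow> 'a" where
  "pairing r g F = (\<Sum>n\<le>r. g n * coeff (coeff F (r - n)) n)"

definition annih :: "nat \<Rightarrow> 'a::comm_ring_1 poly poly set \<Rightarrow> (nat \<Rightarrow> 'a) set" where
  "annih r H = {g. \<forall>F\<in>H. pairing r g F = 0}"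

lemma pairing_add: "pairing r g (F + G) = pairing r g F + pairing r g G"
  by (simp add: pairing_def distrib_left sum.distrib)

lemma pairing_const2_mult: "pairing r g (const2 c * F) = c * pairing r g F"
  by (simp add: pairing_def coeff_const2_mult sum_distrib_left mult.left_commute)

lemma pairing_of_nat_mult: "pairing r g (of_nat k * F) = of_nat k * pairing r g F"
  using pairing_const2_mult[of r g "of_nat k" F] by (simp add: const2_of_nat)

lemma pairing_0: "pairing r g 0 = 0"
  by (simp add: pairing_def)

lemma pairing_sum: "pairing r g (sum f S) = (\<Sum>x\<in>S. pairing r g (f x))"
  by (induction S rule: infinite_finite_induct) (simp_all add: pairing_0 pairing_add)

lemma pairing_bmono: "pairing r g (bmono a b) = (if a + b = r then g b else 0)"
proof -
  have "pairing r g (bmono a b) = (\<Sum>n\<le>r. if n = b then (if a + b = r then g b else 0) else 0)"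
    unfolding pairing_def by (intro sum.cong) (auto simp: coeff_bmono)
  then show ?thesis by auto
qed

lemma annih_add: "g \<in> annih r H \<Longrightarrow> h \<in> annih r H \<Longrightarrow> (\<lambda>n. g n + h n) \<in> annih r H"
  by (simp add: annih_def pairing_def distrib_right sum.distrib)

lemma annih_0: "(\<lambda>n. 0) \<in> annih r H"
  by (simp add: annih_def pairing_def)

lemma annih_scale: "g \<in> annih r H \<Longrightarrow> (\<lambda>n. c * g n) \<in> annih r H"
  by (simp add: annih_def pairing_def mult.assoc flip: sum_distrib_left)

lemma annih_sum: "(\<And>x. x \<in> S \<Longrightarrow> f x \<in> annih r H) \<Longrightarrow> (\<lambda>n. \<Sum>x\<in>S. f x n) \<in> annih r H"
  by (induction S rule: infinite_finite_induct) (simp_all add: annih_0 annih_add)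

lemma annih_cong: "g \<in> annih r H \<Longrightarrow> (\<And>n. n \<le> r \<Longrightarrow> g n = h n) \<Longrightarrow> h \<in> annih r H"
  unfolding annih_def pairing_def by simp

lemma annih_antimono: "H \<subseteq> K \<Longrightarrow> annih r K \<subseteq> annih r H"
  by (auto simp: annih_def)

text \<open>
  The action on functionals dual to that of \<open>A\<close> on forms.
\<close>

definition transpose_action :: "nat \<Rightarrow> 'p::prime_card mod_ring ^ 2 ^ 2 \<Rightarrow> (nat \<Rightarrow> 'p mod_ring) \<Rightarrow> nat \<Rightarrow> 'p mod_ring" where
  "transpose_action r A g n = pairing r g (gact A (bmono (r - n) n))"

lemma pairing_transpose_action:
  assumes "F \<in> forms r"
  shows "pairing r (transpose_action r A g) F = pairing r g (gact A F)"
proof -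
  have "pairing r g (gact A F)
    = pairing r g (gact A (\<Sum>n\<le>r. const2 (coeff (coeff F (r - n)) n) * bmono (r - n) n))"
    using form_expand[OF assms] by simp
  also have "\<dots> = pairing r (transpose_action r A g) F"
    unfolding gact_sum gact_const2_mult pairing_sum pairing_const2_mult pairing_def[of _ "transpose_action r A g"]
        transpose_action_def by (intro sum.cong refl mult.commute)
  finally show ?thesis ..
qed

lemma annih_transpose_action:
  assumes "stable_subspace r H" "A \<in> GL2" "g \<in> annih r H"
  shows "transpose_action r A g \<in> annih r H"
  unfolding annih_def
proof (safe)
  fix F assume F: "F \<in> H"
  then have "F \<in> forms r" "gact A F \<in> H"
    using assms(1,2) unfolding stable_subspace_def by blast+
  then show "pairing r (transpose_action r A g) F = 0"
    using assms(3) by (simp add: pairing_transpose_action annih_def)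
qed

text \<open>
  Linear algebra over the field: extend a basis of \<open>H\<close> by \<open>F\<close> and take a coordinate functional.  With
  this, a stable subspace is determined by its annihilator.
\<close>

lemma separating_functional:
  fixes H :: "'p::prime_card mod_ring poly poly set"
  assumes H: "stable_subspace r H" and F: "F \<in> forms r" "F \<notin> H"
  shows "\<exists>g \<in> annih r H. pairing r g F \<noteq> 0"
proof -
  define sc :: "'p mod_ring \<Rightarrow> 'p mod_ring poly poly \<Rightarrow> 'p mod_ring poly poly"
    where "sc = (\<lambda>c F. const2 c * F)"
  interpret V: vector_space sc
    by unfold_locales (simp_all add: sc_def const2_add const2_mult const2_1 distrib_left distrib_right mult.assoc)
  interpret K: vector_space "(*) :: 'p mod_ring \<Rightarrow> 'p mod_ring \<Rightarrow> 'p mod_ring"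
    by unfold_locales (simp_all add: distrib_left distrib_right)
  interpret P: vector_space_pair sc "(*) :: 'p mod_ring \<Rightarrow> 'p mod_ring \<Rightarrow> 'p mod_ring" ..
  have sub: "V.subspace H"
    by (rule V.subspaceI) (use H in \<open>simp_all add: stable_subspace_def sc_def\<close>)
  obtain B where B: "B \<subseteq> H" "V.independent B" "H \<subseteq> V.span B"
    using V.maximal_independent_subset[of H] by blast
  have spB: "V.span B \<subseteq> H" using V.span_minimal[OF B(1) sub] .
  have ind: "V.independent (insert F B)"
    using B(2) spB F(2) V.independent_insertI by blast
  obtain \<phi> where lin: "Vector_Spaces.linear sc (*) \<phi>" and \<phi>: "\<forall>x\<in>insert F B. \<phi> x = (if x = F then 1 else 0)"
    using P.linear_independent_extend[OF ind, of "\<lambda>x. if x = F then 1 else 0"] by blast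
  define g where "g n = \<phi> (bmono (r - n) n)" for n
  have \<phi>eq: "pairing r g G = \<phi> G" if "G \<in> forms r" for G
  proof -
    have "\<phi> G = \<phi> (\<Sum>n\<le>r. sc (coeff (coeff G (r - n)) n) (bmono (r - n) n))"
      using form_expand[OF that] by (simp add: sc_def)
    also have "\<dots> = pairing r g G"
      unfolding P.linear_sum[OF lin] P.linear_scale[OF lin] pairing_def g_def by (simp add: mult.commute)
    finally show ?thesis ..
  qed
  have "\<phi> G = 0" if "G \<in> H" for G
  proof -
    have "\<phi> x = 0" if "x \<in> B" for x
      using \<phi> that F(2) B(1) by auto
    moreover have "G \<in> V.span B" using that B(3) by blast
    ultimately show ?thesis using P.linear_eq_0_on_span[OF lin] by blast
  qed
  then have "g \<in> annih r H"
  proof -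
    have "H \<subseteq> forms r" using H by (simp add: stable_subspace_def)
    then show ?thesis if "\<And>G. G \<in> H \<Longrightarrow> \<phi> G = 0"
      using that \<phi>eq by (auto simp: annih_def subset_iff)
  qed
  moreover have "pairing r g F \<noteq> 0" using \<phi>eq[OF F(1)] \<phi> by simp
  ultimately show ?thesis by blast
qed

definition mat2 :: "'a \<Rightarrow> 'a \<Rightarrow> 'a \<Rightarrow> 'a \<Rightarrow> 'a::comm_ring_1 ^ 2 ^ 2" where
  "mat2 a b c d = vector [vector [a, b], vector [c, d]]"

lemma mat2_nth: "mat2 a b c d $ 1 $ 1 = a" "mat2 a b c d $ 1 $ 2 = b"
  "mat2 a b c d $ 2 $ 1 = c" "mat2 a b c d $ 2 $ 2 = d"
  by (simp_all add: mat2_def)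

lemma GL2_iff: "A \<in> GL2 \<longleftrightarrow> A $ 1 $ 1 * A $ 2 $ 2 - A $ 1 $ 2 * A $ 2 $ 1 \<noteq> 0"
  by (simp add: GL2_def invertible_det_nz det_2)

lemma mat2_GL2: "mat2 a b c d \<in> GL2 \<longleftrightarrow> a * d - b * c \<noteq> 0"
  by (simp add: GL2_iff mat2_nth)

lemma gact_mat2_bmono: "gact (mat2 a b c d) (bmono m n)
    = (const2 a * varX + const2 c * varY) ^ m * (const2 b * varX + const2 d * varY) ^ n"
  by (simp add: gact_bmono mat2_nth)

lemma linear_form_power: "(const2 a * varX + const2 c * varY) ^ m
    = (\<Sum>l\<le>m. of_nat (m choose l) * (const2 (c ^ l * a ^ (m - l)) * bmono (m - l) l))"
proof -
  have "(const2 c * varY + const2 a * varX) ^ m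
    = (\<Sum>l\<le>m. of_nat (m choose l) * (const2 c * varY) ^ l * (const2 a * varX) ^ (m - l))"
    by (rule binomial_ring)
  then show ?thesis
    by (simp add: bmono_def power_mult_distrib const2_mult const2_power mult.assoc mult.left_commute
        mult.commute[of "varY ^ _"] add.commute[of "const2 c * varY"])
qed

lemma pairing_linear_power_bmono:
  assumes "m + s + t = r"
  shows "pairing r g ((const2 a * varX + const2 c * varY) ^ m * bmono s t)
    = (\<Sum>l\<le>m. of_nat (m choose l) * c ^ l * a ^ (m - l) * g (l + t))"
  unfolding linear_form_power sum_distrib_right pairing_sum
  using assms
  by (intro sum.cong refl)
    (simp add: mult.assoc bmono_mult pairing_of_nat_mult pairing_const2_mult pairing_bmono)

lemma Xsub_annihI_orbit:
  fixes g :: "nat \<Rightarrow> 'p::prime_card mod_ring"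
  assumes "i \<le> r" and orb: "\<And>A. A \<in> GL2 \<Longrightarrow> pairing r g (gact A (bmono (r - i) i)) = 0"
  shows "g \<in> annih r (Xsub r i)"
proof -
  define L where "L = {F \<in> forms r. \<forall>A\<in>GL2. pairing r g (gact A F) = 0}"
  have st: "gact B F \<in> L" if B: "B \<in> GL2" and F: "F \<in> L" for B F
  proof -
    have "A ** B \<in> GL2" if "A \<in> GL2" for A
      using that B by (simp add: GL2_def invertible_mult)
    then show ?thesis using F by (simp add: L_def gact_forms gact_gact)
  qed
  have "L \<subseteq> forms r" "0 \<in> L" by (auto simp: L_def forms_0 gact_0 pairing_0)
  moreover have "F + G \<in> L" if "F \<in> L" "G \<in> L" for F G
    using that by (simp add: L_def forms_add gact_add pairing_add)
  moreover have "const2 c * F \<in> L" if "F \<in> L" for c F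
    using that by (simp add: L_def forms_const2_mult gact_const2_mult pairing_const2_mult)
  ultimately have "stable_subspace r L"
    using st unfolding stable_subspace_def by blast
  moreover have "{varX ^ (r - i) * varY ^ i} \<subseteq> L"
    using orb forms_bmono[of "r - i" i r] \<open>i \<le> r\<close> by (auto simp: L_def bmono_def)
  ultimately have "Xsub r i \<subseteq> L"
    unfolding Xsub_def by (intro gspan_Vmod(3)[OF bmono_in_forms_Xsub[OF \<open>i \<le> r\<close>]])
  moreover have "pairing r g F = 0" if "F \<in> L" for F
  proof -
    have "mat 1 \<in> GL2" by (simp add: GL2_iff mat_def)
    then have "pairing r g (gact (mat 1) F) = 0" using that unfolding L_def by blast
    then show ?thesis by (simp add: gact_id)
  qed
  ultimately show ?thesis unfolding annih_def by blast
qed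

text \<open>
  The dual action of the matrix exchanging \<open>X\<close> and \<open>Y\<close>.
\<close>

lemma annih_swap:
  assumes "stable_subspace r H" "g \<in> annih r H"
  shows "(\<lambda>n. g (r - n)) \<in> annih r (H :: 'p::prime_card mod_ring poly poly set)"
proof (rule annih_cong[OF annih_transpose_action[OF assms(1) _ assms(2)]])
  show "mat2 0 1 1 0 \<in> (GL2 :: ('p mod_ring ^ 2 ^ 2) set)" by (simp add: mat2_GL2)
  show "transpose_action r (mat2 0 1 1 0) g n = g (r - n)" if "n \<le> r" for n
  proof -
    have "gact (mat2 0 1 1 0) (bmono (r - n) n :: 'p mod_ring poly poly) = bmono n (r - n)"
      unfolding gact_mat2_bmono by (simp add: const2_0 const2_1 bmono_def mult.commute)
    then show ?thesis using that by (simp add: transpose_action_def pairing_bmono)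
  qed
qed

text \<open>
  The dual action of the substitution that fixes \<open>X\<close> and sends \<open>Y\<close> to \<open>X + Y\<close>.  Unlike the diagonal matrices and
  the exchange it mixes residue classes modulo \<open>p - 1\<close>, and it is the source of all movement between classes below.
\<close>

lemma annih_up:
  assumes "stable_subspace r H" "g \<in> annih r H"
  shows "(\<lambda>n. \<Sum>m\<le>n. of_nat (n choose m) * g m) \<in> annih r (H :: 'p::prime_card mod_ring poly poly set)"
proof (rule annih_cong[OF annih_transpose_action[OF assms(1) _ assms(2)]])
  show "mat2 1 1 0 1 \<in> (GL2 :: ('p mod_ring ^ 2 ^ 2) set)" by (simp add: mat2_GL2)
  show "transpose_action r (mat2 1 1 0 1) g n = (\<Sum>m\<le>n. of_nat (n choose m) * g m)" if "n \<le> r" for n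
  proof -
    have "gact (mat2 1 1 0 1) (bmono (r - n) n :: 'p mod_ring poly poly)
      = (const2 1 * varX + const2 1 * varY) ^ n * bmono (r - n) 0"
      unfolding gact_mat2_bmono by (simp add: const2_0 const2_1 bmono_def mult.commute)
    then show ?thesis
      unfolding transpose_action_def using pairing_linear_power_bmono[of n "r - n" 0 r g 1 1] that by simp
  qed
qed

section \<open>Residue classes of exponents and the annihilator of a cyclic submodule\<close>

lemma of_nat_mod_ring_eq_0_iff: "(of_nat n :: 'p::prime_card mod_ring) = 0 \<longleftrightarrow> CARD('p) dvd n"
  using of_nat_eq_0_iff_char_dvd[of n, where 'a = "'p mod_ring"] by simp

lemma of_nat_mod_ring_eq_iff:
  "(of_nat m :: 'p::prime_card mod_ring) = of_nat n \<longleftrightarrow> m mod CARD('p) = n mod CARD('p)"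
  using of_nat_eq_iff_cong_CHAR[of m n, where 'a = "'p mod_ring"] by (simp add: cong_def)

lemma CARD_gt_1: "CARD('p::prime_card) > 1"
  using prime_card prime_gt_1_nat by blast

lemma mod_ring_power_card_minus_1:
  fixes x :: "'p::prime_card mod_ring"
  assumes "x \<noteq> 0" shows "x ^ (CARD('p) - 1) = 1"
proof -
  have "x ^ CARD('p) = x" using finite_field_power_card_eq_same[of x] by simp
  then have "x * x ^ (CARD('p) - 1) = x * 1"
    using CARD_gt_1[where 'p='p] by (simp flip: power_Suc)
  then show ?thesis using assms by (simp only: mult_cancel_left) simp
qed

lemma mod_ring_power_mod:
  fixes x :: "'p::prime_card mod_ring"
  assumes "x \<noteq> 0" and "[m = n] (mod (CARD('p) - 1))"
  shows "x ^ m = x ^ n"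
proof -
  have *: "x ^ k = x ^ (k mod (CARD('p) - 1))" for k
  proof -
    have "x ^ k = x ^ ((CARD('p) - 1) * (k div (CARD('p) - 1)) + k mod (CARD('p) - 1))" by simp
    also have "\<dots> = x ^ (k mod (CARD('p) - 1))"
      unfolding power_add power_mult mod_ring_power_card_minus_1[OF assms(1)] by simp
    finally show ?thesis .
  qed
  show ?thesis using *[of m] *[of n] assms(2) by (simp add: cong_def)
qed

text \<open>
  The orthogonality relation for the characters of the cyclic group of units.
\<close>

lemma sum_nonzero_powers:
  "(\<Sum>x\<in>UNIV - {0 :: 'p::prime_card mod_ring}. x ^ k) = (if (CARD('p) - 1) dvd k then - 1 else 0)"
proof (cases "(CARD('p) - 1) dvd k")
  case True
  then have "x ^ k = 1" if "x \<noteq> 0" for x :: "'p mod_ring"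
    using mod_ring_power_mod[OF that, of k 0] by (simp add: cong_0_iff)
  then have "(\<Sum>x\<in>UNIV - {0 :: 'p mod_ring}. x ^ k) = of_nat (CARD('p) - 1)"
    by simp
  also have "\<dots> = (-1 :: 'p mod_ring)"
    using CARD_gt_1[where 'p='p] by (simp add: of_nat_diff)
  finally show ?thesis using True by simp
next
  case False
  define s where "s = k mod (CARD('p) - 1)"
  have s: "0 < s" "s < CARD('p) - 1"
    using False CARD_gt_1[where 'p='p] by (auto simp: s_def dvd_eq_mod_eq_0)
  define P where "P = monom 1 s - (1 :: 'p mod_ring poly)"
  have "coeff P s = 1" using s by (simp add: P_def)
  then have P0: "P \<noteq> 0" by auto
  have "degree P \<le> s" unfolding P_def using degree_diff_le[of "monom 1 s" s 1] by (simp add: degree_monom_le)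
  then have "card {x. poly P x = 0} \<le> s" using poly_roots_degree[OF P0] by simp
  moreover have "card (UNIV - {0 :: 'p mod_ring}) = CARD('p) - 1" by simp
  ultimately have "\<not> UNIV - {0} \<subseteq> {x. poly P x = 0}"
    using s card_mono[of "{x. poly P x = 0}" "UNIV - {0}"] by fastforce
  then obtain c where c: "c \<noteq> 0" "poly P c \<noteq> 0" by auto
  have "c ^ k = c ^ s" by (rule mod_ring_power_mod[OF c(1)]) (simp add: s_def cong_def)
  with c have ck: "c ^ k \<noteq> 1" by (simp add: P_def poly_monom)
  have "(\<Sum>x\<in>UNIV - {0}. x ^ k) = (\<Sum>x\<in>UNIV - {0}. (c * x) ^ k)"
    by (rule sum.reindex_bij_witness[of _ "\<lambda>x. c * x" "\<lambda>x. x / c"]) (use c in auto)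
  also have "\<dots> = c ^ k * (\<Sum>x\<in>UNIV - {0}. x ^ k)"
    by (simp add: power_mult_distrib sum_distrib_left)
  finally have "(c ^ k - 1) * (\<Sum>x\<in>UNIV - {0}. x ^ k) = 0" by (simp add: algebra_simps)
  then show ?thesis using ck False by simp
qed

text \<open>
  \<open>(p - 2) w\<close> is congruent to \<open>-w\<close> and avoids a subtraction of natural numbers.
\<close>

lemma dvd_add_negative_class:
  "(CARD('p::prime_card) - 1) dvd (n + (CARD('p) - 2) * w) \<longleftrightarrow> [n = w] (mod (CARD('p) - 1))"
proof -
  have "w + (CARD('p) - 2) * w = (CARD('p) - 1) * w"
    using CARD_gt_1[where 'p='p] by (cases "CARD('p)") (auto simp: algebra_simps)
  then have "[w + (CARD('p) - 2) * w = 0] (mod (CARD('p) - 1))" by (simp add: cong_0_iff)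
  then have "[n + (CARD('p) - 2) * w = 0] (mod (CARD('p) - 1)) \<longleftrightarrow> [n + (CARD('p) - 2) * w = w + (CARD('p) - 2) * w] (mod (CARD('p) - 1))"
    by (meson cong_sym cong_trans)
  then show ?thesis by (simp add: cong_0_iff cong_add_rcancel_nat)
qed

text \<open>
  The diagonal matrix with entries \<open>1, x\<close> multiplies \<open>g n\<close> by \<open>x^n\<close>.  Summing these with weights \<open>x^e\<close>
  over all units \<open>x\<close> projects onto one eigenspace of the torus, that is, onto one class modulo \<open>p - 1\<close>.
\<close>

lemma annih_class:
  fixes H :: "'p::prime_card mod_ring poly poly set"
  assumes "stable_subspace r H" "g \<in> annih r H"
  shows "(\<lambda>n. if [n = w] (mod (CARD('p) - 1)) then g n else 0) \<in> annih r H"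
proof -
  define e where "e = (CARD('p) - 2) * w"
  have cls: "(CARD('p) - 1) dvd (n + e) \<longleftrightarrow> [n = w] (mod (CARD('p) - 1))" for n
    unfolding e_def by (rule dvd_add_negative_class)
  have tor: "(\<lambda>n. x ^ n * g n) \<in> annih r H" if "x \<noteq> 0" for x :: "'p mod_ring"
  proof (rule annih_cong[OF annih_transpose_action[OF assms(1) _ assms(2)]])
    \<comment> \<open>the torus acts on \<open>g n\<close> through \<open>x^n\<close>\<close>
    show "mat2 1 0 0 x \<in> GL2" using that by (simp add: mat2_GL2)
    show "transpose_action r (mat2 1 0 0 x) g n = x ^ n * g n" if "n \<le> r" for n
    proof -
      have "gact (mat2 1 0 0 x) (bmono (r - n) n) = const2 (x ^ n) * bmono (r - n) n"
        unfolding gact_mat2_bmono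
        by (simp add: const2_0 const2_1 bmono_def mult.left_commute power_mult_distrib const2_power)
      then show ?thesis using that by (simp add: transpose_action_def pairing_const2_mult pairing_bmono)
    qed
  qed
  have "(\<lambda>n. - 1 * (\<Sum>x\<in>UNIV - {0}. x ^ e * (x ^ n * g n))) \<in> annih r H"
    by (intro annih_scale annih_sum tor) auto
  moreover have "- 1 * (\<Sum>x\<in>UNIV - {0}. x ^ e * (x ^ n * g n)) = (if [n = w] (mod (CARD('p) - 1)) then g n else 0)"
    for n
  proof -
    have "(\<Sum>x\<in>UNIV - {0}. x ^ e * (x ^ n * g n)) = (\<Sum>x\<in>UNIV - {0 :: 'p mod_ring}. x ^ (n + e)) * g n"
      unfolding sum_distrib_right by (intro sum.cong refl) (simp add: power_add mult_ac)
    then show ?thesis unfolding sum_nonzero_powers cls by simp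
  qed
  ultimately show ?thesis by simp
qed

lemma of_nat_binomial_neq_0:
  assumes "m < CARD('p)" "k \<le> m"
  shows "(of_nat (m choose k) :: 'p::prime_card mod_ring) \<noteq> 0"
  unfolding of_nat_mod_ring_eq_0_iff
proof
  assume "CARD('p) dvd (m choose k)"
  then have "CARD('p) dvd fact m"
    using binomial_fact_lemma[OF assms(2)] by (metis dvd_mult)
  then show False using assms(1) prime_dvd_fact_iff[OF prime_card[where 'a='p], of m] by simp
qed

lemma poly_zero_on_field:
  fixes P :: "'p::prime_card mod_ring poly"
  assumes "degree P < CARD('p)" "\<And>x. poly P x = 0"
  shows "P = 0"
proof (rule ccontr)
  assume "P \<noteq> 0"
  from poly_roots_degree[OF this] have "card {x. poly P x = 0} \<le> degree P" .
  moreover have "{x. poly P x = 0} = UNIV" using assms(2) by auto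
  ultimately show False using assms(1) by simp
qed

text \<open>
  The substitution \<open>Y \<mapsto> bX + Y\<close> takes \<open>X^(r-i) Y^i\<close> to \<open>X^(r-i) (bX + Y)^i\<close>.  The
  pairing with it is a polynomial in \<open>b\<close> of degree at most \<open>i < p\<close>, with coefficients \<open>(i choose l) g l\<close>, and it
  vanishes for all \<open>b\<close>.
\<close>

lemma annih_generator_low:
  fixes H :: "'p::prime_card mod_ring poly poly set"
  assumes H: "stable_subspace r H" and gen: "bmono (r - i) i \<in> H" and i: "i < CARD('p)" "i \<le> r"
    and g: "g \<in> annih r H" and n: "n \<le> i"
  shows "g n = 0"
proof -
  define P where "P = (\<Sum>l\<le>i. monom (of_nat (i choose l) * g l) (i - l))"
  have "poly P b = 0" for b
  proof -
    have "mat2 1 b 0 1 \<in> (GL2 :: ('p mod_ring ^ 2 ^ 2) set)" by (simp add: mat2_GL2)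
    then have "gact (mat2 1 b 0 1) (bmono (r - i) i) \<in> H"
      using H gen by (simp add: stable_subspace_def)
    moreover have "gact (mat2 1 b 0 1) (bmono (r - i) i)
      = (const2 b * varX + const2 1 * varY) ^ i * (bmono (r - i) 0 :: 'p mod_ring poly poly)"
      unfolding gact_mat2_bmono by (simp add: const2_0 const2_1 bmono_def mult.commute)
    ultimately have "pairing r g ((const2 b * varX + const2 1 * varY) ^ i * bmono (r - i) 0) = 0"
      using g by (simp add: annih_def)
    then show ?thesis
      using pairing_linear_power_bmono[of i "r - i" 0 r g b 1] i(2)
      by (simp add: P_def poly_sum poly_monom mult_ac)
  qed
  moreover have "degree P < CARD('p)"
  proof -
    have "degree P \<le> i" unfolding P_def
      by (intro degree_sum_le) (auto intro: order_trans[OF degree_monom_le])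
    then show ?thesis using i by simp
  qed
  ultimately have "P = 0" using poly_zero_on_field by blast
  then have "coeff P (i - n) = 0" by simp
  moreover have "coeff P (i - n) = (\<Sum>l\<le>i. if l = n then of_nat (i choose n) * g n else 0)"
    unfolding P_def coeff_sum using n by (intro sum.cong) auto
  ultimately have "of_nat (i choose n) * g n = 0" using n by simp
  then show ?thesis using of_nat_binomial_neq_0[OF i(1) n] by simp
qed

lemma annih_generator_high:
  fixes H :: "'p::prime_card mod_ring poly poly set"
  assumes H: "stable_subspace r H" and gen: "bmono (r - i) i \<in> H" and i: "i < CARD('p)" "i \<le> r"
    and g: "g \<in> annih r H" and n: "r - i \<le> n" "n \<le> r"
  shows "g n = 0"
  using annih_generator_low[OF H gen i annih_swap[OF H g], of "r - n"] n by simp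

text \<open>
  The rows come from the forms \<open>X^j (X + Y)^(r-j)\<close>, which lie in the submodule for \<open>j \<le> i\<close>.
\<close>

lemma annih_generator_sum:
  fixes H :: "'p::prime_card mod_ring poly poly set"
  assumes H: "stable_subspace r H" and gen: "bmono (r - i) i \<in> H" and i: "i < CARD('p)" "i \<le> r"
    and g: "g \<in> annih r H" and j: "j \<le> i"
  shows "(\<Sum>n\<le>r - j. of_nat ((r - j) choose n) * g n) = 0"
proof -
  have "mat2 1 1 1 0 \<in> (GL2 :: ('p mod_ring ^ 2 ^ 2) set)" by (simp add: mat2_GL2)
  from annih_generator_low[OF H gen i annih_transpose_action[OF H this g] j]
  have "pairing r g (gact (mat2 1 1 1 0) (bmono (r - j) j)) = 0" by (simp add: transpose_action_def)
  moreover have "gact (mat2 1 1 1 0) (bmono (r - j) j)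
    = (const2 1 * varX + const2 1 * varY) ^ (r - j) * (bmono j 0 :: 'p mod_ring poly poly)"
    unfolding gact_mat2_bmono by (simp add: const2_0 const2_1 bmono_def)
  ultimately show ?thesis
    using pairing_linear_power_bmono[of "r - j" j 0 r g 1 1] i j by simp
qed

text \<open>
  Conversely to the three preceding lemmas.  An orbit element is \<open>(aX + cY)^(r-i) (bX + dY)^i\<close>.  If \<open>a\<close> or
  \<open>c\<close> is \<open>0\<close> it only involves monomials near one end.  Otherwise the second factor is rewritten in powers of the first and of
  \<open>X\<close>, which leaves forms \<open>X^j (aX + cY)^(r-j)\<close>; on a single class modulo \<open>p - 1\<close> the factors \<open>a\<close>, \<open>c\<close> come out
  as a constant, and a row remains.
\<close>

lemma Xsub_annihI:
  fixes g :: "nat \<Rightarrow> 'p::prime_card mod_ring"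
  assumes ir: "i \<le> r"
    and low: "\<And>n. n \<le> i \<Longrightarrow> g n = 0"
    and high: "\<And>n. r - i \<le> n \<Longrightarrow> n \<le> r \<Longrightarrow> g n = 0"
    and cls: "\<And>n. n \<le> r \<Longrightarrow> g n \<noteq> 0 \<Longrightarrow> [n = w] (mod (CARD('p) - 1))"
    and sums: "\<And>j. j \<le> i \<Longrightarrow> (\<Sum>n\<le>r - j. of_nat ((r - j) choose n) * g n) = 0"
  shows "g \<in> annih r (Xsub r i)"
proof (rule Xsub_annihI_orbit[OF ir])
  fix A :: "'p mod_ring ^ 2 ^ 2"
  define a b c d where "a = A $ 1 $ 1" and "b = A $ 1 $ 2" and "c = A $ 2 $ 1" and "d = A $ 2 $ 2"
  define lin where "lin a c = const2 a * varX + const2 c * varY" for a c :: "'p mod_ring"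
  have gen: "gact A (bmono (r - i) i) = lin a c ^ (r - i) * lin b d ^ i"
    by (simp add: gact_bmono lin_def a_def b_def c_def d_def)
  consider "a = 0" | "c = 0" | "a \<noteq> 0" "c \<noteq> 0" by blast
  then show "pairing r g (gact A (bmono (r - i) i)) = 0"
  proof cases
    case 1
    have "gact A (bmono (r - i) i) = const2 (c ^ (r - i)) * (lin b d ^ i * bmono 0 (r - i))"
      unfolding gen 1 by (simp add: lin_def const2_0 power_mult_distrib const2_power bmono_def mult_ac)
    moreover have "pairing r g (lin b d ^ i * bmono 0 (r - i)) = 0"
      unfolding lin_def
      using high ir by (subst pairing_linear_power_bmono) (auto intro!: sum.neutral)
    ultimately show ?thesis by (simp add: pairing_const2_mult)
  next
    case 2
    have "gact A (bmono (r - i) i) = const2 (a ^ (r - i)) * (lin b d ^ i * bmono (r - i) 0)"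
      unfolding gen 2 by (simp add: lin_def const2_0 power_mult_distrib const2_power bmono_def mult_ac)
    moreover have "pairing r g (lin b d ^ i * bmono (r - i) 0) = 0"
      unfolding lin_def
      using low ir by (subst pairing_linear_power_bmono) (auto intro!: sum.neutral)
    ultimately show ?thesis by (simp add: pairing_const2_mult)
  next
    case 3
    have bd: "lin b d = const2 (d / c) * lin a c + const2 (b - a * d / c) * varX"
    proof -
      have e: "d / c * c = d" "d / c * a + (b - a * d / c) = b" using 3 by (simp_all add: field_simps)
      have "const2 (d / c) * lin a c + const2 (b - a * d / c) * varX
        = const2 (d / c * a + (b - a * d / c)) * varX + const2 (d / c * c) * varY"
        by (simp only: lin_def const2_add const2_mult distrib_left distrib_right mult.assoc add_ac)
      then show ?thesis unfolding e lin_def by simp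
    qed
    have bin: "lin b d ^ i = (\<Sum>l\<le>i. of_nat (i choose l) * (const2 (d / c) * lin a c) ^ l
        * (const2 (b - a * d / c) * varX) ^ (i - l))"
      unfolding bd by (rule binomial_ring)
    have term0: "pairing r g (lin a c ^ (r - i) * (of_nat (i choose l) * (const2 (d / c) * lin a c) ^ l
        * (const2 (b - a * d / c) * varX) ^ (i - l))) = 0" if l: "l \<le> i" for l
    proof -
      define j where "j = i - l"
      have rj: "r - j = r - i + l" "j \<le> i" using l ir by (auto simp: j_def)
      have "lin a c ^ (r - i) * (of_nat (i choose l) * (const2 (d / c) * lin a c) ^ l
        * (const2 (b - a * d / c) * varX) ^ (i - l))
        = of_nat (i choose l) * (const2 ((d / c) ^ l * (b - a * d / c) ^ j) * (lin a c ^ (r - j) * bmono j 0))"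
        unfolding rj(1)
        by (simp add: power_add power_mult_distrib const2_mult const2_power bmono_def j_def mult_ac)
      moreover have "pairing r g (lin a c ^ (r - j) * bmono j 0) = 0"
      proof -
        define z where "z = c / a"
        have z: "z \<noteq> 0" "c = z * a" using 3 by (simp_all add: z_def)
        have "pairing r g (lin a c ^ (r - j) * bmono j 0)
          = (\<Sum>n\<le>r - j. of_nat ((r - j) choose n) * c ^ n * a ^ (r - j - n) * g n)"
          unfolding lin_def using ir rj by (subst pairing_linear_power_bmono) auto
        also have "\<dots> = (\<Sum>n\<le>r - j. (a ^ (r - j) * z ^ w) * (of_nat ((r - j) choose n) * g n))"
        proof (intro sum.cong refl)
          fix n assume n: "n \<in> {..r - j}"
          show "of_nat ((r - j) choose n) * c ^ n * a ^ (r - j - n) * g n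
            = (a ^ (r - j) * z ^ w) * (of_nat ((r - j) choose n) * g n)"
          proof (cases "g n = 0")
            case False
            then have "z ^ n = z ^ w" using cls n by (intro mod_ring_power_mod[OF z(1)]) auto
            moreover have "c ^ n * a ^ (r - j - n) = z ^ n * a ^ (r - j)"
            proof -
              have "a ^ n * a ^ (r - j - n) = a ^ (r - j)"
                using n by (metis atMost_iff le_add_diff_inverse power_add)
              then show ?thesis by (simp add: z(2) power_mult_distrib mult.assoc)
            qed
            ultimately show ?thesis by (simp add: mult_ac)
          qed simp
        qed
        also have "\<dots> = 0"
          using sums[OF rj(2)] by (simp flip: sum_distrib_left)
        finally show ?thesis .
      qed
      ultimately show ?thesis by (simp only: pairing_of_nat_mult pairing_const2_mult mult_zero_right)
    qed
    show ?thesis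
      unfolding gen bin sum_distrib_left pairing_sum using term0 by (intro sum.neutral) auto
  qed
qed

section \<open>Powers of theta and finite differences\<close>

lemma theta_power_bmono:
  "theta ^ m * bmono a b = (\<Sum>t\<le>m. of_nat (m choose t) * (const2 ((- 1) ^ t) *
     (bmono (a + CARD('p) * (m - t) + t) (b + (m - t) + CARD('p) * t) :: 'p::prime_card mod_ring poly poly)))"
proof -
  let ?q = "CARD('p)"
  have th: "theta = const2 (- 1) * bmono 1 ?q + (bmono ?q 1 :: 'p mod_ring poly poly)"
    by (simp add: theta_def bmono_def const2_minus const2_1)
  have pw: "(bmono c d :: 'p mod_ring poly poly) ^ k = bmono (c * k) (d * k)" for c d k
    by (simp add: bmono_def power_mult_distrib power_mult)
  have "theta ^ m = (\<Sum>t\<le>m. of_nat (m choose t) * (const2 (- 1) * bmono 1 ?q) ^ t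
      * (bmono ?q 1 :: 'p mod_ring poly poly) ^ (m - t))"
    unfolding th by (rule binomial_ring)
  moreover have "of_nat (m choose t) * (const2 (- 1) * bmono 1 ?q) ^ t
      * (bmono ?q 1 :: 'p mod_ring poly poly) ^ (m - t) * bmono a b
    = of_nat (m choose t) * (const2 ((- 1) ^ t) * bmono (a + ?q * (m - t) + t) (b + (m - t) + ?q * t))" for t
  proof -
    have "(bmono 1 ?q :: 'p mod_ring poly poly) ^ t * bmono ?q 1 ^ (m - t) * bmono a b
       = bmono (a + ?q * (m - t) + t) (b + (m - t) + ?q * t)"
      by (simp add: pw bmono_mult add_ac)
    then show ?thesis
      by (simp only: power_mult_distrib const2_power mult.assoc)
  qed
  ultimately show ?thesis by (simp only: sum_distrib_right)
qed

text \<open>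
  The pairing with a multiple of \<open>\<theta>^m\<close> is an \<open>m\<close>-th difference of \<open>g\<close> with step \<open>p - 1\<close>.
\<close>

lemma pairing_theta_bmono:
  fixes g :: "nat \<Rightarrow> 'p::prime_card mod_ring"
  shows "a + b + m * (CARD('p) + 1) = r \<Longrightarrow> pairing r g (theta ^ m * bmono a b) =
      (\<Sum>t\<le>m. of_nat (m choose t) * (- 1) ^ t * g (b + m + (CARD('p) - 1) * t))"
    and "a + b + m * (CARD('p) + 1) \<noteq> r \<Longrightarrow> pairing r g (theta ^ m * bmono a b) = 0"
proof -
  let ?q = "CARD('p)"
  have e1: "a + ?q * (m - t) + t + (b + (m - t) + ?q * t) = a + b + m * (?q + 1)" if "t \<le> m" for t
  proof -
    have "?q * (m - t) + ?q * t = ?q * m" using that by (metis add_mult_distrib2 le_add_diff_inverse2)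
    moreover have "m * (?q + 1) = ?q * m + m" by simp
    ultimately show ?thesis using that by linarith
  qed
  have e2: "b + (m - t) + ?q * t = b + m + (?q - 1) * t" if "t \<le> m" for t
  proof -
    have "?q * t = (?q - 1) * t + t" using CARD_gt_1[where 'p='p] by (cases ?q) auto
    then show ?thesis using that by linarith
  qed
  have exp: "pairing r g (theta ^ m * bmono a b) = (\<Sum>t\<le>m. of_nat (m choose t) * (- 1) ^ t
      * (if a + b + m * (?q + 1) = r then g (b + m + (?q - 1) * t) else 0))"
    unfolding theta_power_bmono pairing_sum
  proof (intro sum.cong refl)
    fix t assume "t \<in> {..m}"
    then have t: "t \<le> m" by simp
    show "pairing r g (of_nat (m choose t) * (const2 ((- 1) ^ t) *
        bmono (a + ?q * (m - t) + t) (b + (m - t) + ?q * t)))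
      = of_nat (m choose t) * (- 1) ^ t
        * (if a + b + m * (?q + 1) = r then g (b + m + (?q - 1) * t) else 0)"
      unfolding pairing_of_nat_mult pairing_const2_mult pairing_bmono e1[OF t]
      unfolding e2[OF t] mult.assoc ..
  qed
  show "a + b + m * (?q + 1) = r \<Longrightarrow> pairing r g (theta ^ m * bmono a b) =
      (\<Sum>t\<le>m. of_nat (m choose t) * (- 1) ^ t * g (b + m + (?q - 1) * t))"
    by (simp only: exp refl if_True)
  show "a + b + m * (?q + 1) \<noteq> r \<Longrightarrow> pairing r g (theta ^ m * bmono a b) = 0"
    by (simp only: exp if_False mult_zero_right sum.neutral_const)
qed

lemma Vfilt_annih_iff:
  fixes g :: "nat \<Rightarrow> 'p::prime_card mod_ring"
  shows "g \<in> annih r (Vfilt r m) \<longleftrightarrow> (\<forall>b. b + m * (CARD('p) + 1) \<le> r \<longrightarrow>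
    (\<Sum>t\<le>m. of_nat (m choose t) * (- 1) ^ t * g (b + m + (CARD('p) - 1) * t)) = 0)"
proof safe
  fix b assume g: "g \<in> annih r (Vfilt r m)" and b: "b + m * (CARD('p) + 1) \<le> r"
  define a where "a = r - (b + m * (CARD('p) + 1))"
  have ab: "a + b + m * (CARD('p) + 1) = r" using b by (simp add: a_def)
  have "(theta ^ m * bmono a b :: 'p mod_ring poly poly) \<in> forms ((CARD('p) + 1) * m + (a + b))"
    by (intro forms_mult forms_power theta_forms forms_bmono refl)
  moreover have "(CARD('p) + 1) * m + (a + b) = r" using ab by (simp add: algebra_simps)
  ultimately have "(theta ^ m * bmono a b :: 'p mod_ring poly poly) \<in> Vfilt r m"
    by (simp add: Vfilt_def Vmod_simps)
  then have "pairing r g (theta ^ m * bmono a b :: 'p mod_ring poly poly) = 0" using g by (simp add: annih_def)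
  then show "(\<Sum>t\<le>m. of_nat (m choose t) * (- 1) ^ t * g (b + m + (CARD('p) - 1) * t)) = 0"
    by (simp only: pairing_theta_bmono(1)[OF ab])
next
  assume h: "\<forall>b. b + m * (CARD('p) + 1) \<le> r \<longrightarrow>
    (\<Sum>t\<le>m. of_nat (m choose t) * (- 1) ^ t * g (b + m + (CARD('p) - 1) * t)) = 0"
  have z: "pairing r g (theta ^ m * bmono a b) = 0" for a b
  proof (cases "a + b + m * (CARD('p) + 1) = r")
    case True
    then have "b + m * (CARD('p) + 1) \<le> r" by linarith
    then show ?thesis unfolding pairing_theta_bmono(1)[OF True] using h by blast
  qed (rule pairing_theta_bmono(2))
  show "g \<in> annih r (Vfilt r m)"
    unfolding annih_def
  proof safe
    fix F :: "'p mod_ring poly poly" assume "F \<in> Vfilt r m"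
    then have "theta ^ m dvd F" by (simp add: Vfilt_def)
    then obtain G where G: "F = theta ^ m * G" by (rule dvdE)
    obtain S where S: "G = (\<Sum>(a,b)\<in>S. const2 (coeff (coeff G a) b) * bmono a b)"
      using poly_poly_expand by blast
    have "F = (\<Sum>(a,b)\<in>S. const2 (coeff (coeff G a) b) * (theta ^ m * bmono a b))"
      unfolding G by (subst S) (simp add: sum_distrib_left case_prod_unfold mult.left_commute)
    then show "pairing r g F = 0"
      by (simp add: pairing_sum case_prod_unfold pairing_const2_mult z)
  qed
qed

text \<open>
  Up to sign, the \<open>m\<close>-th finite difference of \<open>h\<close> at \<open>0\<close>.
\<close>

definition alternating_sum :: "nat \<Rightarrow> (nat \<Rightarrow> 'a::comm_ring_1) \<Rightarrow> 'a" where
  "alternating_sum m h = (\<Sum>t\<le>m. of_nat (m choose t) * (- 1) ^ t * h t)"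

lemma alternating_sum_Suc: "alternating_sum (Suc m) h = alternating_sum m h - alternating_sum m (\<lambda>t. h (Suc t))"
proof -
  have "alternating_sum (Suc m) h = h 0 + (\<Sum>t\<le>m. of_nat (Suc m choose Suc t) * (- 1) ^ Suc t * h (Suc t))"
    unfolding alternating_sum_def by (subst sum.atMost_Suc_shift) simp
  also have "(\<Sum>t\<le>m. of_nat (Suc m choose Suc t) * (- 1) ^ Suc t * h (Suc t))
     = (\<Sum>t\<le>m. of_nat (m choose Suc t) * (- 1) ^ Suc t * h (Suc t)) - alternating_sum m (\<lambda>t. h (Suc t))"
    unfolding alternating_sum_def sum_subtractf[symmetric] by (intro sum.cong refl) (simp add: algebra_simps)
  also have "h 0 + (\<dots>) = (\<Sum>t\<le>Suc m. of_nat (m choose t) * (- 1) ^ t * h t) - alternating_sum m (\<lambda>t. h (Suc t))"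
    by (subst sum.atMost_Suc_shift) (simp add: algebra_simps)
  also have "(\<Sum>t\<le>Suc m. of_nat (m choose t) * (- 1) ^ t * h t) = alternating_sum m h"
    by (simp add: alternating_sum_def binomial_eq_0)
  finally show ?thesis .
qed

lemma alternating_sum_diff: "alternating_sum m (\<lambda>t. h t - k t) = alternating_sum m h - alternating_sum m k"
  by (simp add: alternating_sum_def right_diff_distrib sum_subtractf)

lemma alternating_sum_poly_eq_0:
  fixes P :: "'a::field poly"
  assumes "degree P < m"
  shows "alternating_sum m (\<lambda>t. poly P (x + of_nat t * y)) = 0"
  using assms
proof (induction m arbitrary: P)
  case (Suc m)
  define Q where "Q = P - pcompose P [:y, 1:]"
  have Q: "poly P (x + of_nat t * y) - poly P (x + of_nat (Suc t) * y) = poly Q (x + of_nat t * y)" for t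
    by (simp add: Q_def poly_pcompose algebra_simps)
  have "alternating_sum (Suc m) (\<lambda>t. poly P (x + of_nat t * y)) = alternating_sum m (\<lambda>t. poly Q (x + of_nat t * y))"
    by (simp only: alternating_sum_Suc alternating_sum_diff[symmetric] Q)
  also have "\<dots> = 0"
  proof (cases "degree P = 0")
    case True
    then obtain c where "P = [:c:]" by (rule degree_eq_zeroE)
    then have "Q = 0" by (simp add: Q_def)
    then show ?thesis by (simp add: alternating_sum_def)
  next
    case False
    have dc: "degree (pcompose P [:y, 1:]) = degree P" by (simp add: degree_pcompose)
    have "lead_coeff (pcompose P [:y, 1:]) = lead_coeff P"
      by (subst lead_coeff_comp) auto
    then have cQ: "coeff Q (degree P) = 0" by (simp add: Q_def dc)
    have dQ: "degree Q \<le> degree P"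
      unfolding Q_def using degree_diff_le[of P "degree P" "pcompose P [:y, 1:]"] dc by simp
    have "degree Q < degree P"
    proof (rule ccontr)
      assume "\<not> degree Q < degree P"
      with dQ have e: "degree Q = degree P" by simp
      with cQ have "Q = 0" by (metis leading_coeff_0_iff)
      with e False show False by simp
    qed
    then show ?thesis using Suc by (intro Suc.IH) auto
  qed
  finally show ?case .
qed simp

lemma poly_interpolation:
  fixes f :: "'a::field \<Rightarrow> 'a"
  assumes "finite S"
  shows "\<exists>P. degree P \<le> card S - 1 \<and> (\<forall>x\<in>S. poly P x = f x)"
  using assms
proof (induction S)
  case (insert a S)
  show ?case
  proof (cases "S = {}")
    case True
    then show ?thesis by (intro exI[of _ "[:f a:]"]) simp
  next
    case False
    from insert obtain P where P: "degree P \<le> card S - 1" "\<forall>x\<in>S. poly P x = f x" by auto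
    define R where "R = (\<Prod>x\<in>S. [:- x, 1:])"
    have R: "degree R = card S" "poly R x = (\<Prod>y\<in>S. x - y)" for x
      unfolding R_def by (subst degree_prod_eq_sum_degree) (auto simp: poly_prod)
    have Ra: "poly R a \<noteq> 0" using insert by (auto simp: R(2))
    have RS: "poly R x = 0" if "x \<in> S" for x using that insert.hyps(1) by (auto simp: R(2))
    define P' where "P' = P + smult ((f a - poly P a) / poly R a) R"
    have "degree P' \<le> card S"
      unfolding P'_def using P(1) R(1) by (intro degree_add_le) (auto intro: order_trans[OF degree_smult_le])
    moreover have "poly P' x = f x" if "x \<in> insert a S" for x
      using that P(2) Ra RS by (auto simp: P'_def)
    ultimately show ?thesis using insert by (intro exI[of _ P']) auto
  qed
qed (auto intro: exI[of _ 0])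

text \<open>
  The discrete analogue of integrating \<open>m\<close> times: interpolate the first \<open>m\<close> values (possible since
  \<open>m \<le> p\<close> makes the nodes distinct), and propagate, each further value being determined by the \<open>m\<close> preceding ones.
\<close>

lemma poly_of_vanishing_differences:
  fixes h :: "nat \<Rightarrow> 'p::prime_card mod_ring"
  assumes m: "1 \<le> m" "m \<le> CARD('p)"
    and h: "\<And>x. x + m \<le> T \<Longrightarrow> alternating_sum m (\<lambda>t. h (x + t)) = 0"
  shows "\<exists>P. degree P < m \<and> (\<forall>t\<le>T. h t = poly P (of_nat t))"
proof -
  have inj: "inj_on (of_nat :: nat \<Rightarrow> 'p mod_ring) {..<m}"
    using m by (auto simp: inj_on_def of_nat_mod_ring_eq_iff)
  define S where "S = (of_nat :: nat \<Rightarrow> 'p mod_ring) ` {..<m}"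
  have cS: "card S = m" unfolding S_def by (simp add: card_image[OF inj])
  obtain P where P: "degree P \<le> m - 1" "\<forall>x\<in>S. poly P x = h (inv_into {..<m} of_nat x)"
    using poly_interpolation[of S "\<lambda>x. h (inv_into {..<m} of_nat x)"] cS by (auto simp: S_def)
  have P0: "h t = poly P (of_nat t)" if "t < m" for t
    using P(2) that inv_into_f_f[OF inj, of t] by (simp add: S_def)
  have dP: "degree P < m" using P(1) m(1) by linarith
  have "h t = poly P (of_nat t)" if "t \<le> T" for t
    using that
  proof (induction t rule: less_induct)
    case (less t)
    show ?case
    proof (cases "t < m")
      case False
      define x where "x = t - m"
      have tx: "t = x + m" using False by (simp add: x_def)
      have eq: "alternating_sum m f = (- 1) ^ m * f m + (\<Sum>s<m. of_nat (m choose s) * (- 1) ^ s * f s)"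
        for f :: "nat \<Rightarrow> 'p mod_ring"
        unfolding alternating_sum_def by (simp add: lessThan_Suc_atMost[symmetric])
      have "alternating_sum m (\<lambda>s. h (x + s)) = 0" using less.prems by (intro h) (simp add: tx)
      moreover have "alternating_sum m (\<lambda>s. poly P (of_nat (x + s))) = 0"
        using alternating_sum_poly_eq_0[OF dP, of "of_nat x" 1] by simp
      moreover have "(\<Sum>s<m. of_nat (m choose s) * (- 1) ^ s * h (x + s))
        = (\<Sum>s<m. of_nat (m choose s) * (- 1) ^ s * poly P (of_nat (x + s)))"
        using less tx by (intro sum.cong refl) auto
      ultimately have "(- 1) ^ m * h t = (- 1) ^ m * poly P (of_nat t)"
        unfolding eq tx by (simp add: add_eq_0_iff2)
      then show ?thesis by simp
    qed (rule P0)
  qed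
  then show ?thesis using dP by blast
qed

lemma class_representative:
  fixes m w q :: nat assumes "0 < q"
  obtains n0 where "m \<le> n0" "n0 < m + q" "[n0 = w] (mod q)"
proof
  define e where "e = (w + (q - 1) * m) mod q"
  have "[m + e = m + (w + (q - 1) * m)] (mod q)"
    unfolding e_def by (intro cong_add cong_refl) (simp add: cong_def)
  also have "m + (w + (q - 1) * m) = w + q * m"
    using assms by (cases q) auto
  also have "[w + q * m = w] (mod q)" by (simp add: cong_def)
  finally show "[m + e = w] (mod q)" .
  show "m \<le> m + e" "m + e < m + q" using assms by (auto simp: e_def)
qed

text \<open>
  Along a class modulo \<open>p - 1\<close> one has \<open>n0 + (p-1) t = n0 - t\<close> in the field, so that polynomials in
  the index \<open>t\<close> and polynomials in \<open>n\<close> are the same thing.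
\<close>

lemma Vfilt_annih_iff_poly:
  fixes g :: "nat \<Rightarrow> 'p::prime_card mod_ring"
  assumes m: "1 \<le> m" "m \<le> CARD('p)"
  shows "g \<in> annih r (Vfilt r m) \<longleftrightarrow> (\<forall>w. \<exists>P. degree P < m \<and>
    (\<forall>n. m \<le> n \<and> n + m \<le> r \<and> [n = w] (mod (CARD('p) - 1)) \<longrightarrow> g n = poly P (of_nat n)))"
    (is "_ \<longleftrightarrow> ?R")
proof
  let ?q = "CARD('p) - 1"
  have q: "?q > 0" and ofq: "(of_nat ?q :: 'p mod_ring) = - 1"
    using CARD_gt_1[where 'p='p] by (auto simp: of_nat_diff)
  have pq: "CARD('p) + 1 = ?q + 2" using q by simp
  {
    assume g: "g \<in> annih r (Vfilt r m)"
    show ?R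
    proof
      fix w
      obtain n0 where n0: "m \<le> n0" "n0 < m + ?q" "[n0 = w] (mod ?q)"
        using class_representative[OF q] .
      have cl: "\<exists>t. n = n0 + ?q * t" if n: "m \<le> n" "[n = w] (mod ?q)" for n
      proof -
        have md: "n mod ?q = n0 mod ?q" using n(2) n0(3) by (simp add: cong_def)
        have "n0 \<le> n"
        proof (rule ccontr)
          assume "\<not> n0 \<le> n"
          then have "?q dvd n0 - n" "0 < n0 - n" using md mod_eq_dvd_iff_nat[of n n0 ?q] by auto
          then have "?q \<le> n0 - n" by (rule dvd_imp_le)
          then show False using n0(2) n(1) q by linarith
        qed
        then have "?q dvd n - n0" using md mod_eq_dvd_iff_nat[of n0 n ?q] by simp
        then obtain t where "n - n0 = ?q * t" by (rule dvdE)
        then show ?thesis using \<open>n0 \<le> n\<close> by (intro exI[of _ t]) simp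
      qed
      show "\<exists>P. degree P < m \<and> (\<forall>n. m \<le> n \<and> n + m \<le> r \<and> [n = w] (mod ?q) \<longrightarrow> g n = poly P (of_nat n))"
      proof (cases "n0 + m \<le> r")
        case False
        have "\<not> (m \<le> n \<and> n + m \<le> r \<and> [n = w] (mod ?q))" for n
          using cl[of n] False by auto
        then show ?thesis using m by (intro exI[of _ 0]) auto
      next
        case True
        define T where "T = (r - m - n0) div ?q"
        have T: "n0 + ?q * t + m \<le> r \<longleftrightarrow> t \<le> T" for t
          using True q unfolding T_def by (subst less_eq_div_iff_mult_less_eq) (auto simp: mult.commute)
        have "\<exists>P. degree P < m \<and> (\<forall>t\<le>T. g (n0 + ?q * t) = poly P (of_nat t))"
        proof (rule poly_of_vanishing_differences[OF m])
          fix x assume x: "x + m \<le> T"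
          define b where "b = n0 + ?q * x - m"
          have b: "b + m = n0 + ?q * x" using n0(1) by (simp add: b_def)
          have "m * (CARD('p) + 1) = ?q * m + 2 * m" unfolding pq by (simp add: algebra_simps)
          moreover have "?q * (x + m) = ?q * x + ?q * m" by (rule distrib_left)
          ultimately have "b + m * (CARD('p) + 1) \<le> r" using T[of "x + m"] x b by linarith
          then have "(\<Sum>t\<le>m. of_nat (m choose t) * (- 1) ^ t * g (b + m + ?q * t)) = 0"
            using g unfolding Vfilt_annih_iff by blast
          then show "alternating_sum m (\<lambda>t. g (n0 + ?q * (x + t))) = 0"
            unfolding alternating_sum_def b by (simp add: distrib_left add.assoc)
        qed
        then obtain P where P: "degree P < m" "\<And>t. t \<le> T \<Longrightarrow> g (n0 + ?q * t) = poly P (of_nat t)"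
          by blast
        define P' where "P' = pcompose P [:of_nat n0, - 1:]"
        have "degree P' < m" using P(1) by (simp add: P'_def degree_pcompose)
        moreover have "g n = poly P' (of_nat n)" if n: "m \<le> n \<and> n + m \<le> r \<and> [n = w] (mod ?q)" for n
        proof -
          obtain t where t: "n = n0 + ?q * t" using cl[of n] n by blast
          have "g n = poly P (of_nat t)" unfolding t using n T[of t] unfolding t by (intro P(2)) simp
          also have "of_nat t = of_nat n0 - (of_nat n :: 'p mod_ring)"
            unfolding t of_nat_add of_nat_mult ofq by simp
          finally show ?thesis by (simp add: P'_def poly_pcompose)
        qed
        ultimately show ?thesis by blast
      qed
    qed
  next
    assume R: ?R
    show "g \<in> annih r (Vfilt r m)"
      unfolding Vfilt_annih_iff
    proof (intro allI impI)
      fix b assume b: "b + m * (CARD('p) + 1) \<le> r"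
      obtain P where P: "degree P < m"
        "\<And>n. m \<le> n \<and> n + m \<le> r \<and> [n = b + m] (mod ?q) \<Longrightarrow> g n = poly P (of_nat n)"
        using R by blast
      have "g (b + m + ?q * t) = poly P (of_nat (b + m) + of_nat t * (- 1))" if "t \<le> m" for t
      proof -
        have "?q * t \<le> ?q * m" using that by simp
        moreover have "m * (CARD('p) + 1) = ?q * m + 2 * m" unfolding pq by (simp add: algebra_simps)
        ultimately have "b + m + ?q * t + m \<le> r" using b by linarith
        then have "g (b + m + ?q * t) = poly P (of_nat (b + m + ?q * t))"
          by (intro P(2)) (simp add: cong_def)
        then show ?thesis unfolding of_nat_add of_nat_mult ofq by (simp add: mult.commute)
      qed
      then have "(\<Sum>t\<le>m. of_nat (m choose t) * (- 1) ^ t * g (b + m + ?q * t))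
        = alternating_sum m (\<lambda>t. poly P (of_nat (b + m) + of_nat t * (- 1)))"
        unfolding alternating_sum_def by (intro sum.cong refl) auto
      then show "(\<Sum>t\<le>m. of_nat (m choose t) * (- 1) ^ t * g (b + m + ?q * t)) = 0"
        by (simp only: alternating_sum_poly_eq_0[OF P(1)])
    qed
  }
qed

section \<open>The annihilator of the relations\<close>

lemma stable_subspace_Xsub: "i \<le> r \<Longrightarrow> stable_subspace r (Xsub r i)"
  unfolding Xsub_def by (rule gspan_Vmod(1)[OF bmono_in_forms_Xsub])

lemma stable_subspace_0: "stable_subspace r H \<Longrightarrow> 0 \<in> H"
  by (simp add: stable_subspace_def)

lemma Xsub_subset_relations: "Xsub r i \<subseteq> relations r i"
proof
  fix F :: "'p::prime_card mod_ring poly poly" assume "F \<in> Xsub r i"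
  then have "F = F + 0 \<and> F \<in> Xsub r i \<and> 0 \<in> Vfilt r (i + 1)"
    using stable_subspace_0[OF stable_subspace_Vfilt[of r "i + 1"]] by simp
  then show "F \<in> relations r i" unfolding relations_def by blast
qed

lemma Vfilt_subset_relations:
  assumes "i \<le> r" shows "Vfilt r (i + 1) \<subseteq> relations r i"
proof
  fix F :: "'p::prime_card mod_ring poly poly" assume "F \<in> Vfilt r (i + 1)"
  then have "F = 0 + F \<and> 0 \<in> Xsub r i \<and> F \<in> Vfilt r (i + 1)"
    using stable_subspace_0[OF stable_subspace_Xsub[OF assms]] by simp
  then show "F \<in> relations r i" unfolding relations_def by blast
qed

lemma annih_relations_iff:
  fixes g :: "nat \<Rightarrow> 'p::prime_card mod_ring"
  assumes "i \<le> r"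
  shows "g \<in> annih r (relations r i) \<longleftrightarrow> g \<in> annih r (Xsub r i) \<and> g \<in> annih r (Vfilt r (i + 1))"
proof
  assume "g \<in> annih r (relations r i)"
  then show "g \<in> annih r (Xsub r i) \<and> g \<in> annih r (Vfilt r (i + 1))"
    using annih_antimono[OF Xsub_subset_relations] annih_antimono[OF Vfilt_subset_relations[OF assms]] by blast
next
  assume g: "g \<in> annih r (Xsub r i) \<and> g \<in> annih r (Vfilt r (i + 1))"
  show "g \<in> annih r (relations r i)"
    unfolding annih_def
  proof safe
    fix F :: "'p mod_ring poly poly" assume "F \<in> relations r i"
    then obtain x y where "F = x + y" "x \<in> Xsub r i" "y \<in> Vfilt r (i + 1)"
      unfolding relations_def by blast
    then show "pairing r g F = 0" using g by (simp add: annih_def pairing_add)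
  qed
qed

lemma bmono_in_relations:
  assumes "i \<le> r" shows "bmono (r - i) i \<in> (relations r i :: 'p::prime_card mod_ring poly poly set)"
proof -
  have "{bmono (r - i) i} \<subseteq> (Xsub r i :: 'p mod_ring poly poly set)"
    using gspan_Vmod(2)[OF bmono_in_forms_Xsub[OF assms], where 'a='p]
    unfolding Xsub_def bmono_def .
  then show ?thesis using Xsub_subset_relations by blast
qed

text \<open>
  The functions to which the annihilator of the relations reduces: on the class \<open>w\<close> a polynomial in \<open>n\<close>, set to
  \<open>0\<close> within distance \<open>i\<close> of either end.
\<close>

definition cut_poly :: "nat \<Rightarrow> nat \<Rightarrow> nat \<Rightarrow> 'p::prime_card mod_ring poly \<Rightarrow> nat \<Rightarrow> 'p mod_ring" where
  "cut_poly r i w P n = (if i < n \<and> n + i < r \<and> [n = w] (mod (CARD('p) - 1)) then poly P (of_nat n) else 0)"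

text \<open>
  Outside \<open>i < n < r - i\<close> the cut-off changes the values, which does no harm where \<open>P\<close> vanishes anyway.
\<close>

lemma cut_poly_annih_Vfilt:
  fixes P :: "'p::prime_card mod_ring poly"
  assumes m: "1 \<le> m" "m \<le> CARD('p)" and P: "degree P < m"
    and edge: "\<And>n. m \<le> n \<Longrightarrow> n + m \<le> r \<Longrightarrow> [n = w] (mod (CARD('p) - 1)) \<Longrightarrow> n \<le> i \<or> r \<le> n + i \<Longrightarrow>
      poly P (of_nat n) = 0"
  shows "cut_poly r i w P \<in> annih r (Vfilt r m)"
  unfolding Vfilt_annih_iff_poly[OF m]
proof
  fix w'
  show "\<exists>P'. degree P' < m \<and> (\<forall>n. m \<le> n \<and> n + m \<le> r \<and> [n = w'] (mod CARD('p) - 1) \<longrightarrow>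
    cut_poly r i w P n = poly P' (of_nat n))"
  proof (cases "[w' = w] (mod CARD('p) - 1)")
    case True
    have "cut_poly r i w P n = poly P (of_nat n)"
      if n: "m \<le> n \<and> n + m \<le> r \<and> [n = w'] (mod CARD('p) - 1)" for n
    proof -
      have "[n = w] (mod CARD('p) - 1)" using n True cong_trans by blast
      then show ?thesis using n edge[of n] by (auto simp: cut_poly_def not_less)
    qed
    then show ?thesis using P by blast
  next
    case False
    have "cut_poly r i w P n = poly 0 (of_nat n)" if "[n = w'] (mod CARD('p) - 1)" for n
    proof -
      have "\<not> [n = w] (mod CARD('p) - 1)" using that False cong_trans cong_sym by blast
      then show ?thesis by (simp add: cut_poly_def)
    qed
    moreover have "degree (0 :: 'p mod_ring poly) < m" using m by simp
    ultimately show ?thesis by blast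
  qed
qed

lemma cut_poly_annih_relations:
  fixes P :: "'p::prime_card mod_ring poly"
  assumes i: "i < CARD('p)" "i \<le> r" and P: "degree P \<le> i"
    and sums: "\<And>j. j \<le> i \<Longrightarrow> (\<Sum>n\<le>r - j. of_nat ((r - j) choose n) * cut_poly r i w P n) = 0"
  shows "cut_poly r i w P \<in> annih r (relations r i)"
  unfolding annih_relations_iff[OF i(2)]
proof
  show "cut_poly r i w P \<in> annih r (Xsub r i)"
    by (rule Xsub_annihI[where w = w]) (use i sums in \<open>auto simp: cut_poly_def split: if_splits\<close>)
  show "cut_poly r i w P \<in> annih r (Vfilt r (i + 1))"
    by (rule cut_poly_annih_Vfilt) (use i P in auto)
qed

text \<open>
  The structure of the annihilator: its class-\<open>w\<close> parts are given by polynomials of degree at most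
  \<open>i\<close> solving the \<open>i + 1\<close> row equations.
\<close>

lemma annih_relations_class:
  fixes g :: "nat \<Rightarrow> 'p::prime_card mod_ring"
  assumes i: "i < CARD('p)" "i \<le> r" and g: "g \<in> annih r (relations r i)"
  obtains P where "degree P \<le> i"
    "\<And>n. n \<le> r \<Longrightarrow> [n = w] (mod (CARD('p) - 1)) \<Longrightarrow> g n = cut_poly r i w P n"
    "\<And>j. j \<le> i \<Longrightarrow> (\<Sum>n\<le>r - j. of_nat ((r - j) choose n) * cut_poly r i w P n) = 0"
proof -
  note st = stable_subspace_relations[OF i(2)] and gen = bmono_in_relations[OF i(2)]
  from g have "g \<in> annih r (Vfilt r (i + 1))" by (simp add: annih_relations_iff[OF i(2)])
  then have "\<forall>w. \<exists>P. degree P < i + 1 \<and> (\<forall>n. i + 1 \<le> n \<and> n + (i + 1) \<le> r \<and>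
      [n = w] (mod CARD('p) - 1) \<longrightarrow> g n = poly P (of_nat n))"
    by (subst (asm) Vfilt_annih_iff_poly) (use i in auto)
  then obtain P where P: "degree P < i + 1"
    "\<And>n. i + 1 \<le> n \<and> n + (i + 1) \<le> r \<and> [n = w] (mod CARD('p) - 1) \<Longrightarrow> g n = poly P (of_nat n)"
    by blast
  have gP: "g n = cut_poly r i w P n" if "n \<le> r" "[n = w] (mod (CARD('p) - 1))" for n
    using that P(2)[of n] annih_generator_low[OF st gen i g, of n] annih_generator_high[OF st gen i g, of n]
    by (auto simp: cut_poly_def not_less)
  have "(\<Sum>n\<le>r - j. of_nat ((r - j) choose n) * cut_poly r i w P n) = 0" if "j \<le> i" for j
  proof -
    have "(\<Sum>n\<le>r - j. of_nat ((r - j) choose n) * (if [n = w] (mod (CARD('p) - 1)) then g n else 0)) = 0"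
      using annih_generator_sum[OF st gen i annih_class[OF st g] that] .
    moreover have "(if [n = w] (mod (CARD('p) - 1)) then g n else 0) = cut_poly r i w P n" if "n \<le> r - j" for n
      using gP[of n] that by (auto simp: cut_poly_def)
    ultimately show ?thesis by simp
  qed
  then show ?thesis using that[of P] P(1) gP by simp
qed

section \<open>Class sums of binomial coefficients modulo a prime\<close>

text \<open>
  The part of the binomial sum \<open>(1 + 1)^N\<close> that falls into the class of \<open>w\<close>.
\<close>

definition bsum :: "nat \<Rightarrow> nat \<Rightarrow> 'p::prime_card mod_ring" where
  "bsum N w = (\<Sum>n\<le>N. if [n = w] (mod (CARD('p) - 1)) then of_nat (N choose n) else 0)"

lemma bsum_cong_class: "[w = w'] (mod (CARD('p) - 1)) \<Longrightarrow> bsum N w = (bsum N w' :: 'p::prime_card mod_ring)"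
  unfolding bsum_def by (intro sum.cong refl) (metis cong_sym cong_trans)

text \<open>
  Detect the class by the characters of the units; the inner sum over \<open>n\<close> is \<open>(1 + x)^N\<close>.
\<close>

lemma bsum_character: "bsum N w = - (\<Sum>x\<in>UNIV - {0 :: 'p::prime_card mod_ring}. x ^ ((CARD('p) - 2) * w) * (1 + x) ^ N)"
proof -
  define e where "e = (CARD('p) - 2) * w"
  have cls: "(CARD('p) - 1) dvd (n + e) \<longleftrightarrow> [n = w] (mod (CARD('p) - 1))" for n
    unfolding e_def by (rule dvd_add_negative_class)
  have "(\<Sum>x\<in>UNIV - {0 :: 'p mod_ring}. x ^ e * (1 + x) ^ N)
    = (\<Sum>x\<in>UNIV - {0}. \<Sum>n\<le>N. of_nat (N choose n) * x ^ (n + e))"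
  proof (intro sum.cong refl)
    fix x :: "'p mod_ring"
    have "(1 + x) ^ N = (\<Sum>n\<le>N. of_nat (N choose n) * x ^ n)"
      using binomial_ring[of x 1 N] by (simp add: add.commute)
    then show "x ^ e * (1 + x) ^ N = (\<Sum>n\<le>N. of_nat (N choose n) * x ^ (n + e))"
      by (simp add: sum_distrib_left power_add mult_ac)
  qed
  also have "\<dots> = (\<Sum>n\<le>N. of_nat (N choose n) * (\<Sum>x\<in>UNIV - {0 :: 'p mod_ring}. x ^ (n + e)))"
    by (subst sum.swap) (simp only: sum_distrib_left)
  also have "\<dots> = - bsum N w"
    unfolding sum_nonzero_powers cls bsum_def sum_negf[symmetric] by (intro sum.cong refl) simp
  finally show ?thesis by (simp add: e_def)
qed

text \<open>
  Visible from the character formula: \<open>(1 + x)^N\<close> depends only on the class of \<open>N\<close>, except that \<open>0^N\<close> requires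
  \<open>N\<close> to be positive.
\<close>

lemma bsum_cong:
  assumes "1 \<le> N" "1 \<le> M" "[N = M] (mod (CARD('p) - 1))"
  shows "bsum N w = (bsum M w :: 'p::prime_card mod_ring)"
proof -
  have "y ^ N = y ^ M" for y :: "'p mod_ring"
    using assms mod_ring_power_mod[of y N M] by (cases "y = 0") (auto simp: power_0_left)
  then show ?thesis unfolding bsum_character by simp
qed

lemma bsum_small:
  assumes M: "M < CARD('p)" and w: "0 < w" "w < CARD('p) - 1"
  shows "bsum M w = (of_nat (M choose w) :: 'p::prime_card mod_ring)"
proof -
  have c: "[n = w] (mod (CARD('p) - 1)) \<longleftrightarrow> n = w" if "n \<le> M" for n
  proof (cases "n = CARD('p) - 1")
    case True
    then show ?thesis using w by (simp add: cong_def)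
  next
    case False
    then show ?thesis using that w M by (simp add: cong_def)
  qed
  have "bsum M w = (\<Sum>n\<le>M. if n = w then of_nat (M choose w) else (0 :: 'p mod_ring))"
    unfolding bsum_def using c by (intro sum.cong refl) auto
  then show ?thesis by (cases "w \<le> M") (auto simp: binomial_eq_0)
qed

lemma bsum_0:
  assumes M: "1 \<le> M" "M < CARD('p)" and p: "CARD('p) \<noteq> 2"
  shows "bsum M 0 = (1 + (if M = CARD('p) - 1 then 1 else 0) :: 'p::prime_card mod_ring)"
proof -
  have q: "CARD('p) - 1 > 1" using CARD_gt_1[where 'p='p] p by linarith
  have c: "[n = 0] (mod (CARD('p) - 1)) \<longleftrightarrow> n = 0 \<or> n = CARD('p) - 1" if "n \<le> M" for n
    using that M q by (auto simp: cong_0_iff dest: dvd_imp_le)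
  have "bsum M 0 = (\<Sum>n\<le>M. (if n = 0 then 1 else 0) + (if n = CARD('p) - 1 then of_nat (M choose (CARD('p) - 1)) else (0 :: 'p mod_ring)))"
    unfolding bsum_def using c q by (intro sum.cong refl) auto
  also have "\<dots> = 1 + (if M = CARD('p) - 1 then 1 else 0)"
    using M by (auto simp: sum.distrib)
  finally show ?thesis .
qed

text \<open>
  By Vandermonde, \<open>(r-n+q choose e)\<close> expands into \<open>(r-j-n choose k)\<close>, and \<open>(r-j choose n) (r-j-n choose k) =
  (r-j choose k) (r-j-k choose n)\<close>.
\<close>

lemma binomial_class_sum:
  assumes "j \<le> r"
  shows "(\<Sum>n\<le>r - j. if [n = w] (mod (CARD('p) - 1))
      then of_nat ((r - j) choose n) * of_nat ((r - n + q) choose e) else 0)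
    = (\<Sum>k\<le>e. of_nat ((j + q) choose (e - k)) * of_nat ((r - j) choose k) * (bsum (r - j - k) w :: 'p::prime_card mod_ring))"
proof -
  define R where "R = r - j"
  have key: "of_nat (R choose n) * of_nat ((r - n + q) choose e)
    = (\<Sum>k\<le>e. of_nat ((j + q) choose (e - k)) * of_nat (R choose k) * (of_nat ((R - k) choose n) :: 'p mod_ring))"
    if "n \<le> R" for n
  proof -
    have swp: "(R choose n) * ((R - n) choose k) = (R choose k) * ((R - k) choose n)" for k
      proof (cases "n + k \<le> R")
        case True
        have "(R choose n) * ((R - n) choose k) = (R choose (n + k)) * ((n + k) choose n)"
          using choose_mult[OF le_add1 True] by (simp only: diff_add_inverse)
        also have "(n + k) choose n = (n + k) choose k"
          using binomial_symmetric[OF le_add1, of n k] by (simp only: diff_add_inverse)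
        also have "(R choose (n + k)) * ((n + k) choose k) = (R choose k) * ((R - k) choose n)"
          using choose_mult[OF le_add2 True] by (simp only: diff_add_inverse2)
        finally show ?thesis .
      next
        case False
        then have "(R - n) choose k = 0" "(R - k) choose n = 0 \<or> R choose k = 0"
          using that by (auto simp: binomial_eq_0_iff)
        then show ?thesis by (auto simp: binomial_eq_0)
      qed
    have "(r - n + q) choose e = (\<Sum>k\<le>e. ((R - n) choose k) * ((j + q) choose (e - k)))"
      using vandermonde[of "R - n" "j + q" e] that assms by (simp add: R_def)
    then have "(R choose n) * ((r - n + q) choose e)
      = (\<Sum>k\<le>e. ((j + q) choose (e - k)) * ((R choose n) * ((R - n) choose k)))"
      by (simp add: sum_distrib_left mult_ac)
    also have "\<dots> = (\<Sum>k\<le>e. ((j + q) choose (e - k)) * ((R choose k) * ((R - k) choose n)))"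
      by (simp only: swp)
    finally have "of_nat ((R choose n) * ((r - n + q) choose e))
      = (of_nat (\<Sum>k\<le>e. ((j + q) choose (e - k)) * ((R choose k) * ((R - k) choose n))) :: 'p mod_ring)"
      by simp
    then show ?thesis by (simp add: mult.assoc)
  qed
  have ext: "(\<Sum>n\<le>R. if [n = w] (mod (CARD('p) - 1)) then of_nat ((R - k) choose n) else 0)
     = (bsum (R - k) w :: 'p mod_ring)" for k
    unfolding bsum_def by (intro sum.mono_neutral_right) (auto simp: binomial_eq_0)
  have "(\<Sum>n\<le>R. if [n = w] (mod (CARD('p) - 1))
      then of_nat (R choose n) * of_nat ((r - n + q) choose e) else 0)
    = (\<Sum>n\<le>R. \<Sum>k\<le>e. of_nat ((j + q) choose (e - k)) * of_nat (R choose k) *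
       (if [n = w] (mod (CARD('p) - 1)) then of_nat ((R - k) choose n) else (0 :: 'p mod_ring)))"
    using key by (intro sum.cong refl) auto
  also have "\<dots> = (\<Sum>k\<le>e. of_nat ((j + q) choose (e - k)) * of_nat (R choose k) * bsum (R - k) w)"
    by (subst sum.swap) (simp only: sum_distrib_left[symmetric] ext)
  finally show ?thesis unfolding R_def .
qed

text \<open>
  The polynomial \<open>x \<mapsto> (c - x choose e)\<close>, meaningful in characteristic \<open>p\<close> for \<open>e < p\<close>.
\<close>

definition binpoly :: "'a::field \<Rightarrow> nat \<Rightarrow> 'a poly" where
  "binpoly c e = smult (1 / of_nat (fact e)) (\<Prod>s<e. [:c - of_nat s, - 1:])"

lemma of_nat_binomial_fact:
  "of_nat (m choose e) * of_nat (fact e) = (\<Prod>s<e. of_nat m - of_nat s :: 'a::comm_ring_1)"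
proof (induction e)
  case (Suc e)
  have "Suc e * (m choose Suc e) = (m - e) * (m choose e)"
    by (simp only: binomial_absorption binomial_absorb_comp)
  then have "of_nat (Suc e) * of_nat (m choose Suc e) = of_nat (m - e) * (of_nat (m choose e) :: 'a)"
    by (metis of_nat_mult)
  also have "\<dots> = (of_nat m - of_nat e) * of_nat (m choose e)"
    by (cases "e \<le> m") (simp_all add: of_nat_diff binomial_eq_0)
  finally have *: "of_nat (Suc e) * of_nat (m choose Suc e) = (of_nat m - of_nat e) * (of_nat (m choose e) :: 'a)" .
  have e1: "of_nat (fact (Suc e)) = of_nat (Suc e) * (of_nat (fact e) :: 'a)"
    by (simp only: fact_Suc of_nat_mult of_nat_id)
  have "of_nat (m choose Suc e) * of_nat (fact (Suc e))
      = (of_nat (Suc e) * of_nat (m choose Suc e)) * (of_nat (fact e) :: 'a)"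
    unfolding e1 by (simp only: mult_ac)
  also have "\<dots> = (\<Prod>s<e. of_nat m - of_nat s) * (of_nat m - of_nat e)"
    unfolding * Suc[symmetric] by (simp only: mult_ac)
  finally show ?case by simp
qed simp

lemma fact_mod_ring_neq_0: "e < CARD('p) \<Longrightarrow> (of_nat (fact e) :: 'p::prime_card mod_ring) \<noteq> 0"
  using of_nat_mod_ring_eq_0_iff[of "fact e", where 'p='p] prime_dvd_fact_iff[OF prime_card[where 'a='p], of e]
  by simp

lemma poly_binpoly:
  fixes c :: "'p::prime_card mod_ring"
  assumes "e < CARD('p)" "of_nat m = c - x"
  shows "poly (binpoly c e) x = of_nat (m choose e)"
proof -
  have "poly (binpoly c e) x = (\<Prod>s<e. of_nat m - of_nat s) / of_nat (fact e)"
    unfolding binpoly_def assms(2) by (simp add: poly_prod algebra_simps)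
  also have "\<dots> = of_nat (m choose e)"
    unfolding of_nat_binomial_fact[symmetric] using fact_mod_ring_neq_0[OF assms(1)] by simp
  finally show ?thesis .
qed

lemma degree_binpoly:
  "e < CARD('p) \<Longrightarrow> degree (binpoly (c :: 'p::prime_card mod_ring) e) = e"
  unfolding binpoly_def using fact_mod_ring_neq_0[of e, where 'p='p]
  by (simp add: degree_prod_eq_sum_degree)

section \<open>Rows of interior sums\<close>

lemma lucas_theorem:
  "(of_nat (N choose n) :: 'p::prime_card mod_ring)
    = of_nat ((N mod CARD('p)) choose (n mod CARD('p))) * of_nat ((N div CARD('p)) choose (n div CARD('p)))"
proof -
  let ?p = "CARD('p)"
  define L where "L = ([:1, 1:] :: 'p mod_ring poly)"
  have p0: "?p > 0" using CARD_gt_1[where 'p='p] by simp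
  have cL: "coeff (L ^ k) l = of_nat (k choose l)" for k l
  proof -
    have "L = monom 1 1 + 1" by (simp add: L_def monom_altdef one_pCons)
    then have "L ^ k = (\<Sum>j\<le>k. of_nat (k choose j) * monom 1 1 ^ j * 1 ^ (k - j))"
      by (simp only: binomial_ring)
    also have "\<dots> = (\<Sum>j\<le>k. monom (of_nat (k choose j)) j)"
      by (intro sum.cong refl) (simp add: monom_power of_nat_monom mult_monom)
    finally show ?thesis
      by (cases "l \<le> k") (simp_all add: coeff_sum binomial_eq_0)
  qed
  have "L ^ ?p = (monom 1 1 + 1) ^ ?p" by (simp add: L_def monom_altdef one_pCons)
  also have "\<dots> = monom 1 1 ^ ?p + 1 ^ ?p"
    by (rule freshmans_dream) (simp_all add: prime_card)
  finally have Lp: "L ^ ?p = monom 1 ?p + 1" by (simp add: monom_power)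
  define d N' where "d = N mod ?p" and "N' = N div ?p"
  have dp: "d < ?p" using p0 by (simp add: d_def)
  have "L ^ N = L ^ d * (L ^ ?p) ^ N'"
    by (simp add: d_def N'_def flip: power_mult power_add)
  also have "(L ^ ?p) ^ N' = (\<Sum>j\<le>N'. of_nat (N' choose j) * monom 1 ?p ^ j * 1 ^ (N' - j))"
    unfolding Lp by (rule binomial_ring)
  also have "\<dots> = (\<Sum>j\<le>N'. monom (of_nat (N' choose j)) (?p * j))"
    by (intro sum.cong refl) (simp add: monom_power of_nat_monom mult_monom mult.commute)
  finally have "coeff (L ^ N) n = (\<Sum>j\<le>N'. coeff (L ^ d * monom (of_nat (N' choose j)) (?p * j)) n)"
    by (simp add: sum_distrib_left coeff_sum)
  also have "\<dots> = (\<Sum>j\<le>N'. if j = n div ?p then of_nat (N' choose j) * of_nat (d choose (n mod ?p)) else 0)"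
  proof (intro sum.cong refl)
    fix j
    have n: "n = ?p * (n div ?p) + n mod ?p" by simp
    have e: "coeff (L ^ d * monom (of_nat (N' choose j)) (?p * j)) n
      = (if ?p * j \<le> n then of_nat (N' choose j) * of_nat (d choose (n - ?p * j)) else 0)"
      by (simp only: mult.commute[of "L ^ d"] coeff_monom_mult cL)
    consider "j = n div ?p" | "j < n div ?p" | "j > n div ?p" by linarith
    then show "coeff (L ^ d * monom (of_nat (N' choose j)) (?p * j)) n
      = (if j = n div ?p then of_nat (N' choose j) * of_nat (d choose (n mod ?p)) else 0)"
    proof cases
      case 1
      then show ?thesis unfolding e by (simp add: minus_mult_div_eq_mod)
    next
      case 2
      then have "?p * j + ?p \<le> ?p * (n div ?p)" by (metis Suc_leI mult_Suc_right add.commute mult_le_mono2)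
      then have "n - ?p * j \<ge> ?p" using n by linarith
      then show ?thesis unfolding e using dp 2 by (simp add: binomial_eq_0)
    next
      case 3
      then have "n < ?p * j" using p0 by (simp add: div_less_iff_less_mult mult.commute)
      then show ?thesis unfolding e using 3 by simp
    qed
  qed
  also have "\<dots> = of_nat (N' choose (n div ?p)) * of_nat (d choose (n mod ?p))"
    by (cases "n div ?p \<le> N'") (simp_all add: binomial_eq_0)
  finally show ?thesis unfolding cL d_def N'_def by (simp add: mult.commute)
qed

lemma binomial_mod_upper:
  "k < CARD('p) \<Longrightarrow> (of_nat (N choose k) :: 'p::prime_card mod_ring) = of_nat ((N mod CARD('p)) choose k)"
  using lucas_theorem[of N k, where 'p='p] by simp

lemma lucas_sum:
  fixes G :: "nat \<Rightarrow> 'p::prime_card mod_ring"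
  shows "(\<Sum>n\<le>N. of_nat (N choose n) * G n) = (\<Sum>c<CARD('p). of_nat ((N mod CARD('p)) choose c) *
    (\<Sum>n'\<le>N div CARD('p). of_nat ((N div CARD('p)) choose n') * G (c + CARD('p) * n')))"
proof -
  let ?p = "CARD('p)"
  have p0: "?p > 0" using CARD_gt_1[where 'p='p] by simp
  let ?S = "{..<?p} \<times> {..N div ?p}"
  have img: "(\<lambda>(c, n'). c + ?p * n') ` ?S \<supseteq> {..N}"
  proof
    fix n assume "n \<in> {..N}"
    then have "(n mod ?p, n div ?p) \<in> ?S" using p0 by (simp add: div_le_mono)
    moreover have "n = (\<lambda>(c, n'). c + ?p * n') (n mod ?p, n div ?p)" by simp
    ultimately show "n \<in> (\<lambda>(c, n'). c + ?p * n') ` ?S" by (rule rev_image_eqI)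
  qed
  have inj: "inj_on (\<lambda>(c, n'). c + ?p * n') ?S"
  proof (rule inj_onI, clarify)
    fix c n' d m' assume "c < ?p" "d < ?p" "c + ?p * n' = d + ?p * m'"
    then have "(c + ?p * n') mod ?p = (d + ?p * m') mod ?p" "(c + ?p * n') div ?p = (d + ?p * m') div ?p"
      by simp_all
    then show "c = d \<and> n' = m'" using \<open>c < ?p\<close> \<open>d < ?p\<close> p0 by simp
  qed
  have "(\<Sum>n\<le>N. of_nat (N choose n) * G n)
      = (\<Sum>n\<in>(\<lambda>(c, n'). c + ?p * n') ` ?S. of_nat (N choose n) * G n)"
    using img by (intro sum.mono_neutral_left) (auto simp: binomial_eq_0)
  also have "\<dots> = (\<Sum>(c, n')\<in>?S. of_nat (N choose (c + ?p * n')) * G (c + ?p * n'))"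
    by (subst sum.reindex[OF inj]) (simp add: case_prod_unfold o_def)
  also have "\<dots> = (\<Sum>(c, n')\<in>?S. of_nat ((N mod ?p) choose c) * (of_nat ((N div ?p) choose n') * G (c + ?p * n')))"
  proof (intro sum.cong refl, clarify)
    fix c n' assume "c < ?p"
    then have "of_nat (N choose (c + ?p * n')) = of_nat ((N mod ?p) choose c) * (of_nat ((N div ?p) choose n') :: 'p mod_ring)"
      by (subst lucas_theorem) simp
    then show "of_nat (N choose (c + ?p * n')) * G (c + ?p * n')
      = of_nat ((N mod ?p) choose c) * (of_nat ((N div ?p) choose n') * G (c + ?p * n'))"
      by (simp only: mult.assoc)
  qed
  also have "\<dots> = (\<Sum>c<?p. \<Sum>n'\<le>N div ?p. of_nat ((N mod ?p) choose c) * (of_nat ((N div ?p) choose n') * G (c + ?p * n')))"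
    by (simp add: sum.cartesian_product)
  finally show ?thesis by (simp only: sum_distrib_left)
qed

text \<open>
  A row of a cut-off binomial polynomial is the complete class sum less the terms at the two ends.
\<close>

lemma interior_sum:
  fixes q e j w :: nat
  assumes "2 * i < r" "e < CARD('p::prime_card)" "j \<le> i"
  shows "(\<Sum>n\<le>r - j. of_nat ((r - j) choose n) * cut_poly r i w (binpoly (of_nat (r + q)) e) n)
    = (\<Sum>k\<le>e. of_nat ((j + q) choose (e - k)) * of_nat ((r - j) choose k) * (bsum (r - j - k) w :: 'p mod_ring))
    - (\<Sum>n\<le>i. if [n = w] (mod (CARD('p) - 1))
         then of_nat ((r - j) choose n) * of_nat ((r - n + q) choose e) else 0)
    - (\<Sum>k\<le>i - j. if [r - j - k = w] (mod (CARD('p) - 1))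
         then of_nat ((r - j) choose k) * of_nat ((j + k + q) choose e) else 0)"
proof -
  define G :: "nat \<Rightarrow> 'p mod_ring" where "G n = (if [n = w] (mod (CARD('p) - 1))
      then of_nat ((r - j) choose n) * of_nat ((r - n + q) choose e) else 0)" for n
  have P: "poly (binpoly (of_nat (r + q)) e) (of_nat n) = (of_nat ((r - n + q) choose e) :: 'p mod_ring)"
    if "n \<le> r" for n
    using that assms(2) by (intro poly_binpoly) (simp_all add: of_nat_diff)
  have "(\<Sum>n\<le>r - j. of_nat ((r - j) choose n) * cut_poly r i w (binpoly (of_nat (r + q)) e) n)
    = (\<Sum>n\<in>{i<..<r - i}. G n)"
  proof (intro sum.mono_neutral_cong_right)
    show "{i<..<r - i} \<subseteq> {..r - j}" using assms by auto
    show "\<forall>n\<in>{..r - j} - {i<..<r - i}. of_nat ((r - j) choose n) * cut_poly r i w (binpoly (of_nat (r + q)) e) n = 0"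
      using assms by (auto simp: cut_poly_def)
    fix x assume x: "x \<in> {i<..<r - i}"
    then have c: "i < x" "x + i < r" "x \<le> r" by auto
    show "of_nat ((r - j) choose x) * cut_poly r i w (binpoly (of_nat (r + q)) e) x = G x"
      by (cases "[x = w] (mod CARD('p) - 1)")
        (simp_all only: cut_poly_def G_def c P simp_thms if_True if_False mult_zero_right)
  qed simp
  also have "\<dots> = (\<Sum>n\<le>r - j. G n) - (\<Sum>n\<le>i. G n) - (\<Sum>n\<in>{r - i..r - j}. G n)"
  proof -
    have "{..r - j} = {..i} \<union> ({i<..<r - i} \<union> {r - i..r - j})" using assms by auto
    then have "(\<Sum>n\<le>r - j. G n) = (\<Sum>n\<le>i. G n) + (\<Sum>n\<in>{i<..<r - i} \<union> {r - i..r - j}. G n)"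
      using assms by (simp only:) (subst sum.union_disjoint, auto)
    also have "(\<Sum>n\<in>{i<..<r - i} \<union> {r - i..r - j}. G n) = (\<Sum>n\<in>{i<..<r - i}. G n) + (\<Sum>n\<in>{r - i..r - j}. G n)"
      by (subst sum.union_disjoint) auto
    finally show ?thesis by simp
  qed
  also have "(\<Sum>n\<le>r - j. G n) = (\<Sum>k\<le>e. of_nat ((j + q) choose (e - k)) * of_nat ((r - j) choose k) * bsum (r - j - k) w)"
    unfolding G_def using assms by (intro binomial_class_sum) simp
  also have "(\<Sum>n\<in>{r - i..r - j}. G n) = (\<Sum>k\<le>i - j. if [r - j - k = w] (mod (CARD('p) - 1))
         then of_nat ((r - j) choose k) * of_nat ((j + k + q) choose e) else 0)"
  proof (rule sum.reindex_bij_witness[of _ "\<lambda>k. r - j - k" "\<lambda>n. r - j - n"])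
    fix n assume n: "n \<in> {r - i..r - j}"
    have "(r - j) choose (r - j - n) = (r - j) choose n"
      using n binomial_symmetric[of n "r - j"] by simp
    moreover have "j + (r - j - n) = r - n" "r - j - (r - j - n) = n" using n assms by auto
    ultimately show "(if [r - j - (r - j - n) = w] (mod CARD('p) - 1)
          then of_nat ((r - j) choose (r - j - n)) * of_nat ((j + (r - j - n) + q) choose e) else 0) = G n"
      by (simp add: G_def)
  qed (use assms in auto)
  finally show ?thesis unfolding G_def .
qed

text \<open>
  In class \<open>0\<close> every \<open>bsum (r-j-k) 0\<close> is \<open>1\<close>, or \<open>2\<close> when \<open>j + k\<close> is congruent to \<open>r\<close>.
  The ones add up by Vandermonde to \<open>(r+q choose e)\<close>, which is the lower end term \<open>n = 0\<close>; what remains are the exceptional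
  \<open>k\<close>, which have to cancel against the upper end terms.
\<close>

lemma class_zero_annih:
  fixes q e i r :: nat
  assumes p3: "CARD('p::prime_card) \<ge> 3" and i: "i < CARD('p)" and r: "2 * i < r" and e: "e \<le> i"
    and top: "\<And>j. i = CARD('p) - 1 \<Longrightarrow> j \<le> i \<Longrightarrow>
      (of_nat ((r - (CARD('p) - 1) + q) choose e) :: 'p mod_ring) = 0"
    and term_eq: "\<And>j k. j \<le> i \<Longrightarrow> [j + k = r] (mod (CARD('p) - 1)) \<Longrightarrow>
      (of_nat ((r - j) choose k) :: 'p mod_ring) \<noteq> 0 \<Longrightarrow>
      (if k \<le> e then of_nat ((j + q) choose (e - k)) else 0)
        = (if j + k \<le> i then of_nat ((j + k + q) choose e) else (0 :: 'p mod_ring))"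
  shows "cut_poly r i 0 (binpoly (of_nat (r + q)) e :: 'p mod_ring poly) \<in> annih r (relations r i)"
proof (rule cut_poly_annih_relations)
  let ?q = "CARD('p) - 1"
  show "i < CARD('p)" "i \<le> r" using i r by auto
  show "degree (binpoly (of_nat (r + q)) e :: 'p mod_ring poly) \<le> i"
    using e i by (simp add: degree_binpoly)
  fix j assume j: "j \<le> i"
  define A where "A k = (if k \<le> e then of_nat ((j + q) choose (e - k)) else (0 :: 'p mod_ring))" for k
  define B where "B k = (if j + k \<le> i then of_nat ((j + k + q) choose e) else (0 :: 'p mod_ring))" for k
  define C where "C k = (of_nat ((r - j) choose k) :: 'p mod_ring)" for k
  define cl where "cl k \<longleftrightarrow> [j + k = r] (mod ?q)" for k
  have cl0: "[r - j - k = 0] (mod ?q) \<longleftrightarrow> cl k" if "j + k \<le> r" for k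
  proof -
    have "[j + k = r] (mod ?q) \<longleftrightarrow> [r = j + k] (mod ?q)" by (rule cong_sym_eq)
    also have "\<dots> \<longleftrightarrow> ?q dvd (r - (j + k))" using that by (simp add: cong_altdef_nat)
    finally show ?thesis by (simp add: cong_0_iff cl_def)
  qed
  have b: "bsum (r - j - k) 0 = (1 + (if cl k then 1 else 0) :: 'p mod_ring)" if k: "k \<le> e" for k
  proof -
    have jk: "j + k \<le> 2 * i" using j k e by simp
    define M where "M = (r - j - k - 1) mod ?q + 1"
    have "(r - j - k - 1) mod ?q < ?q" using p3 by (intro mod_less_divisor) simp
    then have M: "1 \<le> M" "M < CARD('p)" unfolding M_def by linarith+
    have "[M = r - j - k] (mod ?q)"
    proof -
      have "[(r - j - k - 1) mod ?q + 1 = (r - j - k - 1) + 1] (mod ?q)"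
        by (intro cong_add cong_refl) (simp add: cong_def)
      moreover have "(r - j - k - 1) + 1 = r - j - k" using jk r by linarith
      ultimately show ?thesis by (simp only: M_def)
    qed
    then have "bsum (r - j - k) 0 = (bsum M 0 :: 'p mod_ring)"
      using M jk r by (intro bsum_cong) (auto simp: cong_sym)
    also have "\<dots> = 1 + (if M = ?q then 1 else 0)" using M p3 by (intro bsum_0) auto
    also have "M = ?q \<longleftrightarrow> cl k"
    proof -
      have "M = ?q \<longleftrightarrow> [M = 0] (mod ?q)"
        using M by (auto simp: cong_0_iff dest: dvd_imp_le)
      also have "\<dots> \<longleftrightarrow> [r - j - k = 0] (mod ?q)"
        using \<open>[M = r - j - k] (mod ?q)\<close> by (simp add: cong_def)
      finally show ?thesis using cl0[of k] jk r by simp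
    qed
    finally show ?thesis .
  qed
  have "(\<Sum>k\<le>e. of_nat ((j + q) choose (e - k)) * of_nat ((r - j) choose k) * (bsum (r - j - k) 0 :: 'p mod_ring))
    = (\<Sum>k\<le>e. A k * C k) + (\<Sum>k\<le>e. if cl k then A k * C k else 0)"
    unfolding sum.distrib[symmetric] A_def C_def using b by (intro sum.cong refl) (auto simp: algebra_simps)
  also have "(\<Sum>k\<le>e. A k * C k) = of_nat ((r + q) choose e)"
  proof -
    have "(\<Sum>k\<le>e. ((r - j) choose k) * ((j + q) choose (e - k))) = (r + q) choose e"
      using vandermonde[of "r - j" "j + q" e] j r by simp
    then have "of_nat ((r + q) choose e) = (of_nat (\<Sum>k\<le>e. ((r - j) choose k) * ((j + q) choose (e - k))) :: 'p mod_ring)"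
      by simp
    then show ?thesis by (simp add: A_def C_def mult.commute)
  qed
  also have "(\<Sum>k\<le>e. if cl k then A k * C k else 0) = (\<Sum>k\<le>e + i. if cl k then A k * C k else 0)"
    by (intro sum.mono_neutral_left) (auto simp: A_def)
  also have "\<dots> = (\<Sum>k\<le>e + i. if cl k then B k * C k else 0)"
    using term_eq[OF j] by (intro sum.cong refl) (force simp: A_def B_def C_def cl_def)
  also have "\<dots> = (\<Sum>k\<le>i - j. if cl k then B k * C k else 0)"
    using j by (intro sum.mono_neutral_right) (auto simp: B_def)
  also have "\<dots> = (\<Sum>k\<le>i - j. if [r - j - k = 0] (mod ?q)
         then of_nat ((r - j) choose k) * of_nat ((j + k + q) choose e) else 0)"
    using cl0 j r by (intro sum.cong refl) (auto simp: B_def C_def)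
  finally have tot: "(\<Sum>k\<le>e. of_nat ((j + q) choose (e - k)) * of_nat ((r - j) choose k) * (bsum (r - j - k) 0 :: 'p mod_ring))
    = of_nat ((r + q) choose e) + (\<Sum>k\<le>i - j. if [r - j - k = 0] (mod ?q)
         then of_nat ((r - j) choose k) * of_nat ((j + k + q) choose e) else 0)" .
  have low: "(\<Sum>n\<le>i. if [n = 0] (mod ?q)
         then of_nat ((r - j) choose n) * of_nat ((r - n + q) choose e) else 0)
      = (of_nat ((r + q) choose e) :: 'p mod_ring)"
  proof -
    have "(if [n = 0] (mod ?q) then of_nat ((r - j) choose n) * of_nat ((r - n + q) choose e) else 0)
      = (if n = 0 then of_nat ((r + q) choose e) else (0 :: 'p mod_ring))" if "n \<le> i" for n
    proof (cases "n = 0 \<or> \<not> [n = 0] (mod ?q)")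
      case False
      then have "n = ?q" "i = ?q" using that i by (auto simp: cong_0_iff dest!: dvd_imp_le)
      then show ?thesis using top[OF _ j] p3 by simp
    qed auto
    then have "(\<Sum>n\<le>i. if [n = 0] (mod ?q)
         then of_nat ((r - j) choose n) * of_nat ((r - n + q) choose e) else 0)
      = (\<Sum>n\<le>i. if n = 0 then of_nat ((r + q) choose e) else (0 :: 'p mod_ring))"
      by (intro sum.cong refl) auto
    then show ?thesis by simp
  qed
  show "(\<Sum>n\<le>r - j. of_nat ((r - j) choose n) * cut_poly r i 0 (binpoly (of_nat (r + q)) e :: 'p mod_ring poly) n) = 0"
    using e i by (subst interior_sum[OF r _ j]) (simp_all only: tot low, auto)
qed

section \<open>Explicit elements of the annihilator\<close>

text \<open>
  The sum of \<open>S\<close> and the relations is a proper intermediate submodule: \<open>f\<close> vanishes on it, so it is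
  not everything, and \<open>g\<close> does not, so it is larger than the relations.
\<close>

lemma reducible_by_subspace:
  fixes S :: "'p::prime_card mod_ring poly poly set"
  assumes ir: "i \<le> r" and S: "stable_subspace r S"
    and f: "f \<in> annih r (relations r i)" "f \<in> annih r S" "n \<le> r" "f n \<noteq> 0"
    and g: "g \<in> annih r (relations r i)" "g \<notin> annih r S"
  shows "\<not> girreducible Fp GL2 (Qmod r i :: ('p mod_ring, 'p mod_ring ^ 2 ^ 2, 'p mod_ring poly poly set) gmodule)"
proof
  assume irr: "girreducible Fp GL2 (Qmod r i :: ('p mod_ring, 'p mod_ring ^ 2 ^ 2, 'p mod_ring poly poly set) gmodule)"
  note N = stable_subspace_relations[OF ir, where 'a='p]
  define K where "K = {F + G | F G. F \<in> S \<and> G \<in> (relations r i :: 'p mod_ring poly poly set)}"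
  have K: "stable_subspace r K" unfolding K_def by (rule stable_subspace_sum[OF S N])
  have NK: "relations r i \<subseteq> K"
  proof
    fix G :: "'p mod_ring poly poly" assume "G \<in> relations r i"
    then have "G = 0 + G \<and> 0 \<in> S \<and> G \<in> relations r i" using stable_subspace_0[OF S] by simp
    then show "G \<in> K" unfolding K_def by blast
  qed
  have SK: "S \<subseteq> K"
  proof
    fix F assume "F \<in> S"
    then have "F = F + 0 \<and> F \<in> S \<and> 0 \<in> (relations r i :: 'p mod_ring poly poly set)"
      using stable_subspace_0[OF N] by simp
    then show "F \<in> K" unfolding K_def by blast
  qed
  from g obtain F where "F \<in> S" "pairing r g F \<noteq> 0" by (auto simp: annih_def)
  with g(1) have "F \<notin> relations r i" by (auto simp: annih_def)
  then have "K \<noteq> relations r i" using SK \<open>F \<in> S\<close> by blast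
  moreover have "K \<noteq> forms r"
  proof
    assume "K = forms r"
    then have "bmono (r - n) n \<in> K" using f(3) by (simp add: forms_bmono)
    then obtain F G where FG: "bmono (r - n) n = F + G" "F \<in> S" "G \<in> relations r i"
      unfolding K_def by blast
    have "pairing r f (bmono (r - n) n) = 0"
      unfolding FG(1) pairing_add using f(1,2) FG(2,3) by (simp add: annih_def)
    then show False using f(3,4) by (simp add: pairing_bmono)
  qed
  ultimately show False
    using irr K NK unfolding Qmod_eq girreducible_quotient_iff[OF N] by blast
qed

text \<open>
  Besides the parameters of the theorem, \<open>rq\<close> is the part of \<open>r\<close> above its last base-\<open>p\<close> digit.
\<close>

locale quotient_parameters =
  fixes i r a r0 rq :: nat and ty :: "'p::prime_card itself"
  assumes p3: "CARD('p) \<ge> 3" and i1: "1 \<le> i" and ip: "i \<le> CARD('p) - 1"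
    and r_ge: "r \<ge> i * (CARD('p) + 1) + CARD('p)"
    and r_cong: "[r = a] (mod (CARD('p) - 1))" and a1: "1 \<le> a" and ap: "a \<le> CARD('p) - 1"
    and r0: "r0 = r mod CARD('p)" and rq: "rq = r div CARD('p)"
begin

abbreviation quotient_module ::
    "('p mod_ring, 'p mod_ring ^ 2 ^ 2, 'p mod_ring poly poly set) gmodule" where
  "quotient_module \<equiv> Qmod r i"

lemma r_digits: "r = r0 + CARD('p) * rq" "r0 < CARD('p)"
  using CARD_gt_1[where 'p='p] by (simp_all add: r0 rq)

lemma i_less_p: "i < CARD('p)" using ip p3 by linarith

lemma rq_ge: "i + 1 \<le> rq"
proof -
  have "(i + 1) * CARD('p) \<le> r" using r_ge by (simp add: algebra_simps)
  then show ?thesis using p3 by (simp add: rq less_eq_div_iff_mult_less_eq)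
qed

lemma two_i_less_r: "2 * i < r"
proof -
  have "i * 3 \<le> i * CARD('p)" using p3 by (intro mult_le_mono) auto
  moreover have "i * (CARD('p) + 1) = i * CARD('p) + i" by simp
  ultimately show ?thesis using r_ge p3 by linarith
qed

lemma i_le_r: "i \<le> r" using two_i_less_r by simp

lemma r_minus_low: "j \<le> r0 \<Longrightarrow> (r - j) mod CARD('p) = r0 - j" "j \<le> r0 \<Longrightarrow> (r - j) div CARD('p) = rq"
proof -
  assume j: "j \<le> r0"
  then have "r - j = (r0 - j) + CARD('p) * rq" using r_digits by linarith
  moreover have "r0 - j < CARD('p)" using r_digits(2) by linarith
  ultimately show "(r - j) mod CARD('p) = r0 - j" "(r - j) div CARD('p) = rq" by simp_all
qed

lemma r_minus_high:
  assumes "r0 < j" "j < CARD('p)"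
  shows "(r - j) mod CARD('p) = CARD('p) + r0 - j" "(r - j) div CARD('p) = rq - 1"
proof -
  obtain s where s: "rq = Suc s" using rq_ge by (cases rq) auto
  have "r = r0 + CARD('p) * Suc s" using r_digits(1) unfolding s .
  then have "r - j = (CARD('p) + r0 - j) + CARD('p) * s" using assms by simp
  moreover have "CARD('p) + r0 - j < CARD('p)" using assms by linarith
  ultimately have "(r - j) mod CARD('p) = CARD('p) + r0 - j \<and> (r - j) div CARD('p) = s" by simp
  then show "(r - j) mod CARD('p) = CARD('p) + r0 - j" "(r - j) div CARD('p) = rq - 1"
    using s by simp_all
qed

lemma binomial_r_minus_low:
  "j \<le> r0 \<Longrightarrow> k < CARD('p) \<Longrightarrow> (of_nat ((r - j) choose k) :: 'p mod_ring) = of_nat ((r0 - j) choose k)"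
  by (simp add: binomial_mod_upper[where N = "r - j"] r_minus_low)

lemma binomial_wrap:
  assumes "m < CARD('p)" "k < CARD('p)"
  shows "(of_nat ((CARD('p) + m) choose k) :: 'p mod_ring) = of_nat (m choose k)"
  using assms by (subst binomial_mod_upper) simp_all

lemma rq_cong: "[rq + r0 = a] (mod (CARD('p) - 1))"
proof -
  have "CARD('p) * rq = rq + (CARD('p) - 1) * rq" using p3 by (cases "CARD('p)") auto
  then have "r = rq + r0 + (CARD('p) - 1) * rq" using r_digits(1) by linarith
  then have "[rq + r0 = r] (mod (CARD('p) - 1))"
    unfolding cong_def by (metis mod_mult_self2)
  then show ?thesis using r_cong cong_trans by blast
qed

lemma cong_r_cases:
  assumes "[s = r] (mod (CARD('p) - 1))" "s < a + 2 * (CARD('p) - 1)"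
  obtains "s = a" | "s = a + (CARD('p) - 1)" | "s = 0" "a = CARD('p) - 1"
proof -
  let ?q = "CARD('p) - 1"
  have "[s = a] (mod ?q)" using assms(1) r_cong cong_trans by blast
  then have md: "s mod ?q = a mod ?q" by (simp add: cong_def)
  show ?thesis
  proof (cases "s \<ge> a")
    case True
    then have "?q dvd s - a" using md by (metis mod_eq_dvd_iff_nat)
    then obtain t where t: "s - a = ?q * t" by (rule dvdE)
    have "?q * t < ?q * 2" using assms(2) t True by linarith
    then have "t < 2" by simp
    then consider "t = 0" | "t = 1" by linarith
    then show ?thesis
    proof cases
      case 1
      then have "s = a" using t True by simp
      then show ?thesis by (rule that(1))
    next
      case 2
      then have "s - a = ?q" using t by simp
      then have "s = a + ?q" using True by linarith
      then show ?thesis by (rule that(2))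
    qed
  next
    case False
    then have "?q dvd a - s" using md by (metis mod_eq_dvd_iff_nat nat_le_linear)
    then have "?q \<le> a - s" using False by (intro dvd_imp_le) auto
    then show ?thesis using ap that False by linarith
  qed
qed

text \<open>
  By the lower bound on \<open>r\<close>, each class has at least \<open>i + 1\<close> points between the two ends, enough to
  determine a polynomial of degree \<open>i\<close>.
\<close>

lemma interior_points:
  "\<exists>n0. i < n0 \<and> [n0 = w] (mod (CARD('p) - 1)) \<and> (\<forall>t\<le>i. n0 + (CARD('p) - 1) * t + i < r)"
proof -
  have "0 < CARD('p) - 1" using p3 by simp
  then obtain n0 where n0: "i + 1 \<le> n0" "n0 < i + 1 + (CARD('p) - 1)" "[n0 = w] (mod (CARD('p) - 1))"
    by (rule class_representative)
  have "n0 + (CARD('p) - 1) * t + i < r" if "t \<le> i" for t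
  proof -
    have "(CARD('p) - 1) * t \<le> (CARD('p) - 1) * i" using that by simp
    moreover have "i * (CARD('p) + 1) = (CARD('p) - 1) * i + 2 * i"
      using p3 by (cases "CARD('p)") (auto simp: algebra_simps)
    ultimately show ?thesis using n0 r_ge by linarith
  qed
  with n0 show ?thesis by (intro exI[of _ n0]) auto
qed

lemma interior_unique:
  fixes P P' :: "'p mod_ring poly"
  assumes "degree P \<le> i" "degree P' \<le> i"
    and eq: "\<And>n. i < n \<Longrightarrow> n + i < r \<Longrightarrow> [n = w] (mod (CARD('p) - 1)) \<Longrightarrow>
      poly P (of_nat n) = poly P' (of_nat n)"
  shows "P = P'"
proof (rule ccontr)
  assume "P \<noteq> P'"
  let ?q = "CARD('p) - 1"
  obtain n0 where n0: "i < n0" "[n0 = w] (mod ?q)" "\<And>t. t \<le> i \<Longrightarrow> n0 + ?q * t + i < r"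
    using interior_points[of w] by blast
  define f where "f t = (of_nat (n0 + ?q * t) :: 'p mod_ring)" for t
  have fe: "f t = of_nat n0 - of_nat t" for t
  proof -
    have "(of_nat ?q :: 'p mod_ring) = - 1" using p3 by (simp add: of_nat_diff)
    then show ?thesis unfolding f_def of_nat_add of_nat_mult by simp
  qed
  have inj: "inj_on f {..i}"
  proof (rule inj_onI)
    fix s t assume "s \<in> {..i}" "t \<in> {..i}" "f s = f t"
    then have "(of_nat s :: 'p mod_ring) = of_nat t" "s < CARD('p)" "t < CARD('p)"
      using i_less_p by (auto simp: fe)
    then show "s = t" by (simp add: of_nat_mod_ring_eq_iff)
  qed
  have nz: "P - P' \<noteq> 0" using \<open>P \<noteq> P'\<close> by simp
  have "f ` {..i} \<subseteq> {x. poly (P - P') x = 0}"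
  proof safe
    fix t assume "t \<le> i"
    have "[n0 + ?q * t = w] (mod ?q)" using n0(2) by (simp add: cong_def)
    then show "poly (P - P') (f t) = 0"
      using eq[of "n0 + ?q * t"] n0(1) n0(3)[OF \<open>t \<le> i\<close>] by (simp add: f_def)
  qed
  then have "card (f ` {..i}) \<le> card {x. poly (P - P') x = 0}"
    by (intro card_mono) auto
  also have "\<dots> \<le> degree (P - P')" by (rule poly_roots_degree[OF nz])
  also have "\<dots> \<le> i" using assms by (intro degree_diff_le)
  finally show False by (simp add: card_image[OF inj])
qed

lemma cut_poly_nonzero:
  fixes P :: "'p mod_ring poly"
  assumes "degree P \<le> i" "P \<noteq> 0"
  shows "\<exists>n\<le>r. cut_poly r i w P n \<noteq> 0"
proof (rule ccontr)
  assume "\<not> ?thesis"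
  then have z: "\<And>n. n \<le> r \<Longrightarrow> cut_poly r i w P n = 0" by blast
  have "P = 0"
  proof (rule interior_unique[where w = w])
    fix n assume "i < n" "n + i < r" "[n = w] (mod CARD('p) - 1)"
    then show "poly P (of_nat n) = poly 0 (of_nat n)" using z[of n] by (simp add: cut_poly_def)
  qed (use assms in auto)
  then show False using assms by simp
qed

text \<open>
  The annihilator of \<open>V^(m)\<close> only contains polynomials of degree below \<open>m\<close>, and the
  polynomial of a class is unique.
\<close>

lemma cut_poly_not_annih_Vfilt:
  fixes P :: "'p mod_ring poly"
  assumes m: "1 \<le> m" "m \<le> degree P" and P: "degree P \<le> i"
  shows "cut_poly r i w P \<notin> annih r (Vfilt r m)"
proof
  assume "cut_poly r i w P \<in> annih r (Vfilt r m)"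
  then have "\<forall>w'. \<exists>P'. degree P' < m \<and> (\<forall>n. m \<le> n \<and> n + m \<le> r \<and> [n = w'] (mod CARD('p) - 1) \<longrightarrow>
      cut_poly r i w P n = poly P' (of_nat n))"
    using m P i_less_p by (subst (asm) Vfilt_annih_iff_poly) auto
  then obtain P' where P': "degree P' < m"
    "\<And>n. m \<le> n \<and> n + m \<le> r \<and> [n = w] (mod CARD('p) - 1) \<Longrightarrow> cut_poly r i w P n = poly P' (of_nat n)"
    by blast
  have "P = P'"
  proof (rule interior_unique[where w = w])
    fix n assume "i < n" "n + i < r" "[n = w] (mod CARD('p) - 1)"
    then show "poly P (of_nat n) = poly P' (of_nat n)" using P'(2)[of n] m P by (simp add: cut_poly_def)
  qed (use P P' m in auto)
  then show False using P' m by simp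
qed

text \<open>
  The congruence \<open>j + k = r\<close> modulo \<open>p - 1\<close> leaves few possible values of \<open>j + k\<close>, and the
  exceptional terms are treated separately for each.
\<close>

lemma class_zero:
  fixes q e :: nat
  assumes e: "e \<le> i"
    and top: "i = CARD('p) - 1 \<Longrightarrow> (of_nat ((r - (CARD('p) - 1) + q) choose e) :: 'p mod_ring) = 0"
    and jka: "\<And>j k. j \<le> i \<Longrightarrow> j + k = a \<Longrightarrow> (of_nat ((r - j) choose k) :: 'p mod_ring) \<noteq> 0 \<Longrightarrow>
      (if k \<le> e then of_nat ((j + q) choose (e - k)) else 0)
        = (if a \<le> i then of_nat ((a + q) choose e) else (0 :: 'p mod_ring))"
    and jkp: "\<And>j k. j \<le> i \<Longrightarrow> k \<le> e \<Longrightarrow> j + k = a + (CARD('p) - 1) \<Longrightarrow>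
      (of_nat ((r - j) choose k) :: 'p mod_ring) \<noteq> 0 \<Longrightarrow> (of_nat ((j + q) choose (e - k)) :: 'p mod_ring) = 0"
  shows "cut_poly r i 0 (binpoly (of_nat (r + q)) e :: 'p mod_ring poly) \<in> annih r (relations r i)"
proof (rule class_zero_annih[OF p3 i_less_p two_i_less_r e top])
  fix j k
  assume j: "j \<le> i" and c: "[j + k = r] (mod CARD('p) - 1)"
    and nz: "(of_nat ((r - j) choose k) :: 'p mod_ring) \<noteq> 0"
  show "(if k \<le> e then of_nat ((j + q) choose (e - k)) else 0)
        = (if j + k \<le> i then of_nat ((j + k + q) choose e) else (0 :: 'p mod_ring))"
  proof (cases "k \<le> e \<or> j + k \<le> i")
    case True
    then have "j + k < a + 2 * (CARD('p) - 1)" using j e ip a1 by linarith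
    with c show ?thesis
    proof (rule cong_r_cases)
      assume s: "j + k = a"
      show ?thesis using jka[OF j s nz] unfolding s .
    next
      assume s: "j + k = a + (CARD('p) - 1)"
      then have "\<not> j + k \<le> i" using ip a1 by linarith
      then show ?thesis using jkp[OF j _ s nz] by simp
    qed simp
  qed simp
qed simp

lemma annih_low_degree:
  assumes "e + i < a" "e \<le> i"
  shows "cut_poly r i 0 (binpoly (of_nat (r + 0)) e :: 'p mod_ring poly) \<in> annih r (relations r i)"
proof (rule class_zero)
  show "e \<le> i" by fact
next
  show "(of_nat ((r - (CARD('p) - 1) + 0) choose e) :: 'p mod_ring) = 0" if "i = CARD('p) - 1"
    using that assms ap by linarith
next
  fix j k assume "j \<le> i" "j + k = a"
  then show "(if k \<le> e then of_nat ((j + 0) choose (e - k)) else 0)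
        = (if a \<le> i then of_nat ((a + 0) choose e) else (0 :: 'p mod_ring))"
    using assms by auto
next
  fix j k
  assume "j \<le> i" "k \<le> e" "j + k = a + (CARD('p) - 1)"
  then show "(of_nat ((j + 0) choose (e - k)) :: 'p mod_ring) = 0" using assms p3 by linarith
qed

text \<open>
  The shift \<open>q = p - 1 - r0\<close> gives \<open>r + q - n\<close> the last digit \<open>p - 1 - c\<close> when \<open>n\<close> has last digit \<open>c\<close>.  So,
  with \<open>e = a - r0\<close>, the values are nonzero exactly for \<open>c \<le> p - 1 - e\<close>.
\<close>

lemma annih_excess_degree:
  assumes "r0 < a" "a - r0 \<le> i" "i \<le> CARD('p) - 2"
  shows "cut_poly r i 0 (binpoly (of_nat (r + (CARD('p) - 1 - r0))) (a - r0) :: 'p mod_ring poly)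
    \<in> annih r (relations r i)"
proof (rule class_zero)
  show "a - r0 \<le> i" by fact
  show "(of_nat ((r - (CARD('p) - 1) + (CARD('p) - 1 - r0)) choose (a - r0)) :: 'p mod_ring) = 0"
    if "i = CARD('p) - 1" using that assms(3) p3 by linarith
next
  fix j k
  assume j: "j \<le> i" and s: "j + k = a" and nz: "(of_nat ((r - j) choose k) :: 'p mod_ring) \<noteq> 0"
  have right: "(of_nat ((a + (CARD('p) - 1 - r0)) choose (a - r0)) :: 'p mod_ring) = 0"
  proof -
    have "a + (CARD('p) - 1 - r0) = CARD('p) + (a - r0 - 1)" using assms r_digits(2) by linarith
    moreover have "(of_nat ((CARD('p) + (a - r0 - 1)) choose (a - r0)) :: 'p mod_ring) = 0"
      using assms(1) ap p3 by (subst binomial_wrap) (auto simp: binomial_eq_0)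
    ultimately show ?thesis by simp
  qed
  have left: "(of_nat ((j + (CARD('p) - 1 - r0)) choose (a - r0 - k)) :: 'p mod_ring) = 0" if k: "k \<le> a - r0"
  proof (cases "j = r0")
    case True
    then have "k = a - r0" using s by simp
    then have "(of_nat ((r - j) choose k) :: 'p mod_ring) = of_nat (0 choose k)"
      using True ap p3 by (subst binomial_r_minus_low) auto
    then show ?thesis using nz \<open>k = a - r0\<close> assms(1) by (simp add: binomial_eq_0)
  next
    case False
    then have jr: "r0 < j" using k s assms(1) by linarith
    have "j + (CARD('p) - 1 - r0) = CARD('p) + (j - 1 - r0)" "a - r0 - k = j - r0"
      using jr s k r_digits(2) by linarith+
    moreover have "(of_nat ((CARD('p) + (j - 1 - r0)) choose (j - r0)) :: 'p mod_ring) = 0"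
      using jr j i_less_p by (subst binomial_wrap) (auto simp: binomial_eq_0)
    ultimately show ?thesis by simp
  qed
  show "(if k \<le> a - r0 then of_nat ((j + (CARD('p) - 1 - r0)) choose (a - r0 - k)) else 0)
        = (if a \<le> i then of_nat ((a + (CARD('p) - 1 - r0)) choose (a - r0)) else (0 :: 'p mod_ring))"
    using left right by simp
next
  fix j k
  assume "j \<le> i" "k \<le> a - r0" "j + k = a + (CARD('p) - 1)"
  then show "(of_nat ((j + (CARD('p) - 1 - r0)) choose (a - r0 - k)) :: 'p mod_ring) = 0"
    using assms p3 by linarith
qed

lemma annih_degree_a:
  assumes "a \<le> i" "i \<le> CARD('p) - 2 \<or> r0 = CARD('p) - 1"
  shows "cut_poly r i 0 (binpoly (of_nat (r + 0)) a :: 'p mod_ring poly) \<in> annih r (relations r i)"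
proof (rule class_zero)
  show "a \<le> i" by fact
  show "(of_nat ((r - (CARD('p) - 1) + 0) choose a) :: 'p mod_ring) = 0" if "i = CARD('p) - 1"
  proof -
    have "r0 = CARD('p) - 1" using that assms(2) p3 by linarith
    then have "(of_nat ((r - (CARD('p) - 1)) choose a) :: 'p mod_ring) = of_nat (0 choose a)"
      using ap p3 by (subst binomial_r_minus_low) auto
    then show ?thesis using a1 by (simp add: binomial_eq_0)
  qed
next
  fix j k assume "j \<le> i" "j + k = a"
  then show "(if k \<le> a then of_nat ((j + 0) choose (a - k)) else 0)
        = (if a \<le> i then of_nat ((a + 0) choose a) else (0 :: 'p mod_ring))"
    using assms(1) by auto
next
  fix j k
  assume j: "j \<le> i" and k: "k \<le> a" and s: "j + k = a + (CARD('p) - 1)"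
    and nz: "(of_nat ((r - j) choose k) :: 'p mod_ring) \<noteq> 0"
  then have "j = CARD('p) - 1" "k = a" "i = CARD('p) - 1" using ip by linarith+
  moreover from this have "r0 = CARD('p) - 1" using assms(2) p3 by linarith
  ultimately have "(of_nat ((r - j) choose k) :: 'p mod_ring) = of_nat (0 choose k)"
    using ap p3 by (subst binomial_r_minus_low) auto
  then show "(of_nat ((j + 0) choose (a - k)) :: 'p mod_ring) = 0"
    using nz \<open>k = a\<close> a1 by (simp add: binomial_eq_0)
qed

lemma annih_degree_p_minus_2:
  assumes "i = CARD('p) - 2" "a < r0"
  shows "cut_poly r i 0 (binpoly (of_nat (r + (CARD('p) - 1 - r0))) (CARD('p) - 2) :: 'p mod_ring poly)
    \<in> annih r (relations r i)"
proof (rule class_zero)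
  show "CARD('p) - 2 \<le> i" using assms by simp
  show "(of_nat ((r - (CARD('p) - 1) + (CARD('p) - 1 - r0)) choose (CARD('p) - 2)) :: 'p mod_ring) = 0"
    if "i = CARD('p) - 1" using that assms p3 by linarith
next
  fix j k assume j: "j \<le> i" and s: "j + k = a"
  have r0p: "r0 < CARD('p)" by (rule r_digits)
  have k: "k \<le> CARD('p) - 2" "a \<le> i" using s assms r0p by linarith+
  show "(if k \<le> CARD('p) - 2 then of_nat ((j + (CARD('p) - 1 - r0)) choose (CARD('p) - 2 - k)) else 0)
        = (if a \<le> i then of_nat ((a + (CARD('p) - 1 - r0)) choose (CARD('p) - 2)) else (0 :: 'p mod_ring))"
  proof (cases "r0 = a + 1")
    case True
    have "j + (CARD('p) - 1 - r0) = CARD('p) - 2 - k" "a + (CARD('p) - 1 - r0) = CARD('p) - 2"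
      using True s r0p by linarith+
    then show ?thesis using k by simp
  next
    case False
    have "j + (CARD('p) - 1 - r0) < CARD('p) - 2 - k" "a + (CARD('p) - 1 - r0) < CARD('p) - 2"
      using False s r0p assms(2) by linarith+
    then show ?thesis using k by (simp add: binomial_eq_0)
  qed
next
  fix j k
  assume j: "j \<le> i" and k: "k \<le> CARD('p) - 2" and s: "j + k = a + (CARD('p) - 1)"
    and nz: "(of_nat ((r - j) choose k) :: 'p mod_ring) \<noteq> 0"
  have r0p: "r0 < CARD('p)" by (rule r_digits)
  have "r0 < j"
  proof (rule ccontr)
    assume "\<not> r0 < j"
    then have "(of_nat ((r - j) choose k) :: 'p mod_ring) = of_nat ((r0 - j) choose k)"
      using k p3 by (intro binomial_r_minus_low) linarith+
    moreover have "r0 - j < k" using s r0p a1 \<open>\<not> r0 < j\<close> by linarith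
    ultimately show False using nz by (simp add: binomial_eq_0)
  qed
  then have "j + (CARD('p) - 1 - r0) = CARD('p) + (j - 1 - r0)" using r0p by linarith
  moreover have "(of_nat ((CARD('p) + (j - 1 - r0)) choose (CARD('p) - 2 - k)) :: 'p mod_ring) = 0"
  proof (subst binomial_wrap)
    show "j - 1 - r0 < CARD('p)" "CARD('p) - 2 - k < CARD('p)" using j i_less_p p3 by linarith+
    have "j - 1 - r0 < CARD('p) - 2 - k" using s assms j \<open>r0 < j\<close> k by linarith
    then show "(of_nat ((j - 1 - r0) choose (CARD('p) - 2 - k)) :: 'p mod_ring) = 0"
      by (simp add: binomial_eq_0)
  qed
  ultimately show "(of_nat ((j + (CARD('p) - 1 - r0)) choose (CARD('p) - 2 - k)) :: 'p mod_ring) = 0"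
    by simp
qed

end

section \<open>Forms with small last digits\<close>

text \<open>
  By Lucas's theorem \<open>(aX + cY)^(r-n) (bX + dY)^n\<close> is a product of \<open>p\<close>-th powers, which do not affect last
  digits, with a form whose degree is the sum of the last digits of \<open>r - n\<close> and \<open>n\<close>.  If the last digit of \<open>n\<close> is at
  most that of \<open>r\<close>, this degree is the last digit of \<open>r\<close>; hence the space is stable.
\<close>

definition low_digit_forms :: "nat \<Rightarrow> 'p::prime_card mod_ring poly poly set" where
  "low_digit_forms r = {F \<in> forms r. \<forall>m n. coeff (coeff F m) n \<noteq> 0 \<longrightarrow> n mod CARD('p) \<le> r mod CARD('p)}"

lemma coeff2_mult_nonzero:
  fixes F G :: "'a::comm_ring_1 poly poly"
  assumes "coeff (coeff (F * G) m) n \<noteq> 0"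
  shows "\<exists>m' m'' n' n''. n = n' + n'' \<and> coeff (coeff F m') n' \<noteq> 0 \<and> coeff (coeff G m'') n'' \<noteq> 0"
proof -
  have "coeff (coeff (F * G) m) n
    = (\<Sum>k\<le>m. \<Sum>l\<le>n. coeff (coeff F k) l * coeff (coeff G (m - k)) (n - l))"
    by (simp add: coeff_mult coeff_sum)
  with assms obtain k l where "k \<le> m" "l \<le> n" "coeff (coeff F k) l * coeff (coeff G (m - k)) (n - l) \<noteq> 0"
    by (metis (no_types, lifting) atMost_iff sum.neutral)
  then have "n = l + (n - l) \<and> coeff (coeff F k) l \<noteq> 0 \<and> coeff (coeff G (m - k)) (n - l) \<noteq> 0" by auto
  then show ?thesis by blast
qed

lemma stable_subspace_low_digit_forms:
  "stable_subspace r (low_digit_forms r :: 'p::prime_card mod_ring poly poly set)"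
proof -
  let ?p = "CARD('p)"
  define r0 where "r0 = r mod ?p"
  have p0: "?p > 0" using CARD_gt_1[where 'p='p] by simp
  define S :: "'p mod_ring poly poly set" where "S = {F. \<forall>m n. coeff (coeff F m) n \<noteq> 0 \<longrightarrow> ?p dvd n}"
  have Smult: "F * G \<in> S" if "F \<in> S" "G \<in> S" for F G
    unfolding S_def
  proof safe
    fix m n assume "coeff (coeff (F * G) m) n \<noteq> 0"
    then obtain m' m'' n' n'' where "n = n' + n''" "coeff (coeff F m') n' \<noteq> 0" "coeff (coeff G m'') n'' \<noteq> 0"
      using coeff2_mult_nonzero by blast
    then show "?p dvd n" using that by (auto simp: S_def)
  qed
  have S1: "1 \<in> S"
  proof -
    have "(1 :: 'p mod_ring poly poly) = bmono 0 0" by (simp add: bmono_def)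
    then show ?thesis by (auto simp: S_def coeff_bmono split: if_splits)
  qed
  have Spow: "F ^ k \<in> S" if "F \<in> S" for F k
    by (induction k) (use S1 Smult that in auto)
  have Slin: "(const2 a * varX + const2 c * varY) ^ ?p \<in> S" for a c :: "'p mod_ring"
  proof -
    have "(const2 a * varX + const2 c * varY) ^ ?p = (const2 a * varX) ^ ?p + (const2 c * varY) ^ ?p"
      by (rule freshmans_dream) (simp_all add: prime_card)
    also have "\<dots> = const2 (a ^ ?p) * bmono ?p 0 + const2 (c ^ ?p) * bmono 0 ?p"
      by (simp add: power_mult_distrib bmono_def const2_power)
    finally show ?thesis by (auto simp: S_def coeff_const2_mult coeff_bmono split: if_splits)
  qed
  have low: "gact A (bmono (r - n) n) \<in> low_digit_forms r" if n: "n \<le> r" "n mod ?p \<le> r0"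
    for A :: "'p mod_ring ^ 2 ^ 2" and n
  proof -
    define M N where "M = const2 (A $ 1 $ 1) * varX + const2 (A $ 2 $ 1) * varY"
      and "N = const2 (A $ 1 $ 2) * varX + const2 (A $ 2 $ 2) * varY"
    define s t where "s = r div ?p - n div ?p" and "t = n div ?p"
    have nt: "n = n mod ?p + ?p * t" by (simp add: t_def)
    have rs: "r - n = (r0 - n mod ?p) + ?p * s"
    proof -
      have "r = r0 + ?p * (r div ?p)" by (simp add: r0_def)
      moreover have "?p * s = ?p * (r div ?p) - ?p * t" by (simp add: s_def t_def diff_mult_distrib2)
      moreover have "?p * t \<le> ?p * (r div ?p)" using n(1) by (simp add: t_def div_le_mono)
      ultimately show ?thesis using nt n(2) by linarith
    qed
    define F E where "F = M ^ (r0 - n mod ?p) * N ^ (n mod ?p)" and "E = (M ^ ?p) ^ s * (N ^ ?p) ^ t"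
    have "gact A (bmono (r - n) n) = M ^ (r - n) * N ^ n" by (simp add: gact_bmono M_def N_def)
    also have "\<dots> = M ^ ((r0 - n mod ?p) + ?p * s) * N ^ (n mod ?p + ?p * t)"
      using rs nt by (metis)
    also have "\<dots> = F * E" unfolding F_def E_def power_add power_mult by (simp only: mult_ac)
    finally have FE: "gact A (bmono (r - n) n) = F * E" .
    have "F \<in> forms (1 * (r0 - n mod ?p) + 1 * (n mod ?p))"
      unfolding F_def M_def N_def by (intro forms_mult forms_power forms_linear)
    then have F: "F \<in> forms r0" using n(2) by simp
    have E: "E \<in> S" unfolding E_def M_def N_def by (intro Smult Spow Slin)
    have "k mod ?p \<le> r mod ?p" if nz: "coeff (coeff (F * E) m) k \<noteq> 0" for m k
    proof -
      obtain m' m'' k' k'' where k: "k = k' + k''" "coeff (coeff F m') k' \<noteq> 0" "coeff (coeff E m'') k'' \<noteq> 0"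
        using coeff2_mult_nonzero[OF nz] by blast
      have "k' \<le> r0" using F k(2) unfolding forms_def by (metis (mono_tags, lifting) le_add2 mem_Collect_eq)
      moreover have "?p dvd k''" using E k(3) by (auto simp: S_def)
      moreover have "r0 < ?p" using p0 by (simp add: r0_def)
      ultimately have "k mod ?p = k'" unfolding k(1) by (auto elim!: dvdE)
      with \<open>k' \<le> r0\<close> show ?thesis by (simp add: r0_def)
    qed
    moreover have "gact A (bmono (r - n) n) \<in> forms r" using n(1) by (intro gact_forms forms_bmono) simp
    ultimately show ?thesis by (simp add: low_digit_forms_def FE)
  qed
  have add: "F + G \<in> low_digit_forms r" if FG: "F \<in> low_digit_forms r" "G \<in> low_digit_forms r"
    for F G :: "'p mod_ring poly poly"
  proof -
    have "coeff (coeff F m) n \<noteq> 0 \<or> coeff (coeff G m) n \<noteq> 0" if "coeff (coeff (F + G) m) n \<noteq> 0" for m n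
      using that by auto
    then show ?thesis using FG unfolding low_digit_forms_def by (fastforce intro: forms_add)
  qed
  have scale: "const2 c * F \<in> low_digit_forms r" if "F \<in> low_digit_forms r" for c and F :: "'p mod_ring poly poly"
    using that by (auto simp: low_digit_forms_def forms_const2_mult coeff_const2_mult)
  have zero: "0 \<in> (low_digit_forms r :: 'p mod_ring poly poly set)"
    by (simp add: low_digit_forms_def forms_0)
  have sum: "sum f T \<in> low_digit_forms r" if "\<And>x. x \<in> T \<Longrightarrow> f x \<in> low_digit_forms r"
    for f :: "nat \<Rightarrow> 'p mod_ring poly poly" and T
    using that by (induction T rule: infinite_finite_induct) (auto intro: zero add)
  have act: "gact A F \<in> low_digit_forms r" if F: "F \<in> low_digit_forms r"
    for A :: "'p mod_ring ^ 2 ^ 2" and F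
  proof -
    have Ff: "F \<in> forms r" using F by (simp add: low_digit_forms_def)
    have "gact A F = (\<Sum>n\<le>r. const2 (coeff (coeff F (r - n)) n) * gact A (bmono (r - n) n))"
      by (subst form_expand[OF Ff]) (simp add: gact_sum gact_const2_mult)
    also have "\<dots> \<in> low_digit_forms r"
    proof (rule sum)
      fix n assume n: "n \<in> {..r}"
      show "const2 (coeff (coeff F (r - n)) n) * gact A (bmono (r - n) n) \<in> low_digit_forms r"
      proof (cases "coeff (coeff F (r - n)) n = 0")
        case True
        then show ?thesis using zero by (simp add: const2_0)
      next
        case False
        then have "n mod ?p \<le> r0" using F by (auto simp: low_digit_forms_def r0_def)
        then show ?thesis using n by (intro scale low) auto
      qed
    qed
    finally show ?thesis .
  qed
  have "low_digit_forms r \<subseteq> (forms r :: 'p mod_ring poly poly set)" by (auto simp: low_digit_forms_def)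
  then show ?thesis
    using zero add scale act unfolding stable_subspace_def by blast
qed

lemma annih_low_digit_forms_iff:
  fixes f :: "nat \<Rightarrow> 'p::prime_card mod_ring"
  shows "f \<in> annih r (low_digit_forms r) \<longleftrightarrow> (\<forall>n\<le>r. n mod CARD('p) \<le> r mod CARD('p) \<longrightarrow> f n = 0)"
proof (intro iffI allI impI)
  fix n assume f: "f \<in> annih r (low_digit_forms r)" and n: "n \<le> r" "n mod CARD('p) \<le> r mod CARD('p)"
  have "bmono (r - n) n \<in> (low_digit_forms r :: 'p mod_ring poly poly set)"
    using n by (auto simp: low_digit_forms_def forms_bmono coeff_bmono)
  then have "pairing r f (bmono (r - n) n) = 0" using f by (simp add: annih_def)
  then show "f n = 0" using n by (simp add: pairing_bmono)
next
  assume h: "\<forall>n\<le>r. n mod CARD('p) \<le> r mod CARD('p) \<longrightarrow> f n = 0"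
  show "f \<in> annih r (low_digit_forms r)"
    unfolding annih_def pairing_def
  proof (safe, intro sum.neutral ballI)
    fix F :: "'p mod_ring poly poly" and n assume F: "F \<in> low_digit_forms r" and n: "n \<in> {..r}"
    show "f n * coeff (coeff F (r - n)) n = 0"
    proof (cases "coeff (coeff F (r - n)) n = 0")
      case False
      then have "n mod CARD('p) \<le> r mod CARD('p)" using F unfolding low_digit_forms_def by blast
      then show ?thesis using h n by simp
    qed simp
  qed
qed

section \<open>Rows in terms of last digits\<close>

text \<open>
  The indicator function of the residue of \<open>c\<close>, since \<open>(m choose p-1)\<close> is nonzero modulo \<open>p\<close>, and then equal to
  \<open>1\<close>, exactly when \<open>m\<close> has last digit \<open>p - 1\<close>.
\<close>

definition delta_poly :: "nat \<Rightarrow> 'p::prime_card mod_ring poly" where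
  "delta_poly c = binpoly (of_nat c - 1) (CARD('p) - 1)"

lemma degree_delta_poly: "degree (delta_poly c :: 'p::prime_card mod_ring poly) = CARD('p) - 1"
  unfolding delta_poly_def using CARD_gt_1[where 'p='p] by (intro degree_binpoly) simp

lemma poly_delta_poly:
  "poly (delta_poly c) (of_nat n) = (if n mod CARD('p) = c mod CARD('p) then 1 else (0 :: 'p::prime_card mod_ring))"
proof -
  let ?p = "CARD('p)"
  have p1: "?p > 1" by (rule CARD_gt_1)
  obtain m where m: "m < ?p" "of_nat c - 1 - of_nat n = (of_nat m :: 'p mod_ring)"
    using surj_of_nat_mod_ring[where 'a='p, of "of_nat c - 1 - of_nat n"] by blast
  have "poly (delta_poly c) (of_nat n) = (of_nat (m choose (?p - 1)) :: 'p mod_ring)"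
    unfolding delta_poly_def using p1 m(2) by (intro poly_binpoly) simp_all
  also have "\<dots> = (if m = ?p - 1 then 1 else 0)"
    using m(1) by (auto simp: binomial_eq_0)
  also have "m = ?p - 1 \<longleftrightarrow> n mod ?p = c mod ?p"
  proof -
    have "m = ?p - 1 \<longleftrightarrow> (of_nat m :: 'p mod_ring) = of_nat (?p - 1)"
      using m(1) p1 by (simp only: of_nat_mod_ring_eq_iff) simp
    also have "\<dots> \<longleftrightarrow> (of_nat n :: 'p mod_ring) = of_nat c"
      using p1 by (simp add: m(2)[symmetric] of_nat_diff) (metis add_diff_cancel_left' add_uminus_conv_diff diff_add_cancel diff_right_commute)
    finally show ?thesis by (simp only: of_nat_mod_ring_eq_iff)
  qed
  finally show ?thesis .
qed

context quotient_parameters begin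

lemma rq_ge_2: "2 \<le> rq" using rq_ge i1 by linarith

text \<open>
  The numbers \<open>n\<close> of a row are grouped by their last digit \<open>c\<close>.  On such a group \<open>P\<close> is constant, and by Lucas's
  theorem the remaining factor is this sum over the higher part \<open>n'\<close> of \<open>n = c + p n'\<close>.
\<close>

definition digit_sum :: "nat \<Rightarrow> nat \<Rightarrow> nat \<Rightarrow> 'p mod_ring" where
  "digit_sum j w c = (\<Sum>n'\<le>(r - j) div CARD('p). of_nat (((r - j) div CARD('p)) choose n') *
     (if i < c + CARD('p) * n' \<and> c + CARD('p) * n' + i < r \<and> [c + CARD('p) * n' = w] (mod (CARD('p) - 1)) then 1 else 0))"

lemma row_digits:
  fixes P :: "'p mod_ring poly"
  shows "(\<Sum>n\<le>r - j. of_nat ((r - j) choose n) * cut_poly r i w P n)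
    = (\<Sum>c<CARD('p). of_nat (((r - j) mod CARD('p)) choose c) * (poly P (of_nat c) * digit_sum j w c))"
  unfolding lucas_sum[where N = "r - j"] digit_sum_def sum_distrib_left
  by (intro sum.cong refl) (simp add: cut_poly_def)

text \<open>
  As \<open>p\<close> is congruent to \<open>1\<close> modulo \<open>p - 1\<close>, the class of \<open>c + p n'\<close> is that of \<open>c + n'\<close>, and the sum
  is a class sum except for the end terms.  Only \<open>n' = 0\<close> and the largest \<open>n'\<close> can lie at an end.
\<close>

lemma digit_sum_eval:
  assumes j: "j \<le> i" and c: "c \<le> (r - j) mod CARD('p)" and v: "[c + v = w] (mod (CARD('p) - 1))"
  shows "digit_sum j w c = bsum ((r - j) div CARD('p)) v
    - (if [v = 0] (mod (CARD('p) - 1)) \<and> c \<le> i then 1 else 0)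
    - (if [(r - j) div CARD('p) = v] (mod (CARD('p) - 1)) \<and> r \<le> c + CARD('p) * ((r - j) div CARD('p)) + i then 1 else 0)"
proof -
  let ?p = "CARD('p)" and ?q = "CARD('p) - 1"
  define N where "N = (r - j) div ?p"
  have N1: "1 \<le> N"
    using r_minus_low(2)[of j] r_minus_high(2)[of j] rq_ge_2 j i_less_p unfolding N_def
    by (cases "j \<le> r0") auto
  have pN: "c + ?p * N \<le> r"
  proof -
    have "r - j = (r - j) mod ?p + ?p * N" by (simp add: N_def)
    then show ?thesis using c by linarith
  qed
  have cp: "c < ?p" using c p3 by (meson le_less_trans mod_less_divisor less_le_trans zero_less_numeral)
  have cl: "[c + ?p * n' = w] (mod ?q) \<longleftrightarrow> [n' = v] (mod ?q)" for n'
  proof -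
    have "?p * n' = n' + ?q * n'" using p3 by (cases ?p) auto
    then have "[c + ?p * n' = c + n'] (mod ?q)" by (simp add: cong_def flip: add.assoc)
    then have "[c + ?p * n' = w] (mod ?q) \<longleftrightarrow> [c + n' = c + v] (mod ?q)"
      using v by (meson cong_sym cong_trans)
    then show ?thesis by (simp add: cong_add_lcancel_nat)
  qed
  define E where "E n' = (of_nat (N choose n') :: 'p mod_ring)" for n'
  have mid: "c + ?p * n' + i < r" if "n' < N" for n'
  proof -
    have "?p * Suc n' \<le> ?p * N" using that by (intro mult_le_mono2) simp
    then have "c + ?p * n' + ?p \<le> r" using pN by simp
    then show ?thesis using i_less_p by linarith
  qed
  have low: "i < c + ?p * n'" if "0 < n'" for n'
  proof -
    have "?p * 1 \<le> ?p * n'" using that by (intro mult_le_mono2) simp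
    then show ?thesis using i_less_p by linarith
  qed
  have t: "E n' * (if i < c + ?p * n' \<and> c + ?p * n' + i < r \<and> [c + ?p * n' = w] (mod ?q) then 1 else 0)
    = (if [n' = v] (mod ?q) then E n' else 0)
      - (if n' = 0 then (if [v = 0] (mod ?q) \<and> c \<le> i then 1 else 0) else 0)
      - (if n' = N then (if [N = v] (mod ?q) \<and> r \<le> c + ?p * N + i then 1 else 0) else 0)"
    if n'N: "n' \<le> N" for n'
  proof -
    consider "n' = 0" | "n' = N" "0 < n'" | "0 < n'" "n' < N" using n'N by linarith
    then show ?thesis
    proof cases
      case 1
      then have "0 < N" using N1 by simp
      then show ?thesis unfolding cl using 1 mid[of 0] by (auto simp: E_def cong_sym_eq[of 0 v])
    next
      case 2
      then show ?thesis unfolding cl using low[of N] by (auto simp: E_def)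
    next
      case 3
      then show ?thesis unfolding cl using low mid by auto
    qed
  qed
  have "digit_sum j w c = (\<Sum>n'\<le>N. (if [n' = v] (mod ?q) then E n' else 0)
      - (if n' = 0 then (if [v = 0] (mod ?q) \<and> c \<le> i then 1 else 0) else 0)
      - (if n' = N then (if [N = v] (mod ?q) \<and> r \<le> c + ?p * N + i then 1 else 0) else 0))"
    unfolding digit_sum_def N_def[symmetric] using t by (intro sum.cong refl) (simp add: E_def)
  also have "\<dots> = bsum N v - (if [v = 0] (mod ?q) \<and> c \<le> i then 1 else 0)
      - (if [N = v] (mod ?q) \<and> r \<le> c + ?p * N + i then 1 else 0)"
    unfolding sum_subtractf bsum_def E_def by simp
  finally show ?thesis unfolding N_def .
qed

lemma bsum_value:
  assumes "1 \<le> N" "1 \<le> M" "M < CARD('p)" "[N = M] (mod (CARD('p) - 1))" "0 < v" "v < CARD('p) - 1"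
  shows "bsum N v = (of_nat (M choose v) :: 'p mod_ring)"
  using bsum_cong[OF assms(1,2,4)] bsum_small[OF assms(3,5,6)] by simp

lemma bsum_zero_value:
  assumes "1 \<le> N"
  shows "bsum N 0 = (1 + (if [N = 0] (mod (CARD('p) - 1)) then 1 else 0) :: 'p mod_ring)"
proof -
  let ?q = "CARD('p) - 1"
  define M where "M = (N - 1) mod ?q + 1"
  have "(N - 1) mod ?q < ?q" using p3 by (intro mod_less_divisor) simp
  then have M: "1 \<le> M" "M < CARD('p)" unfolding M_def by linarith+
  have NM: "[N = M] (mod ?q)"
  proof -
    have "[(N - 1) + 1 = (N - 1) mod ?q + 1] (mod ?q)" by (intro cong_add cong_refl) (simp add: cong_def)
    then show ?thesis using assms by (simp add: M_def)
  qed
  have "bsum N 0 = (bsum M 0 :: 'p mod_ring)" by (rule bsum_cong[OF assms M(1) NM])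
  also have "\<dots> = 1 + (if M = ?q then 1 else 0)" using M p3 by (intro bsum_0) auto
  also have "M = ?q \<longleftrightarrow> [N = 0] (mod ?q)"
  proof -
    have "M = ?q \<longleftrightarrow> [M = 0] (mod ?q)"
      using M by (auto simp: cong_0_iff dest: dvd_imp_le)
    then show ?thesis using NM by (simp add: cong_def)
  qed
  finally show ?thesis .
qed

lemma bsum_row_value:
  assumes "j + k < r" "1 \<le> M" "M < CARD('p)" "[M + j + k = a] (mod (CARD('p) - 1))"
    "0 < w" "w < CARD('p) - 1"
  shows "bsum (r - j - k) w = (of_nat (M choose w) :: 'p mod_ring)"
proof (rule bsum_value[OF _ assms(2,3) _ assms(5,6)])
  have "[(r - j - k) + (j + k) = M + (j + k)] (mod (CARD('p) - 1))"
  proof -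
    have "(r - j - k) + (j + k) = r" using assms(1) by linarith
    moreover have "[r = M + (j + k)] (mod (CARD('p) - 1))"
      using r_cong assms(4) by (metis add.assoc cong_sym cong_trans)
    ultimately show ?thesis by simp
  qed
  then show "[r - j - k = M] (mod (CARD('p) - 1))" by (simp only: cong_add_rcancel_nat)
qed (use assms in linarith)

lemma upper_edge_cong:
  assumes "j + k \<le> r"
  shows "[r - j - k = w] (mod (CARD('p) - 1)) \<longleftrightarrow> [w + j + k = a] (mod (CARD('p) - 1))"
proof -
  have "[r - j - k = w] (mod (CARD('p) - 1)) \<longleftrightarrow> [(r - j - k) + (j + k) = w + (j + k)] (mod (CARD('p) - 1))"
    by (simp only: cong_add_rcancel_nat)
  also have "(r - j - k) + (j + k) = r" using assms by linarith
  also have "[r = w + (j + k)] (mod (CARD('p) - 1)) \<longleftrightarrow> [w + j + k = a] (mod (CARD('p) - 1))"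
    using r_cong by (metis add.assoc cong_sym cong_trans)
  finally show ?thesis .
qed

lemma cong_small_iff:
  "s < CARD('p) - 1 \<Longrightarrow> t < CARD('p) - 1 \<Longrightarrow> [s = t] (mod (CARD('p) - 1)) \<longleftrightarrow> s = t"
  by (simp add: cong_def)

lemma cong_add_period: "s = t + (CARD('p) - 1) \<Longrightarrow> [s = t] (mod (CARD('p) - 1))"
  by (simp only: cong_def mod_add_self2)

lemma annih_of_rows_zero:
  fixes P :: "'p mod_ring poly"
  assumes "degree P \<le> i"
    and "\<And>j c. j \<le> i \<Longrightarrow> c \<le> (r - j) mod CARD('p) \<Longrightarrow> poly P (of_nat c) \<noteq> 0 \<Longrightarrow> digit_sum j w c = 0"
  shows "cut_poly r i w P \<in> annih r (relations r i)"
proof (rule cut_poly_annih_relations[OF i_less_p i_le_r assms(1)])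
  fix j assume j: "j \<le> i"
  have "of_nat (((r - j) mod CARD('p)) choose c) * (poly P (of_nat c) * digit_sum j w c) = 0" for c
    using assms(2)[OF j, of c] by (cases "c \<le> (r - j) mod CARD('p)") (auto simp: binomial_eq_0)
  then show "(\<Sum>n\<le>r - j. of_nat ((r - j) choose n) * cut_poly r i w P n) = 0"
    unfolding row_digits by (intro sum.neutral ballI)
qed

lemma row_quotient:
  assumes "j \<le> i"
  shows "(r - j) div CARD('p) = (if j \<le> r0 then rq else rq - 1)"
    "(r - j) mod CARD('p) = (if j \<le> r0 then r0 - j else CARD('p) + r0 - j)"
    "1 \<le> (r - j) div CARD('p)"
    "c + CARD('p) * ((r - j) div CARD('p)) + i \<ge> r \<longleftrightarrow> c + i \<ge> (if j \<le> r0 then r0 else CARD('p) + r0)"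
proof -
  have jp: "j < CARD('p)" using assms i_less_p by simp
  show d: "(r - j) div CARD('p) = (if j \<le> r0 then rq else rq - 1)"
    "(r - j) mod CARD('p) = (if j \<le> r0 then r0 - j else CARD('p) + r0 - j)"
    using r_minus_low[of j] r_minus_high[of j] jp by auto
  show "1 \<le> (r - j) div CARD('p)" using d rq_ge_2 by auto
  have e: "CARD('p) * (rq - 1) + CARD('p) = CARD('p) * rq" using rq_ge_2 by (cases rq) auto
  show "c + CARD('p) * ((r - j) div CARD('p)) + i \<ge> r \<longleftrightarrow> c + i \<ge> (if j \<le> r0 then r0 else CARD('p) + r0)"
  proof (cases "j \<le> r0")
    case True
    show ?thesis unfolding d(1) if_P[OF True] using r_digits(1) by (intro iffI; linarith)
  next
    case False
    show ?thesis unfolding d(1) if_not_P[OF False] using r_digits(1) e by (intro iffI; linarith)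
  qed
qed

text \<open>
  The class sum \<open>bsum _ 0\<close> is \<open>1\<close> or \<open>2\<close>, one for each end term that is then removed.
\<close>

lemma digit_sum_same_class:
  assumes j: "j \<le> i" and c: "c \<le> (r - j) mod CARD('p)" "c \<le> i" and w: "[c = w] (mod (CARD('p) - 1))"
    and edge: "[(r - j) div CARD('p) = 0] (mod (CARD('p) - 1)) \<Longrightarrow> r \<le> c + CARD('p) * ((r - j) div CARD('p)) + i"
  shows "digit_sum j w c = 0"
proof -
  have v: "[c + 0 = w] (mod (CARD('p) - 1))" using w by simp
  show ?thesis
    unfolding digit_sum_eval[OF j c(1) v] bsum_zero_value[OF row_quotient(3)[OF j]]
    using c(2) edge by auto
qed

text \<open>
  For \<open>i = p - 1\<close> each row of the indicator of \<open>c\<close> in the class of \<open>c\<close> reduces to a single \<open>digit_sum\<close>.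
\<close>

lemma annih_delta:
  assumes i: "i = CARD('p) - 1" and c: "c < CARD('p)" and rc: "r0 < c \<or> r0 + 1 \<noteq> a"
  shows "cut_poly r i c (delta_poly c :: 'p mod_ring poly) \<in> annih r (relations r i)"
proof (rule annih_of_rows_zero)
  show "degree (delta_poly c :: 'p mod_ring poly) \<le> i" using i by (simp add: degree_delta_poly)
  fix j c' assume j: "j \<le> i" and c': "c' \<le> (r - j) mod CARD('p)"
    and nz: "poly (delta_poly c :: 'p mod_ring poly) (of_nat c') \<noteq> 0"
  have "(r - j) mod CARD('p) < CARD('p)" using p3 by (intro mod_less_divisor) simp
  then have "c' < CARD('p)" using c' by linarith
  then have "c' = c" using nz c by (auto simp: poly_delta_poly split: if_splits)
  moreover have "digit_sum j c c = 0"
  proof (rule digit_sum_same_class[OF j])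
    show "c \<le> (r - j) mod CARD('p)" using c' \<open>c' = c\<close> by simp
    show "c \<le> i" using c i by simp
    assume e: "[(r - j) div CARD('p) = 0] (mod (CARD('p) - 1))"
    have cr: "c \<le> (if j \<le> r0 then r0 - j else CARD('p) + r0 - j)"
      using c' \<open>c' = c\<close> row_quotient(2)[OF j] by simp
    have rp: "r0 < CARD('p)" by (rule r_digits)
    show "r \<le> c + CARD('p) * ((r - j) div CARD('p)) + i"
    proof (cases "j \<le> r0")
      case True
      then show ?thesis unfolding row_quotient(4)[OF j] using i rp by simp
    next
      case False
      have "r0 < c"
      proof (rule ccontr)
        assume "\<not> r0 < c"
        then have ra: "r0 + 1 \<noteq> a" using rc by simp
        have "[rq - 1 = 0] (mod (CARD('p) - 1))" using e row_quotient(1)[OF j] False by simp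
        then have "[rq - 1 + (r0 + 1) = 0 + (r0 + 1)] (mod (CARD('p) - 1))" by (intro cong_add cong_refl)
        moreover have "rq - 1 + (r0 + 1) = rq + r0" using rq_ge_2 by linarith
        ultimately have "[r0 + 1 = a] (mod (CARD('p) - 1))"
          using rq_cong by (metis add_0 cong_sym cong_trans)
        moreover have "r0 < j" "j \<le> CARD('p) - 1" using False j ip by auto
        then have "r0 + 1 \<le> CARD('p) - 1" by linarith
        ultimately have "r0 + 1 = a"
          using a1 ap by (cases "r0 + 1 = CARD('p) - 1"; cases "a = CARD('p) - 1") (auto simp: cong_def)
        with ra show False by simp
      qed
      then show ?thesis unfolding row_quotient(4)[OF j] using i False c by simp
    qed
  qed simp
  ultimately show "digit_sum j c c' = 0" by simp
qed

lemma annih_r0_zero: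
  assumes "r0 = 0" "a = i + 1"
  shows "cut_poly r i 1 (binpoly (of_nat r) i :: 'p mod_ring poly) \<in> annih r (relations r i)"
proof (rule annih_of_rows_zero)
  show "degree (binpoly (of_nat r) i :: 'p mod_ring poly) \<le> i" by (simp add: degree_binpoly i_less_p)
  fix j c
  assume j: "j \<le> i" and c: "c \<le> (r - j) mod CARD('p)"
    and nz: "poly (binpoly (of_nat r) i :: 'p mod_ring poly) (of_nat c) \<noteq> 0"
  have cp: "c < CARD('p)"
  proof -
    have "(r - j) mod CARD('p) < CARD('p)" using p3 by (intro mod_less_divisor) simp
    then show ?thesis using c by linarith
  qed
  have r0': "(of_nat r :: 'p mod_ring) = 0" using assms(1) r0 by (simp add: of_nat_mod_ring_eq_0_iff dvd_eq_mod_eq_0)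
  have Pc: "poly (binpoly (of_nat r) i :: 'p mod_ring poly) (of_nat c) = of_nat ((CARD('p) - c) choose i)"
    using cp by (intro poly_binpoly[OF i_less_p]) (simp add: r0' of_nat_diff)
  have i2: "i \<le> CARD('p) - 2" using assms(2) ap by linarith
  have c0: "c \<noteq> 0"
  proof
    assume "c = 0"
    then have "poly (binpoly (of_nat r) i :: 'p mod_ring poly) (of_nat c) = of_nat (0 choose i)"
      by (intro poly_binpoly[OF i_less_p]) (simp add: r0')
    then show False using nz i1 by (simp add: binomial_eq_0)
  qed
  then have "j \<noteq> 0" using c row_quotient(2)[OF j] assms(1) by (auto split: if_splits)
  then have jr: "\<not> j \<le> r0" using assms(1) by simp
  have ci: "c + i \<le> CARD('p)"
  proof (rule ccontr)
    assume "\<not> c + i \<le> CARD('p)"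
    then have "CARD('p) - c < i" using cp by linarith
    then show False using nz unfolding Pc by (simp add: binomial_eq_0)
  qed
  define N where "N = (r - j) div CARD('p)"
  have N: "1 \<le> N" "N = rq - 1" unfolding N_def using row_quotient[OF j] jr by auto
  have Ni: "[N = i] (mod (CARD('p) - 1))"
  proof -
    have "[rq - 1 + 1 = i + 1] (mod (CARD('p) - 1))" using rq_cong assms rq_ge_2 by simp
    then show ?thesis unfolding N(2) by (simp only: cong_add_rcancel_nat)
  qed
  show "digit_sum j 1 c = 0"
  proof (cases "c = 1")
    case True
    have "\<not> [N = 0] (mod (CARD('p) - 1))"
      using Ni i1 i2 p3 by (auto simp: cong_def)
    then show ?thesis
      unfolding N_def by (intro digit_sum_same_class[OF j c]) (use True i1 in auto)
  next
    case False
    then have c2: "2 \<le> c" using c0 by simp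
    define v where "v = CARD('p) - c"
    have v: "0 < v" "v < CARD('p) - 1" "v \<ge> i" using c2 cp ci by (auto simp: v_def)
    have "c + v = 1 + (CARD('p) - 1)" using cp p3 by (simp add: v_def)
    then have vc: "[c + v = 1] (mod (CARD('p) - 1))" by (rule cong_add_period)
    have b: "bsum N v = (of_nat (i choose v) :: 'p mod_ring)"
      by (rule bsum_value[OF N(1) i1 i_less_p Ni v(1,2)])
    have v0: "\<not> [v = 0] (mod (CARD('p) - 1))" using v by (simp add: cong_def)
    have Nv: "[N = v] (mod (CARD('p) - 1)) \<longleftrightarrow> v = i"
    proof -
      have "[N = v] (mod (CARD('p) - 1)) \<longleftrightarrow> [i = v] (mod (CARD('p) - 1))"
        using Ni by (meson cong_sym cong_trans)
      also have "\<dots> \<longleftrightarrow> i = v" using v i2 p3 by (intro cong_small_iff) auto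
      finally show ?thesis by auto
    qed
    have edge: "r \<le> c + CARD('p) * N + i \<longleftrightarrow> c + i \<ge> CARD('p)"
      unfolding N_def row_quotient(4)[OF j] using jr assms(1) by simp
    have "c + i \<ge> CARD('p)" if "v = i" using that by (simp add: v_def)
    then show ?thesis
      unfolding digit_sum_eval[OF j c vc] N_def[symmetric] b using v0 Nv edge v(3)
      by (cases "v = i") (auto simp: binomial_eq_0)
  qed
qed

text \<open>
  Here \<open>i = p - 2\<close> and the polynomial has degree \<open>p - 2\<close>: it is supported on two last digits.
\<close>

lemma annih_two_points:
  assumes "i = CARD('p) - 2" "r0 = a" "a < i"
  shows "cut_poly r i (a + 1) (binpoly (of_nat r) i :: 'p mod_ring poly) \<in> annih r (relations r i)"
proof (rule annih_of_rows_zero)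
  show "degree (binpoly (of_nat r) i :: 'p mod_ring poly) \<le> i" by (simp add: degree_binpoly i_less_p)
  fix j c
  assume j: "j \<le> i" and c: "c \<le> (r - j) mod CARD('p)"
    and nz: "poly (binpoly (of_nat r) i :: 'p mod_ring poly) (of_nat c) \<noteq> 0"
  have cp: "c < CARD('p)"
  proof -
    have "(r - j) mod CARD('p) < CARD('p)" using p3 by (intro mod_less_divisor) simp
    then show ?thesis using c by linarith
  qed
  have ra: "(of_nat r :: 'p mod_ring) = of_nat a"
    using assms(2) r0 r_digits(2) by (simp add: of_nat_mod_ring_eq_iff)
  have Pc: "poly (binpoly (of_nat r) i :: 'p mod_ring poly) (of_nat c) = of_nat (m choose i)"
    if "m + c = a \<or> m + c = a + CARD('p)" for m
  proof (rule poly_binpoly[OF i_less_p])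
    have "(m + c) mod CARD('p) = a mod CARD('p)" using that by auto
    then have "(of_nat (m + c) :: 'p mod_ring) = of_nat a" by (simp only: of_nat_mod_ring_eq_iff)
    then show "(of_nat m :: 'p mod_ring) = of_nat r - of_nat c" unfolding ra by (simp add: algebra_simps)
  qed
  have ac: "c = a + 1 \<or> c = a + 2"
  proof (rule ccontr)
    assume ne: "\<not> (c = a + 1 \<or> c = a + 2)"
    show False
    proof (cases "c \<le> a")
      case True
      then have "poly (binpoly (of_nat r) i :: 'p mod_ring poly) (of_nat c) = of_nat ((a - c) choose i)"
        by (intro Pc) simp
      then show False using nz assms(3) by (simp add: binomial_eq_0)
    next
      case False
      then have "poly (binpoly (of_nat r) i :: 'p mod_ring poly) (of_nat c) = of_nat ((a + CARD('p) - c) choose i)"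
        using cp by (intro Pc) simp
      moreover have "a + CARD('p) - c < i" using False ne assms cp by linarith
      ultimately show False using nz by (simp add: binomial_eq_0)
    qed
  qed
  then have jr: "\<not> j \<le> r0" using c row_quotient(2)[OF j] assms(2) by (auto split: if_splits)
  define N where "N = (r - j) div CARD('p)"
  have N: "1 \<le> N" "N = rq - 1" unfolding N_def using row_quotient[OF j] jr by auto
  have Ni: "[N = i] (mod (CARD('p) - 1))"
  proof -
    have "[rq + r0 = 0 + r0] (mod (CARD('p) - 1))" using rq_cong assms(2) by simp
    then have "[rq = 0] (mod (CARD('p) - 1))" by (simp only: cong_add_rcancel_nat)
    moreover have "rq = N + 1" using N rq_ge_2 by simp
    moreover have "[i + 1 = 0] (mod (CARD('p) - 1))" using assms(1) p3 by (simp add: cong_def Suc_diff_Suc numeral_2_eq_2)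
    ultimately have "[N + 1 = i + 1] (mod (CARD('p) - 1))" by (metis cong_sym cong_trans)
    then show ?thesis by (simp only: cong_add_rcancel_nat)
  qed
  have ip1: "i < CARD('p) - 1" "0 < i" using assms(1) p3 i1 by auto
  show "digit_sum j (a + 1) c = 0"
  proof (cases "c = a + 1")
    case True
    have "\<not> [N = 0] (mod (CARD('p) - 1))"
      using Ni ip1 by (simp add: cong_def)
    then show ?thesis
      unfolding N_def by (intro digit_sum_same_class[OF j c]) (use True assms(3) in auto)
  next
    case False
    then have c2: "c = a + 2" using ac by simp
    have "c + i = (a + 1) + (CARD('p) - 1)" using c2 assms(1) p3 by linarith
    then have vc: "[c + i = a + 1] (mod (CARD('p) - 1))" by (rule cong_add_period)
    have b: "bsum N i = (of_nat (i choose i) :: 'p mod_ring)"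
      by (rule bsum_value[OF N(1) i1 i_less_p Ni ip1(2,1)])
    have v0: "\<not> [i = 0] (mod (CARD('p) - 1))" using ip1 by (simp add: cong_def)
    have edge: "r \<le> c + CARD('p) * N + i"
      unfolding N_def row_quotient(4)[OF j] using jr assms c2 p3 by simp
    show ?thesis
      unfolding digit_sum_eval[OF j c vc] N_def[symmetric] b using v0 Ni edge by simp
  qed
qed

text \<open>
  Degree \<open>a + 1\<close> becomes possible in the class of \<open>-1\<close>.  Together with degree \<open>a\<close> in the class of \<open>0\<close>
  it shows that the degree filtration is not trivial on the annihilator.
\<close>

lemma annih_degree_a_plus_1:
  assumes "a < i" "i + 3 \<le> CARD('p)"
  shows "cut_poly r i (CARD('p) - 2) (binpoly (of_nat (r + 0)) (a + 1) :: 'p mod_ring poly) \<in> annih r (relations r i)"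
proof (rule cut_poly_annih_relations[OF i_less_p i_le_r])
  have ep: "a + 1 < CARD('p)" using assms by linarith
  show "degree (binpoly (of_nat (r + 0)) (a + 1) :: 'p mod_ring poly) \<le> i"
    unfolding degree_binpoly[OF ep] using assms by linarith
  fix j assume j: "j \<le> i"
  define C where "C k = (of_nat ((r - j) choose k) :: 'p mod_ring)" for k
  have w: "0 < CARD('p) - 2" "CARD('p) - 2 < CARD('p) - 1" using p3 by linarith+
  have main: "(\<Sum>k\<le>a + 1. of_nat ((j + 0) choose (a + 1 - k)) * C k * (bsum (r - j - k) (CARD('p) - 2) :: 'p mod_ring))
    = (\<Sum>k\<le>a + 1. if k + j = a + 1 then C k else 0)"
  proof (intro sum.cong refl)
    fix k assume "k \<in> {..a + 1}"
    then have k: "k \<le> a + 1" by simp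
    show "of_nat ((j + 0) choose (a + 1 - k)) * C k * (bsum (r - j - k) (CARD('p) - 2) :: 'p mod_ring)
      = (if k + j = a + 1 then C k else 0)"
    proof (cases "k + j < a + 1")
      case True
      then have "j + 0 < a + 1 - k" by linarith
      then show ?thesis using True by (simp add: binomial_eq_0)
    next
      case False
      define M where "M = CARD('p) - 1 + a - j - k"
      have M: "1 \<le> M" "M + j + k = a + (CARD('p) - 1)" using j k assms unfolding M_def by linarith+
      have M2: "M < CARD('p)" using M(2) False p3 by linarith
      have "[M + j + k = a] (mod (CARD('p) - 1))" by (rule cong_add_period[OF M(2)])
      moreover have "j + k < r" using j k assms two_i_less_r by linarith
      ultimately have b: "(bsum (r - j - k) (CARD('p) - 2) :: 'p mod_ring) = of_nat (M choose (CARD('p) - 2))"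
        using M(1) M2 w by (intro bsum_row_value) auto
      show ?thesis
      proof (cases "k + j = a + 1")
        case True
        then have "M = CARD('p) - 2" "a + 1 - k = j" using M(2) p3 by linarith+
        then show ?thesis unfolding b using True by simp
      next
        case ne: False
        then have "M < CARD('p) - 2" using M(2) False p3 by linarith
        then show ?thesis unfolding b using ne by (simp add: binomial_eq_0)
      qed
    qed
  qed
  have low: "(\<Sum>n\<le>i. if [n = CARD('p) - 2] (mod (CARD('p) - 1))
         then of_nat ((r - j) choose n) * of_nat ((r - n + 0) choose (a + 1)) else 0) = (0 :: 'p mod_ring)"
  proof (intro sum.neutral ballI)
    fix n assume "n \<in> {..i}"
    then have "n < CARD('p) - 2" using assms by auto
    then have "\<not> [n = CARD('p) - 2] (mod (CARD('p) - 1))"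
      using w by (subst cong_small_iff) auto
    then show "(if [n = CARD('p) - 2] (mod (CARD('p) - 1))
         then of_nat ((r - j) choose n) * of_nat ((r - n + 0) choose (a + 1)) else 0) = (0 :: 'p mod_ring)" by simp
  qed
  have upp: "(\<Sum>k\<le>i - j. if [r - j - k = CARD('p) - 2] (mod (CARD('p) - 1))
         then C k * of_nat ((j + k + 0) choose (a + 1)) else (0 :: 'p mod_ring))
    = (\<Sum>k\<le>i - j. if k + j = a + 1 then C k else 0)"
  proof (intro sum.cong refl)
    fix k assume "k \<in> {..i - j}"
    then have k: "j + k \<le> i" using j by auto
    have "[r - j - k = CARD('p) - 2] (mod (CARD('p) - 1)) \<longleftrightarrow> [CARD('p) - 2 + j + k = a] (mod (CARD('p) - 1))"
      using k i_le_r by (intro upper_edge_cong) simp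
    also have "\<dots> \<longleftrightarrow> [CARD('p) - 2 + j + k + 1 = a + 1] (mod (CARD('p) - 1))"
      by (simp only: cong_add_rcancel_nat)
    also have "CARD('p) - 2 + j + k + 1 = j + k + (CARD('p) - 1)" using p3 by linarith
    also have "[j + k + (CARD('p) - 1) = a + 1] (mod (CARD('p) - 1)) \<longleftrightarrow> [j + k = a + 1] (mod (CARD('p) - 1))"
      by (simp only: cong_def mod_add_self2)
    also have "\<dots> \<longleftrightarrow> j + k = a + 1" using k assms by (intro cong_small_iff) linarith+
    finally show "(if [r - j - k = CARD('p) - 2] (mod (CARD('p) - 1))
         then C k * of_nat ((j + k + 0) choose (a + 1)) else 0) = (if k + j = a + 1 then C k else (0 :: 'p mod_ring))"
      by (simp add: add.commute)
  qed
  have "(\<Sum>k\<le>a + 1. if k + j = a + 1 then C k else 0) = (\<Sum>k\<le>a + 1 + i. if k + j = a + 1 then C k else 0)"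
    by (intro sum.mono_neutral_left) auto
  also have "\<dots> = (\<Sum>k\<le>i - j. if k + j = a + 1 then C k else 0)"
    using assms by (intro sum.mono_neutral_right) auto
  finally show "(\<Sum>n\<le>r - j. of_nat ((r - j) choose n) *
      cut_poly r i (CARD('p) - 2) (binpoly (of_nat (r + 0)) (a + 1) :: 'p mod_ring poly) n) = 0"
    unfolding interior_sum[OF two_i_less_r ep j] low
    unfolding C_def[symmetric] main upp by simp
qed

lemma annih_constant:
  assumes "i = CARD('p) - 1" "r0 + 1 = a" "2 \<le> a"
  shows "cut_poly r i 1 (binpoly (of_nat (r + 0)) 0 :: 'p mod_ring poly) \<in> annih r (relations r i)"
proof (rule cut_poly_annih_relations[OF i_less_p i_le_r])
  have ep: "0 < CARD('p)" using p3 by linarith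
  show "degree (binpoly (of_nat (r + 0)) 0 :: 'p mod_ring poly) \<le> i" by (simp add: binpoly_def)
  fix j assume j: "j \<le> i"
  have w: "0 < (1::nat)" "1 < CARD('p) - 1" using p3 by linarith+
  define M where "M = (if j < a then a - j else CARD('p) - 1 + a - j)"
  have M: "1 \<le> M" "M < CARD('p)" "M + j = a \<or> M + j = a + (CARD('p) - 1)"
    using j assms ip ap a1 unfolding M_def by auto
  then have Mc: "[M + j + 0 = a] (mod (CARD('p) - 1))"
    using cong_add_period[of "M + j" a] by auto
  have jr: "j + 0 < r" using j two_i_less_r by linarith
  have main: "(\<Sum>k\<le>0. of_nat ((j + 0) choose (0 - k)) * of_nat ((r - j) choose k) * (bsum (r - j - k) 1 :: 'p mod_ring))
    = of_nat M"
    using bsum_row_value[OF jr M(1,2) Mc w] by simp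
  have low: "(\<Sum>n\<le>i. if [n = 1] (mod (CARD('p) - 1))
         then of_nat ((r - j) choose n) * of_nat ((r - n + 0) choose 0) else 0) = (of_nat (r - j) :: 'p mod_ring)"
  proof -
    have "[n = 1] (mod (CARD('p) - 1)) \<longleftrightarrow> n = 1" if "n \<le> i" for n
    proof (cases "n = CARD('p) - 1")
      case True
      then show ?thesis using w by (auto simp: cong_def)
    next
      case False
      then show ?thesis using that assms(1) w by (intro cong_small_iff) auto
    qed
    then have "(\<Sum>n\<le>i. if [n = 1] (mod (CARD('p) - 1))
         then of_nat ((r - j) choose n) * of_nat ((r - n + 0) choose 0) else 0)
       = (\<Sum>n\<le>i. if n = 1 then of_nat (r - j) else (0 :: 'p mod_ring))"
      by (intro sum.cong refl) auto
    then show ?thesis using i1 by simp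
  qed
  have upp: "(\<Sum>k\<le>i - j. if [r - j - k = 1] (mod (CARD('p) - 1))
         then of_nat ((r - j) choose k) * of_nat ((j + k + 0) choose 0) else (0 :: 'p mod_ring))
    = (if j < a then 1 else 0)"
  proof -
    have c: "[r - j - k = 1] (mod (CARD('p) - 1)) \<longleftrightarrow> j + k = r0" if k: "j + k \<le> i" for k
    proof -
      have "[r - j - k = 1] (mod (CARD('p) - 1)) \<longleftrightarrow> [1 + j + k = a] (mod (CARD('p) - 1))"
        using k i_le_r by (intro upper_edge_cong) simp
      also have "\<dots> \<longleftrightarrow> [j + k + 1 = r0 + 1] (mod (CARD('p) - 1))"
        using assms(2) by (simp add: add_ac)
      also have "\<dots> \<longleftrightarrow> [j + k = r0] (mod (CARD('p) - 1))"
        by (simp only: cong_add_rcancel_nat)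
      also have "\<dots> \<longleftrightarrow> j + k = r0"
      proof (cases "j + k = CARD('p) - 1")
        case True
        then show ?thesis using assms ap by (auto simp: cong_def)
      next
        case False
        then show ?thesis using k assms ap by (intro cong_small_iff) linarith+
      qed
      finally show ?thesis .
    qed
    have "(\<Sum>k\<le>i - j. if [r - j - k = 1] (mod (CARD('p) - 1))
         then of_nat ((r - j) choose k) * of_nat ((j + k + 0) choose 0) else (0 :: 'p mod_ring))
      = (\<Sum>k\<le>i - j. if k + j = r0 then 1 else 0)"
    proof (intro sum.cong refl)
      fix k assume "k \<in> {..i - j}"
      then have k: "j + k \<le> i" using j by auto
      have "(of_nat ((r - j) choose k) :: 'p mod_ring) = 1" if e: "k + j = r0"
      proof -
        have "(of_nat ((r - j) choose k) :: 'p mod_ring) = of_nat ((r0 - j) choose k)"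
          using e r_digits(2) by (intro binomial_r_minus_low) linarith+
        also have "r0 - j = k" using e by linarith
        finally show ?thesis by simp
      qed
      then show "(if [r - j - k = 1] (mod (CARD('p) - 1))
         then of_nat ((r - j) choose k) * of_nat ((j + k + 0) choose 0) else (0 :: 'p mod_ring))
         = (if k + j = r0 then 1 else 0)"
        unfolding c[OF k] by (auto simp: add.commute)
    qed
    also have "\<dots> = (if j < a then 1 else 0)"
    proof (cases "j < a")
      case True
      then have "(\<Sum>k\<le>i - j. if k + j = r0 then 1 else 0) = (\<Sum>k\<le>i - j. if k = r0 - j then 1 else (0 :: 'p mod_ring))"
        using assms(2) by (intro sum.cong refl) auto
      moreover have "r0 - j \<le> i - j" using assms ap by linarith
      ultimately show ?thesis using True by simp
    next
      case False
      then show ?thesis using assms(2) by (intro trans[OF sum.neutral]) auto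
    qed
    finally show ?thesis .
  qed
  have ofr: "(of_nat (r - j) :: 'p mod_ring) = of_nat a - 1 - of_nat j"
  proof -
    have "(of_nat r :: 'p mod_ring) = of_nat r0" using r0 r_digits(2) by (simp add: of_nat_mod_ring_eq_iff)
    moreover have "(of_nat a :: 'p mod_ring) = of_nat r0 + 1" using assms(2) by (metis of_nat_1 of_nat_add)
    ultimately show ?thesis using jr by (simp add: of_nat_diff)
  qed
  have ofM: "(of_nat M :: 'p mod_ring) = of_nat a - of_nat j - (if j < a then 0 else 1)"
    unfolding M_def using j assms p3 ap ip by (auto simp: of_nat_diff)
  show "(\<Sum>n\<le>r - j. of_nat ((r - j) choose n) *
      cut_poly r i 1 (binpoly (of_nat (r + 0)) 0 :: 'p mod_ring poly) n) = 0"
    unfolding interior_sum[OF two_i_less_r ep j] low upp main ofr ofM by simp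
qed

lemma degree_binpoly_neq_0: "e < CARD('p) \<Longrightarrow> (binpoly c e :: 'p mod_ring poly) \<noteq> 0"
proof -
  assume e: "e < CARD('p)"
  have "poly (binpoly c e) (c - of_nat e) = (of_nat (e choose e) :: 'p mod_ring)"
    using e by (intro poly_binpoly) simp_all
  then show ?thesis by auto
qed

section \<open>Reducible quotients\<close>

text \<open>
  Two elements of the annihilator whose degrees lie on different sides of \<open>m\<close> are separated by
  \<open>V^(m)\<close>.  The edge condition is needed because the cut-off removes the values at \<open>m \<le> n \<le> i\<close> as well.
\<close>

lemma reducible_by_filtration:
  fixes P P' :: "'p mod_ring poly"
  assumes P: "cut_poly r i w P \<in> annih r (relations r i)" "P \<noteq> 0" "degree P < m"
    and P': "cut_poly r i w' P' \<in> annih r (relations r i)" "m \<le> degree P'" "degree P' \<le> i" and m: "1 \<le> m"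
    and edge: "\<And>n. m \<le> n \<Longrightarrow> n + m \<le> r \<Longrightarrow> [n = w] (mod (CARD('p) - 1)) \<Longrightarrow> n \<le> i \<or> r \<le> n + i \<Longrightarrow>
      poly P (of_nat n) = 0"
  shows "\<not> girreducible Fp GL2 quotient_module"
proof -
  have dP: "degree P \<le> i" and mp: "m \<le> CARD('p)" using P P' i_less_p by linarith+
  obtain n where n: "n \<le> r" "cut_poly r i w P n \<noteq> 0" using cut_poly_nonzero[OF dP P(2)] by blast
  show ?thesis
    by (rule reducible_by_subspace[OF i_le_r stable_subspace_Vfilt P(1) _ n P'(1)])
      (use cut_poly_annih_Vfilt[OF m mp P(3) edge] cut_poly_not_annih_Vfilt[OF m P'(2,3)] in auto)
qed

lemma reducible_by_low_digits:
  fixes P P' :: "'p mod_ring poly"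
  assumes P: "cut_poly r i w P \<in> annih r (relations r i)" "P \<noteq> 0" "degree P \<le> i"
    and low: "\<And>n. n mod CARD('p) \<le> r0 \<Longrightarrow> n \<le> r \<Longrightarrow> poly P (of_nat n) = 0"
    and P': "cut_poly r i w' P' \<in> annih r (relations r i)"
    and n: "n mod CARD('p) \<le> r0" "i < n" "n + i < r" "[n = w'] (mod (CARD('p) - 1))" "poly P' (of_nat n) \<noteq> 0"
  shows "\<not> girreducible Fp GL2 quotient_module"
proof -
  obtain n' where n': "n' \<le> r" "cut_poly r i w P n' \<noteq> 0" using cut_poly_nonzero[OF P(3,2)] by blast
  have "cut_poly r i w P \<in> annih r (low_digit_forms r)"
    unfolding annih_low_digit_forms_iff r0[symmetric] using low by (simp add: cut_poly_def)
  moreover have "cut_poly r i w' P' \<notin> annih r (low_digit_forms r)"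
    unfolding annih_low_digit_forms_iff r0[symmetric] using n by (auto simp: cut_poly_def intro!: exI[of _ n])
  ultimately show ?thesis
    using reducible_by_subspace[OF i_le_r stable_subspace_low_digit_forms P(1) _ n' P'] by blast
qed

lemma class_zero_low:
  "n \<le> i \<Longrightarrow> 1 \<le> n \<Longrightarrow> [n = 0] (mod (CARD('p) - 1)) \<Longrightarrow> n = CARD('p) - 1 \<and> i = CARD('p) - 1"
  using ip by (auto simp: cong_0_iff dest!: dvd_imp_le)

lemma class_zero_high:
  assumes "n \<le> r" "r \<le> n + i" "1 \<le> r - n" "[n = 0] (mod (CARD('p) - 1))"
  shows "r - n = a"
proof -
  have "[n + (r - n) = 0 + (r - n)] (mod (CARD('p) - 1))" using assms(4) by (intro cong_add cong_refl)
  then have c: "[r - n = r] (mod (CARD('p) - 1))" using assms(1) by (simp add: cong_sym)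
  have "r - n \<le> CARD('p) - 1" using assms(2) ip by linarith
  then have "r - n < a + 2 * (CARD('p) - 1)" using a1 by linarith
  with c show ?thesis
    by (rule cong_r_cases) (use assms ip a1 in linarith)+
qed

lemma poly_binpoly_shift:
  assumes "e < CARD('p)" "n \<le> r"
  shows "poly (binpoly (of_nat (r + q)) e) (of_nat n) = (of_nat ((r - n + q) choose e) :: 'p mod_ring)"
  using assms by (intro poly_binpoly) (simp_all add: of_nat_diff)

text \<open>
  For small \<open>i\<close> both a constant and a linear polynomial occur.
\<close>

lemma reducible_small_i:
  assumes "i + 2 \<le> a"
  shows "\<not> girreducible Fp GL2 quotient_module"
proof (rule reducible_by_filtration[where m = 1])
  have p1: "1 < CARD('p)" using p3 by linarith
  show "cut_poly r i 0 (binpoly (of_nat (r + 0)) 0 :: 'p mod_ring poly) \<in> annih r (relations r i)"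
    "cut_poly r i 0 (binpoly (of_nat (r + 0)) 1 :: 'p mod_ring poly) \<in> annih r (relations r i)"
    using assms i1 by (intro annih_low_degree; linarith)+
  show "(binpoly (of_nat (r + 0)) 0 :: 'p mod_ring poly) \<noteq> 0" using p1 by (intro degree_binpoly_neq_0) linarith
  show "degree (binpoly (of_nat (r + 0)) 0 :: 'p mod_ring poly) < 1" by (simp add: binpoly_def)
  show "1 \<le> degree (binpoly (of_nat (r + 0)) 1 :: 'p mod_ring poly)"
    "degree (binpoly (of_nat (r + 0)) 1 :: 'p mod_ring poly) \<le> i"
    unfolding degree_binpoly[OF p1] using i1 by simp_all
  fix n assume n: "1 \<le> n" "n + 1 \<le> r" "[n = 0] (mod CARD('p) - 1)" "n \<le> i \<or> r \<le> n + i"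
  then have False
    using class_zero_low[of n] class_zero_high[of n] assms ap p3 by force
  then show "poly (binpoly (of_nat (r + 0)) 0) (of_nat n) = (0 :: 'p mod_ring)" ..
qed simp

text \<open>
  The constants and a polynomial of positive degree, which exists because of \<open>r0 < a\<close>, are separated by
  \<open>V^(1)\<close>.
\<close>

lemma reducible_i_eq_a_minus_1:
  assumes "i + 1 = a" "r0 < a"
  shows "\<not> girreducible Fp GL2 quotient_module"
proof -
  have p1: "0 < CARD('p)" using p3 by linarith
  obtain w e c where g: "cut_poly r i w (binpoly c e :: 'p mod_ring poly) \<in> annih r (relations r i)" "1 \<le> e" "e \<le> i"
  proof (cases "r0 = 0")
    case True
    show ?thesis by (rule that[OF annih_r0_zero]) (use True assms i1 in auto)
  next
    case False
    show ?thesis by (rule that[OF annih_excess_degree]) (use False assms ap in auto)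
  qed
  have ep: "e < CARD('p)" using g(3) i_less_p by linarith
  show ?thesis
  proof (rule reducible_by_filtration[where m = 1])
    show "cut_poly r i 0 (binpoly (of_nat (r + 0)) 0 :: 'p mod_ring poly) \<in> annih r (relations r i)"
      using assms i1 by (intro annih_low_degree; linarith)+
    show "(binpoly (of_nat (r + 0)) 0 :: 'p mod_ring poly) \<noteq> 0" using p1 by (intro degree_binpoly_neq_0) linarith
    show "degree (binpoly (of_nat (r + 0)) 0 :: 'p mod_ring poly) < 1" by (simp add: binpoly_def)
    show "cut_poly r i w (binpoly c e :: 'p mod_ring poly) \<in> annih r (relations r i)" by fact
    show "1 \<le> degree (binpoly c e :: 'p mod_ring poly)" "degree (binpoly c e :: 'p mod_ring poly) \<le> i"
      unfolding degree_binpoly[OF ep] using g by simp_all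
    fix n assume n: "1 \<le> n" "n + 1 \<le> r" "[n = 0] (mod CARD('p) - 1)" "n \<le> i \<or> r \<le> n + i"
    then have False
      using class_zero_low[of n] class_zero_high[of n] assms ap p3 by force
    then show "poly (binpoly (of_nat (r + 0)) 0) (of_nat n) = (0 :: 'p mod_ring)" ..
  qed simp
qed

text \<open>
  Elements of degrees \<open>a - r0\<close> and \<open>a\<close> are separated by the filtration if \<open>r0 > 0\<close>.  For \<open>r0 = 0\<close> the degrees
  agree, but only one of the two vanishes at all multiples of \<open>p\<close>.
\<close>

lemma reducible_middle_r0_small:
  assumes "a \<le> i" "i + 2 \<le> CARD('p)" "r0 < a"
  shows "\<not> girreducible Fp GL2 quotient_module"
proof -
  define q where "q = CARD('p) - 1 - r0"
  have aP: "a < CARD('p)" using assms by linarith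
  have f: "cut_poly r i 0 (binpoly (of_nat (r + q)) (a - r0) :: 'p mod_ring poly) \<in> annih r (relations r i)"
    unfolding q_def using assms by (intro annih_excess_degree) linarith+
  have g: "cut_poly r i 0 (binpoly (of_nat (r + 0)) a :: 'p mod_ring poly) \<in> annih r (relations r i)"
    using assms by (intro annih_degree_a) linarith+
  show ?thesis
  proof (cases "r0 = 0")
    case False
    have ep: "a - r0 < CARD('p)" using aP by linarith
    show ?thesis
    proof (rule reducible_by_filtration[OF f _ _ g, where m = a])
      show "(binpoly (of_nat (r + q)) (a - r0) :: 'p mod_ring poly) \<noteq> 0" by (rule degree_binpoly_neq_0[OF ep])
      show "degree (binpoly (of_nat (r + q)) (a - r0) :: 'p mod_ring poly) < a"
        unfolding degree_binpoly[OF ep] using False a1 by linarith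
      show "a \<le> degree (binpoly (of_nat (r + 0)) a :: 'p mod_ring poly)"
        "degree (binpoly (of_nat (r + 0)) a :: 'p mod_ring poly) \<le> i"
        unfolding degree_binpoly[OF aP] using assms by simp_all
      fix n assume n: "a \<le> n" "n + a \<le> r" "[n = 0] (mod CARD('p) - 1)" "n \<le> i \<or> r \<le> n + i"
      have "\<not> n \<le> i" using class_zero_low[of n] n a1 assms by linarith
      then have "r - n = a" using n a1 by (intro class_zero_high) linarith+
      then have "poly (binpoly (of_nat (r + q)) (a - r0)) (of_nat n) = (of_nat ((a + q) choose (a - r0)) :: 'p mod_ring)"
        using poly_binpoly_shift[OF ep, of n q] n by simp
      also have "a + q = CARD('p) + (a - r0 - 1)" unfolding q_def using assms r_digits(2) by linarith
      also have "(of_nat ((CARD('p) + (a - r0 - 1)) choose (a - r0)) :: 'p mod_ring) = 0"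
        using assms(3) ep by (subst binomial_wrap) (auto simp: binomial_eq_0)
      finally show "poly (binpoly (of_nat (r + q)) (a - r0)) (of_nat n) = (0 :: 'p mod_ring)" .
    qed (rule a1)
  next
    case True
    have rq_big: "a + (CARD('p) - 1) \<le> rq"
    proof (rule ccontr)
      assume "\<not> a + (CARD('p) - 1) \<le> rq"
      moreover have "a < rq" using rq_ge assms(1) by linarith
      moreover have "[rq = a] (mod (CARD('p) - 1))" using rq_cong True by simp
      then have "rq mod (CARD('p) - 1) = a mod (CARD('p) - 1)" by (simp add: cong_def)
      then have "(CARD('p) - 1) dvd rq - a" using \<open>a < rq\<close> by (metis mod_eq_dvd_iff_nat less_imp_le)
      then have "CARD('p) - 1 \<le> rq - a" using \<open>a < rq\<close> by (intro dvd_imp_le) auto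
      ultimately show False by linarith
    qed
    have r_big: "CARD('p) * (CARD('p) - 1) + CARD('p) * a \<le> r"
    proof -
      have "CARD('p) * (a + (CARD('p) - 1)) \<le> CARD('p) * rq" using rq_big by (rule mult_le_mono2)
      then show ?thesis using r_digits(1) unfolding distrib_left by linarith
    qed
    define n where "n = CARD('p) * (CARD('p) - 1)"
    have n0: "n mod CARD('p) = 0" by (simp add: n_def)
    have pa: "CARD('p) * 1 \<le> CARD('p) * a" using a1 by (intro mult_le_mono2)
    have ni: "i < n" "n + i < r"
    proof -
      have "CARD('p) * 1 \<le> n" unfolding n_def using p3 by (intro mult_le_mono2) linarith
      then show "i < n" using i_less_p by linarith
      show "n + i < r" using r_big pa i_less_p unfolding n_def by linarith
    qed
    show ?thesis
    proof (rule reducible_by_low_digits[OF g _ _ _ f])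
      show "(binpoly (of_nat (r + 0)) a :: 'p mod_ring poly) \<noteq> 0" by (rule degree_binpoly_neq_0[OF aP])
      show "degree (binpoly (of_nat (r + 0)) a :: 'p mod_ring poly) \<le> i" unfolding degree_binpoly[OF aP] by fact
      show "n mod CARD('p) \<le> r0" "i < n" "n + i < r" using n0 ni by simp_all
      show "[n = 0] (mod CARD('p) - 1)" by (simp add: n_def cong_0_iff)
      have "(of_nat ((r - n + q) choose (a - r0)) :: 'p mod_ring) = of_nat (((r - n + q) mod CARD('p)) choose a)"
        using True aP by (subst binomial_mod_upper) auto
      also have "(r - n + q) mod CARD('p) = CARD('p) - 1"
      proof -
        have "CARD('p) dvd r" using True r0 by (simp add: dvd_eq_mod_eq_0)
        moreover have "CARD('p) dvd n" by (simp add: n_def)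
        ultimately have "CARD('p) dvd r - n" by simp
        then obtain s where "r - n = CARD('p) * s" by (rule dvdE)
        moreover have "q mod CARD('p) = CARD('p) - 1"
        proof (subst mod_less)
          show "q < CARD('p)" unfolding q_def using p3 by linarith
          show "q = CARD('p) - 1" unfolding q_def using True by linarith
        qed
        ultimately show ?thesis by simp
      qed
      finally show "poly (binpoly (of_nat (r + q)) (a - r0)) (of_nat n) \<noteq> (0 :: 'p mod_ring)"
        using poly_binpoly_shift[of "a - r0" n q] ni aP of_nat_binomial_neq_0[of "CARD('p) - 1" a, where 'p='p] ap p3
        by simp
      fix k assume k: "k mod CARD('p) \<le> r0" "k \<le> r"
      have "CARD('p) dvd r" "CARD('p) dvd k" using True r0 k by (simp_all add: dvd_eq_mod_eq_0)
      then have "(r - k) mod CARD('p) = 0" by simp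
      then have "(of_nat ((r - k) choose a) :: 'p mod_ring) = of_nat (0 choose a)"
        using aP by (subst binomial_mod_upper) auto
      then show "poly (binpoly (of_nat (r + 0)) a) (of_nat k) = (0 :: 'p mod_ring)"
        using poly_binpoly_shift[OF aP k(2), of 0] a1 by (simp add: binomial_eq_0)
    qed
  qed
qed

text \<open>
  Besides degree \<open>a\<close> in the class of \<open>0\<close> there is an element of larger degree; which one depends on how close
  \<open>i\<close> is to \<open>p\<close>.
\<close>

lemma reducible_middle_r0_large:
  assumes "a < i" "i + 2 \<le> CARD('p)" "a \<le> r0"
  shows "\<not> girreducible Fp GL2 quotient_module"
proof -
  have aP: "a < CARD('p)" using assms by linarith
  have f: "cut_poly r i 0 (binpoly (of_nat (r + 0)) a :: 'p mod_ring poly) \<in> annih r (relations r i)"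
    using assms by (intro annih_degree_a) linarith+
  obtain w e c where g: "cut_poly r i w (binpoly c e :: 'p mod_ring poly) \<in> annih r (relations r i)" "a + 1 \<le> e" "e \<le> i"
  proof (cases "i + 3 \<le> CARD('p)")
    case True
    show ?thesis by (rule that[OF annih_degree_a_plus_1]) (use True assms in auto)
  next
    case False
    then have i2: "i = CARD('p) - 2" using assms by linarith
    show ?thesis
    proof (cases "r0 = a")
      case True
      show ?thesis by (rule that[OF annih_two_points]) (use True i2 assms in auto)
    next
      case ne: False
      show ?thesis by (rule that[OF annih_degree_p_minus_2]) (use ne i2 assms in auto)
    qed
  qed
  have ep: "e < CARD('p)" using g(3) i_less_p by linarith
  show ?thesis
  proof (rule reducible_by_filtration[OF f _ _ g(1), where m = "a + 1"])
    show "(binpoly (of_nat (r + 0)) a :: 'p mod_ring poly) \<noteq> 0" by (rule degree_binpoly_neq_0[OF aP])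
    show "degree (binpoly (of_nat (r + 0)) a :: 'p mod_ring poly) < a + 1" unfolding degree_binpoly[OF aP] by simp
    show "a + 1 \<le> degree (binpoly c e :: 'p mod_ring poly)" "degree (binpoly c e :: 'p mod_ring poly) \<le> i"
      unfolding degree_binpoly[OF ep] using g by simp_all
    fix n assume n: "a + 1 \<le> n" "n + (a + 1) \<le> r" "[n = 0] (mod CARD('p) - 1)" "n \<le> i \<or> r \<le> n + i"
    have "\<not> n \<le> i" using class_zero_low[of n] n a1 assms by linarith
    then have "r - n = a" using n a1 by (intro class_zero_high) linarith+
    then show "poly (binpoly (of_nat (r + 0)) a) (of_nat n) = (0 :: 'p mod_ring)" using n by linarith
  qed simp
qed

text \<open>
  For \<open>r0 = p - 1\<close> the degrees \<open>a < p - 1\<close> and \<open>p - 1\<close> both occur.  Otherwise the indicator of the last digit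
  \<open>p - 1 > r0\<close> vanishes at all last digits up to \<open>r0\<close>, and some other element does not.
\<close>

lemma reducible_i_eq_p_minus_1:
  assumes i: "i = CARD('p) - 1" and "\<not> (a = CARD('p) - 1 \<and> r0 = CARD('p) - 1)" "\<not> (a = 1 \<and> r0 = 0)"
  shows "\<not> girreducible Fp GL2 quotient_module"
proof (cases "r0 = CARD('p) - 1")
  case True
  then have ap2: "a + 1 \<le> CARD('p) - 1" using assms ap by linarith
  then have aP: "a < CARD('p)" by linarith
  have f: "cut_poly r i 0 (binpoly (of_nat (r + 0)) a :: 'p mod_ring poly) \<in> annih r (relations r i)"
    using True ap i by (intro annih_degree_a) auto
  have g: "cut_poly r i 0 (delta_poly 0 :: 'p mod_ring poly) \<in> annih r (relations r i)"
    using True ap2 i p3 by (intro annih_delta) linarith+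
  show ?thesis
  proof (rule reducible_by_filtration[OF f _ _ g, where m = "a + 1"])
    show "(binpoly (of_nat (r + 0)) a :: 'p mod_ring poly) \<noteq> 0" by (rule degree_binpoly_neq_0[OF aP])
    show "degree (binpoly (of_nat (r + 0)) a :: 'p mod_ring poly) < a + 1" unfolding degree_binpoly[OF aP] by simp
    show "a + 1 \<le> degree (delta_poly 0 :: 'p mod_ring poly)" "degree (delta_poly 0 :: 'p mod_ring poly) \<le> i"
      unfolding degree_delta_poly using ap2 i by simp_all
    fix n assume n: "a + 1 \<le> n" "n + (a + 1) \<le> r" "[n = 0] (mod CARD('p) - 1)" "n \<le> i \<or> r \<le> n + i"
    show "poly (binpoly (of_nat (r + 0)) a) (of_nat n) = (0 :: 'p mod_ring)"
    proof (cases "n \<le> i")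
      case nI: True
      then have np: "n = CARD('p) - 1" using class_zero_low[of n] n a1 by linarith
      have "(of_nat ((r - n) choose a) :: 'p mod_ring) = of_nat ((r0 - n) choose a)"
        using np True aP by (intro binomial_r_minus_low) auto
      then show ?thesis using poly_binpoly_shift[OF aP, of n 0] n np True a1 by (simp add: binomial_eq_0)
    next
      case False
      then have "r - n = a" using n a1 by (intro class_zero_high) linarith+
      then show ?thesis using n by linarith
    qed
  qed simp
next
  case False
  then have r0p: "r0 < CARD('p) - 1" using r_digits(2) by linarith
  have f: "cut_poly r i (CARD('p) - 1) (delta_poly (CARD('p) - 1) :: 'p mod_ring poly) \<in> annih r (relations r i)"
    using r0p i p3 by (intro annih_delta) linarith+
  have f0: "(delta_poly (CARD('p) - 1) :: 'p mod_ring poly) \<noteq> 0"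
    using degree_delta_poly[of "CARD('p) - 1", where 'p='p] p3 by force
  have fd: "degree (delta_poly (CARD('p) - 1) :: 'p mod_ring poly) \<le> i" using i by (simp add: degree_delta_poly)
  have fl: "poly (delta_poly (CARD('p) - 1) :: 'p mod_ring poly) (of_nat n) = 0" if "n mod CARD('p) \<le> r0" for n
    using that r0p by (simp add: poly_delta_poly)
  have rb: "CARD('p) * (CARD('p) - 1) + 2 * CARD('p) - 1 \<le> r"
  proof -
    have "(CARD('p) - 1) * (CARD('p) + 1) = CARD('p) * (CARD('p) - 1) + (CARD('p) - 1)" by (simp add: algebra_simps)
    then show ?thesis using r_ge[unfolded i] p3 by linarith
  qed
  have pp: "CARD('p) * 2 \<le> CARD('p) * (CARD('p) - 1)" using p3 by (intro mult_le_mono2) linarith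
  show ?thesis
  proof (cases "r0 + 1 = a")
    case False
    have g: "cut_poly r i 0 (delta_poly 0 :: 'p mod_ring poly) \<in> annih r (relations r i)"
      using False i p3 by (intro annih_delta) linarith+
    show ?thesis
    proof (rule reducible_by_low_digits[OF f f0 fd fl g])
      define n where "n = CARD('p) * (CARD('p) - 1)"
      show "n mod CARD('p) \<le> r0" by (simp add: n_def)
      show "i < n" "n + i < r" using rb pp i p3 unfolding n_def by linarith+
      show "[n = 0] (mod CARD('p) - 1)" by (simp add: n_def cong_0_iff)
      show "poly (delta_poly 0 :: 'p mod_ring poly) (of_nat n) \<noteq> 0"
        unfolding poly_delta_poly by (simp add: n_def)
    qed
  next
    case True
    then have g: "cut_poly r i 1 (binpoly (of_nat (r + 0)) 0 :: 'p mod_ring poly) \<in> annih r (relations r i)"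
      using assms i a1 by (intro annih_constant) linarith+
    show ?thesis
    proof (rule reducible_by_low_digits[OF f f0 fd fl g])
      show "CARD('p) mod CARD('p) \<le> r0" by simp
      show "i < CARD('p)" by (rule i_less_p)
      show "CARD('p) + i < r" using rb pp i p3 by linarith
      show "[CARD('p) = 1] (mod CARD('p) - 1)" using p3 by (intro cong_add_period) linarith
      show "poly (binpoly (of_nat (r + 0)) 0 :: 'p mod_ring poly) (of_nat CARD('p)) \<noteq> 0"
        by (simp add: binpoly_def)
    qed
  qed
qed

text \<open>
  The five reducibility results cover all parameters outside the list.
\<close>

lemma irreducible_imp:
  assumes "girreducible Fp GL2 quotient_module"
  shows "((i + 1 = a \<or> i = a) \<and> a \<le> r0) \<or> (i = CARD('p) - 1 \<and> a = 1 \<and> r0 = 0)"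
proof (rule ccontr)
  assume n: "\<not> ?thesis"
  have r0p: "r0 \<le> CARD('p) - 1" using r_digits(2) by linarith
  consider "i + 2 \<le> a" | "i + 1 = a" | "a \<le> i" "i + 2 \<le> CARD('p)" "r0 < a"
    | "a \<le> i" "i + 2 \<le> CARD('p)" "a \<le> r0" | "i = CARD('p) - 1" using ip by linarith
  then show False
  proof cases
    case 1
    then show ?thesis using reducible_small_i assms by blast
  next
    case 2
    then show ?thesis using reducible_i_eq_a_minus_1 assms n by auto
  next
    case 3
    then show ?thesis using reducible_middle_r0_small assms by blast
  next
    case 4
    then have "a < i" using n by linarith
    with 4 show ?thesis using reducible_middle_r0_large assms by blast
  next
    case 5
    then show ?thesis using reducible_i_eq_p_minus_1 assms n by auto
  qed
qed

section \<open>Criteria for irreducibility\<close>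

lemma cut_poly_cong_class: "[w = w'] (mod CARD('p) - 1) \<Longrightarrow> cut_poly r i w (P :: 'p mod_ring poly) = cut_poly r i w' P"
  unfolding cut_poly_def fun_eq_iff by (metis cong_sym cong_trans)

lemma cut_poly_smult: "cut_poly r i w (smult k P) n = k * cut_poly r i w (P :: 'p mod_ring poly) n"
  by (simp add: cut_poly_def)

lemma cut_poly_rows:
  fixes P :: "'p mod_ring poly"
  assumes "cut_poly r i w P \<in> annih r (relations r i)" "j \<le> i"
  shows "(\<Sum>n\<le>r - j. of_nat ((r - j) choose n) * cut_poly r i w P n) = 0"
  by (rule annih_generator_sum[OF stable_subspace_relations[OF i_le_r] bmono_in_relations[OF i_le_r] i_less_p i_le_r assms])

lemma annih_class_cut_poly:
  fixes g :: "nat \<Rightarrow> 'p mod_ring"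
  assumes H: "stable_subspace r H" "relations r i \<subseteq> H" and g: "g \<in> annih r H"
  obtains P where "degree P \<le> i" "cut_poly r i w P \<in> annih r H"
    "\<And>n. n \<le> r \<Longrightarrow> [n = w] (mod (CARD('p) - 1)) \<Longrightarrow> g n = cut_poly r i w P n"
proof -
  have "g \<in> annih r (relations r i)" using annih_antimono[OF H(2)] g by blast
  then obtain P where P: "degree P \<le> i"
    "\<And>n. n \<le> r \<Longrightarrow> [n = w] (mod (CARD('p) - 1)) \<Longrightarrow> g n = cut_poly r i w P n"
    using annih_relations_class[OF i_less_p i_le_r, of g w] by metis
  have "cut_poly r i w P \<in> annih r H"
  proof (rule annih_cong[OF annih_class[OF H(1) g, of w]])
    fix n assume "n \<le> r"
    then show "(if [n = w] (mod CARD('p) - 1) then g n else 0) = cut_poly r i w P n"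
      using P(2)[of n] by (simp add: cut_poly_def)
  qed
  then show thesis using that P by blast
qed

text \<open>
  A functional is the sum of its class parts.
\<close>

lemma annih_subset_by_classes:
  fixes H :: "'p mod_ring poly poly set"
  assumes H: "stable_subspace r H"
    and cls: "\<And>w P. w < CARD('p) - 1 \<Longrightarrow> degree P \<le> i \<Longrightarrow> cut_poly r i w (P :: 'p mod_ring poly) \<in> annih r (relations r i)
      \<Longrightarrow> cut_poly r i w P \<in> annih r H"
  shows "annih r (relations r i) \<subseteq> annih r H"
proof
  fix g :: "nat \<Rightarrow> 'p mod_ring"
  assume g: "g \<in> annih r (relations r i)"
  have "\<exists>P. degree P \<le> i \<and> cut_poly r i w P \<in> annih r (relations r i) \<and>
      (\<forall>n\<le>r. [n = w] (mod (CARD('p) - 1)) \<longrightarrow> g n = cut_poly r i w P n)" for w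
    using annih_class_cut_poly[OF stable_subspace_relations[OF i_le_r] subset_refl g, of w] by metis
  then obtain P where P: "\<And>w. degree (P w) \<le> i" "\<And>w. cut_poly r i w (P w) \<in> annih r (relations r i)"
    "\<And>w n. n \<le> r \<Longrightarrow> [n = w] (mod (CARD('p) - 1)) \<Longrightarrow> g n = cut_poly r i w (P w) n" by metis
  have "(\<lambda>n. \<Sum>w<CARD('p) - 1. cut_poly r i w (P w) n) \<in> annih r H"
    by (intro annih_sum cls P) simp
  then show "g \<in> annih r H"
  proof (rule annih_cong)
    fix n assume n: "n \<le> r"
    define v where "v = n mod (CARD('p) - 1)"
    have v: "v < CARD('p) - 1" "[n = v] (mod CARD('p) - 1)" unfolding v_def using p3 by (simp_all add: cong_def)
    have z: "cut_poly r i w (P w) n = 0" if w: "w \<in> {..<CARD('p) - 1} - {v}" for w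
    proof -
      have "\<not> [n = w] (mod CARD('p) - 1)"
      proof
        assume "[n = w] (mod CARD('p) - 1)"
        then have "[v = w] (mod CARD('p) - 1)" using v(2) cong_sym cong_trans by blast
        then show False using cong_small_iff[OF v(1), of w] w by auto
      qed
      then show ?thesis by (simp add: cut_poly_def)
    qed
    have "(\<Sum>w<CARD('p) - 1. cut_poly r i w (P w) n)
      = cut_poly r i v (P v) n + (\<Sum>w\<in>{..<CARD('p) - 1} - {v}. cut_poly r i w (P w) n)"
      using v(1) by (intro sum.remove) auto
    also have "\<dots> = g n" using z P(3)[OF n v(2)] by simp
    finally show "(\<Sum>w<CARD('p) - 1. cut_poly r i w (P w) n) = g n" .
  qed
qed

text \<open>
  A stable \<open>H\<close> above the relations, other than \<open>V_r\<close>, has a nonzero annihilator; if this contains the whole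
  annihilator of the relations, then \<open>H\<close> is contained in the relations by double duality.
\<close>

lemma irreducibleI:
  fixes f :: "nat \<Rightarrow> 'p mod_ring"
  assumes f: "f \<in> annih r (relations r i)" "n \<le> r" "f n \<noteq> 0"
    and gen: "\<And>(H :: 'p mod_ring poly poly set) g m. stable_subspace r H \<Longrightarrow> relations r i \<subseteq> H \<Longrightarrow> g \<in> annih r H \<Longrightarrow>
      m \<le> r \<Longrightarrow> g m \<noteq> 0 \<Longrightarrow> annih r (relations r i) \<subseteq> annih r H"
  shows "girreducible Fp GL2 quotient_module"
proof -
  note N = stable_subspace_relations[OF i_le_r, where 'a='p]
  have ne: "relations r i \<noteq> (forms r :: 'p mod_ring poly poly set)"
  proof
    assume "relations r i = (forms r :: 'p mod_ring poly poly set)"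
    then have "bmono (r - n) n \<in> (relations r i :: 'p mod_ring poly poly set)" using f(2) by (simp add: forms_bmono)
    then have "pairing r f (bmono (r - n) n) = 0" using f(1) by (simp add: annih_def)
    then show False using f(2,3) by (simp add: pairing_bmono)
  qed
  have "H = relations r i \<or> H = forms r" if H: "stable_subspace r H" "relations r i \<subseteq> H" for H :: "'p mod_ring poly poly set"
  proof (rule disjCI)
    assume nf: "H \<noteq> forms r"
    have Hf: "H \<subseteq> forms r" using H(1) by (simp add: stable_subspace_def)
    then obtain F where F: "F \<in> forms r" "F \<notin> H" using nf by blast
    from separating_functional[OF H(1) F] obtain g where g: "g \<in> annih r H" "pairing r g F \<noteq> 0" by blast
    have "\<exists>m\<le>r. g m \<noteq> 0"
    proof (rule ccontr)
      assume "\<not> ?thesis"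
      then show False using g(2) by (simp add: pairing_def)
    qed
    then have sub: "annih r (relations r i) \<subseteq> annih r H" using gen[OF H g(1)] by blast
    have "H \<subseteq> relations r i"
    proof
      fix G assume G: "G \<in> H"
      show "G \<in> relations r i"
      proof (rule ccontr)
        assume "G \<notin> relations r i"
        then obtain h where "h \<in> annih r (relations r i)" "pairing r h G \<noteq> 0"
          using separating_functional[OF N] G Hf by blast
        then show False using sub G unfolding annih_def by blast
      qed
    qed
    then show "H = relations r i" using H(2) by blast
  qed
  then show ?thesis unfolding Qmod_eq girreducible_quotient_iff[OF N] using ne by blast
qed

text \<open>
  The classes of \<open>lo\<close> to \<open>hi\<close> are distinct and each carries at most a line of solutions, that of
  \<open>F c\<close>; the other classes carry none.  Let \<open>H\<close> be a stable subspace with a nonzero annihilator.  Some \<open>F c\<close> lies in it.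
  Moving up, so does \<open>F hi\<close>.  Exchanging \<open>X\<close> and \<open>Y\<close> maps class \<open>w\<close> to class \<open>a - w\<close>, hence yields \<open>F lo\<close>, and
  moving up again yields them all.
\<close>

lemma irreducible_by_chain:
  fixes F :: "nat \<Rightarrow> 'p mod_ring poly"
  assumes f: "f \<in> annih r (relations r i)" "n \<le> r" "(f n :: 'p mod_ring) \<noteq> 0"
    and top_poly: "F hi \<noteq> 0" "degree (F hi) \<le> i"
    and range: "lo \<le> hi" "hi - lo < CARD('p) - 1" and sym: "[lo + hi = a] (mod CARD('p) - 1)"
    and one_dim: "\<And>w P. degree P \<le> i \<Longrightarrow> cut_poly r i w P \<in> annih r (relations r i) \<Longrightarrow> P \<noteq> 0 \<Longrightarrow>
      \<exists>c k. lo \<le> c \<and> c \<le> hi \<and> [w = c] (mod CARD('p) - 1) \<and> P = smult k (F c)"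
    and up: "\<And>c. lo \<le> c \<Longrightarrow> c < hi \<Longrightarrow> \<exists>n\<le>r. [n = c + 1] (mod CARD('p) - 1) \<and>
      (\<Sum>m\<le>n. of_nat (n choose m) * cut_poly r i c (F c) m) \<noteq> 0"
  shows "girreducible Fp GL2 quotient_module"
proof (rule irreducibleI[OF f])
  fix H :: "'p mod_ring poly poly set" and g :: "nat \<Rightarrow> 'p mod_ring" and n
  assume H: "stable_subspace r H" "relations r i \<subseteq> H" and g: "g \<in> annih r H" "n \<le> r" "g n \<noteq> 0"
  have uniq: "c = c'" if "lo \<le> c" "c \<le> hi" "lo \<le> c'" "c' \<le> hi" "[c = c'] (mod CARD('p) - 1)" for c c'
  proof -
    have "[lo + (c - lo) = lo + (c' - lo)] (mod CARD('p) - 1)" using that by simp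
    then have "[c - lo = c' - lo] (mod CARD('p) - 1)" by (simp only: cong_add_lcancel_nat)
    moreover have "c - lo < CARD('p) - 1" "c' - lo < CARD('p) - 1" using that range by linarith+
    ultimately have "c - lo = c' - lo" using cong_small_iff by blast
    then show ?thesis using that by linarith
  qed
  have point: "\<exists>c. lo \<le> c \<and> c \<le> hi \<and> [n = c] (mod CARD('p) - 1) \<and> cut_poly r i c (F c) \<in> annih r H"
    if g: "g \<in> annih r H" "n \<le> r" "g n \<noteq> 0" for g n
  proof -
    obtain P where P: "degree P \<le> i" "cut_poly r i n P \<in> annih r H"
      "\<And>m. m \<le> r \<Longrightarrow> [m = n] (mod (CARD('p) - 1)) \<Longrightarrow> g m = cut_poly r i n P m"
      using annih_class_cut_poly[OF H g(1), of n] by metis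
    have nz: "P \<noteq> 0"
    proof
      assume "P = 0"
      then have "cut_poly r i n P n = 0" by (simp add: cut_poly_def)
      then show False using P(3)[OF g(2) cong_refl] g(3) by simp
    qed
    have "cut_poly r i n P \<in> annih r (relations r i)" using P(2) annih_antimono[OF H(2)] by blast
    from one_dim[OF P(1) this nz] obtain c k
      where c: "lo \<le> c" "c \<le> hi" "[n = c] (mod CARD('p) - 1)" "P = smult k (F c)" by blast
    have k: "k \<noteq> 0" using \<open>P \<noteq> 0\<close> c(4) by auto
    have "(\<lambda>m. (1 / k) * cut_poly r i n P m) \<in> annih r H" by (rule annih_scale[OF P(2)])
    also have "(\<lambda>m. (1 / k) * cut_poly r i n P m) = cut_poly r i c (F c)"
      unfolding cut_poly_cong_class[OF c(3)] c(4) cut_poly_smult using k by simp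
    finally show ?thesis using c by blast
  qed
  have step: "cut_poly r i (c + 1) (F (c + 1)) \<in> annih r H" if c: "cut_poly r i c (F c) \<in> annih r H" "lo \<le> c" "c < hi" for c
  proof -
    obtain n where n: "n \<le> r" "[n = c + 1] (mod CARD('p) - 1)"
      "(\<Sum>m\<le>n. of_nat (n choose m) * cut_poly r i c (F c) m) \<noteq> 0" using up[OF c(2,3)] by blast
    from point[OF annih_up[OF H(1) c(1)] n(1,3)] obtain c' where c': "lo \<le> c'" "c' \<le> hi"
      "[n = c'] (mod CARD('p) - 1)" "cut_poly r i c' (F c') \<in> annih r H" by blast
    have "[c + 1 = c'] (mod CARD('p) - 1)" using n(2) c'(3) cong_sym cong_trans by blast
    then have "c + 1 = c'" using uniq[of "c + 1" c'] c c' by linarith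
    then show ?thesis using c'(4) by simp
  qed
  have climb: "cut_poly r i c' (F c') \<in> annih r H" if c: "cut_poly r i c (F c) \<in> annih r H" "lo \<le> c" "c \<le> c'" "c' \<le> hi" for c c'
    using c(3,4)
  proof (induction c' rule: dec_induct)
    case base
    show ?case by (rule c(1))
  next
    case (step m)
    then show ?case using \<open>\<And>c. cut_poly r i c (F c) \<in> annih r H \<Longrightarrow> lo \<le> c \<Longrightarrow> c < hi \<Longrightarrow> cut_poly r i (c + 1) (F (c + 1)) \<in> annih r H\<close>[of m]
      c(2) by simp
  qed
  obtain c where c: "lo \<le> c" "c \<le> hi" "cut_poly r i c (F c) \<in> annih r H" using point[OF g] by blast
  then have top: "cut_poly r i hi (F hi) \<in> annih r H" using climb[OF c(3,1,2)] by simp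
  have bottom: "cut_poly r i lo (F lo) \<in> annih r H"
  proof -
    obtain m where m: "m \<le> r" "cut_poly r i hi (F hi) m \<noteq> 0" using cut_poly_nonzero[OF top_poly(2,1)] by blast
    then have mhi: "[m = hi] (mod CARD('p) - 1)" by (auto simp: cut_poly_def split: if_splits)
    have "cut_poly r i hi (F hi) (r - (r - m)) \<noteq> 0" "r - m \<le> r" using m by simp_all
    from point[OF annih_swap[OF H(1) top] this(2,1)] obtain c' where c': "lo \<le> c'" "c' \<le> hi"
      "[r - m = c'] (mod CARD('p) - 1)" "cut_poly r i c' (F c') \<in> annih r H" by blast
    have "[(r - m) + m = lo + hi] (mod CARD('p) - 1)"
      using cong_trans[OF r_cong cong_sym[OF sym]] m(1) by simp
    from cong_trans[OF cong_sym[OF cong_add[OF cong_refl mhi]] this]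
    have "[(r - m) + hi = lo + hi] (mod CARD('p) - 1)" .
    then have "[r - m = lo] (mod CARD('p) - 1)" by (simp only: cong_add_rcancel_nat)
    then have "[c' = lo] (mod CARD('p) - 1)" by (rule cong_trans[OF cong_sym[OF c'(3)]])
    then have "c' = lo" using uniq[of c' lo] c' range by linarith
    then show ?thesis using c'(4) by simp
  qed
  show "annih r (relations r i) \<subseteq> annih r H"
  proof (rule annih_subset_by_classes[OF H(1)])
    fix w and P :: "'p mod_ring poly"
    assume P: "degree P \<le> i" "cut_poly r i w P \<in> annih r (relations r i)"
    show "cut_poly r i w P \<in> annih r H"
    proof (cases "P = 0")
      case True
      then have "cut_poly r i w P = (\<lambda>n. 0)" by (simp add: cut_poly_def fun_eq_iff)
      then show ?thesis using annih_0 by metis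
    next
      case False
      from one_dim[OF P this] obtain c k
        where c: "lo \<le> c" "c \<le> hi" "[w = c] (mod CARD('p) - 1)" "P = smult k (F c)" by blast
      have "(\<lambda>n. k * cut_poly r i c (F c) n) \<in> annih r H"
        by (rule annih_scale[OF climb[OF bottom order_refl c(1,2)]])
      also have "(\<lambda>n. k * cut_poly r i c (F c) n) = cut_poly r i w P"
        unfolding cut_poly_cong_class[OF c(3)] c(4) cut_poly_smult ..
      finally show ?thesis .
    qed
  qed
qed

end

section \<open>Orthogonality in the last digit\<close>

text \<open>
  Division by a polynomial of exact degree \<open>d\<close>; thus the \<open>binpoly c k\<close> for \<open>k < d\<close> span the polynomials of
  degree below \<open>d\<close>.
\<close>

lemma binpoly_decomposition:
  fixes f :: "'p::prime_card mod_ring poly"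
  assumes d: "d < CARD('p)" and f: "\<And>n. d < n \<Longrightarrow> coeff f n = 0"
  obtains k g where "f = smult k (binpoly c d) + g" "\<And>n. d \<le> n \<Longrightarrow> coeff g n = 0" "k = 0 \<longleftrightarrow> coeff f d = 0"
proof -
  let ?B = "binpoly c d :: 'p mod_ring poly"
  have B: "degree ?B = d" by (rule degree_binpoly[OF d])
  have nz: "coeff ?B d \<noteq> 0"
  proof (cases "d = 0")
    case True then show ?thesis by (simp add: binpoly_def)
  next
    case False
    then have "?B \<noteq> 0" using B by auto
    then show ?thesis using B by (metis leading_coeff_0_iff)
  qed
  show thesis
  proof (rule that)
    show "f = smult (coeff f d / coeff ?B d) ?B + (f - smult (coeff f d / coeff ?B d) ?B)" by simp
    show "coeff (f - smult (coeff f d / coeff ?B d) ?B) n = 0" if "d \<le> n" for n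
    proof (cases "n = d")
      case True then show ?thesis using nz by simp
    next
      case False
      then have "d < n" using that by simp
      then show ?thesis using f B by (simp add: coeff_eq_0)
    qed
    show "coeff f d / coeff ?B d = 0 \<longleftrightarrow> coeff f d = 0" using nz by simp
  qed
qed

lemma linear_on_binpolys:
  fixes L :: "'p::prime_card mod_ring poly \<Rightarrow> 'p mod_ring"
  assumes add: "\<And>f g. L (f + g) = L f + L g" and scale: "\<And>k f. L (smult k f) = k * L f"
  shows "\<lbrakk>d \<le> CARD('p); \<And>k. k < d \<Longrightarrow> L (binpoly c k) = 0; \<And>n. d \<le> n \<Longrightarrow> coeff f n = 0\<rbrakk> \<Longrightarrow> L f = 0"
proof (induction d arbitrary: f)
  case 0
  then have "f = 0" by (simp add: poly_eq_iff)
  then show ?case using scale[of 0 f] by simp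
next
  case (Suc d)
  have "d < CARD('p)" using Suc.prems(1) by simp
  moreover have "coeff f n = 0" if "d < n" for n using Suc.prems(3) that by simp
  ultimately obtain k g where f: "f = smult k (binpoly c d) + g" "\<And>n. d \<le> n \<Longrightarrow> coeff g n = 0"
    using binpoly_decomposition[of d f c] by metis
  have "L g = 0"
  proof (rule Suc.IH)
    show "d \<le> CARD('p)" using Suc.prems(1) by simp
    show "L (binpoly c k) = 0" if "k < d" for k by (rule Suc.prems(2)) (use that in simp)
  qed (rule f(2))
  then show ?case unfolding f(1) add scale using Suc.prems(2)[OF lessI] by simp
qed

lemma linear_on_binpolys_top:
  fixes L :: "'p::prime_card mod_ring poly \<Rightarrow> 'p mod_ring"
  assumes add: "\<And>f g. L (f + g) = L f + L g" and scale: "\<And>k f. L (smult k f) = k * L f"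
    and d: "d < CARD('p)" and low: "\<And>k. k < d \<Longrightarrow> L (binpoly c k) = 0" and top: "L (binpoly c d) \<noteq> 0"
    and f: "degree f = d" "f \<noteq> 0"
  shows "L f \<noteq> 0"
proof -
  obtain k g where k: "f = smult k (binpoly c d) + g" "\<And>n. d \<le> n \<Longrightarrow> coeff g n = 0" "k = 0 \<longleftrightarrow> coeff f d = 0"
    using binpoly_decomposition[OF d coeff_eq_0, of f c] f(1) by metis
  have "k \<noteq> 0" using k(3) f by auto
  moreover have "L g = 0" by (rule linear_on_binpolys[OF add scale _ low k(2)]) (use d in simp_all)
  ultimately show ?thesis unfolding k(1) add scale using top by simp
qed

context quotient_parameters begin

text \<open>
  The weight on last digits obtained from the row \<open>j = 0\<close>.
\<close>

definition digit_functional :: "nat \<Rightarrow> 'p mod_ring poly \<Rightarrow> 'p mod_ring" where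
  "digit_functional w f = (\<Sum>c\<le>r0. of_nat (r0 choose c) * digit_sum 0 w c * poly f (of_nat c))"

lemma digit_functional_add: "digit_functional w (f + g) = digit_functional w f + digit_functional w g"
  by (simp add: digit_functional_def algebra_simps sum.distrib)

lemma digit_functional_smult: "digit_functional w (smult k f) = k * digit_functional w f"
  by (simp add: digit_functional_def sum_distrib_left algebra_simps)

text \<open>
  The rows \<open>j \<le> r0\<close> only differ in the last digit \<open>r0 - j\<close> of \<open>r - j\<close>, and
  \<open>(r0 choose k) (r0-k choose c) = (r0 choose c) (r0-c choose k)\<close>.  So the \<open>k\<close>-th row of \<open>P\<close> is the row
  \<open>0\<close> of \<open>P\<close> times the polynomial \<open>c \<mapsto> (r0-c choose k)\<close> of degree \<open>k\<close>.
\<close>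

lemma digit_functional_binpoly:
  fixes P :: "'p mod_ring poly"
  assumes k: "k \<le> r0"
  shows "digit_functional w (P * binpoly (of_nat r0) k)
    = of_nat (r0 choose k) * (\<Sum>n\<le>r - k. of_nat ((r - k) choose n) * cut_poly r i w P n)"
proof -
  have kp: "k < CARD('p)" using k r_digits(2) by linarith
  have ds: "digit_sum k w c = digit_sum 0 w c" for c
    unfolding digit_sum_def using r_minus_low(2)[OF k] by (simp add: rq)
  have nat_id: "(r0 choose c) * ((r0 - c) choose k) = (r0 choose k) * ((r0 - k) choose c)" if "c \<le> r0" for c
  proof (cases "c + k \<le> r0")
    case True
    have "(r0 choose (c + k)) * ((c + k) choose c) = (r0 choose c) * ((r0 - c) choose (c + k - c))"
      using True by (intro choose_mult) auto
    moreover have "(r0 choose (c + k)) * ((c + k) choose k) = (r0 choose k) * ((r0 - k) choose (c + k - k))"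
      using True by (intro choose_mult) auto
    moreover have "(c + k) choose c = (c + k) choose k" using binomial_symmetric[of c "c + k"] by simp
    ultimately show ?thesis by simp
  next
    case False
    then have "r0 - c < k" "r0 - k < c" using that k by linarith+
    then show ?thesis by (simp add: binomial_eq_0)
  qed
  have "digit_functional w (P * binpoly (of_nat r0) k)
      = (\<Sum>c\<le>r0. of_nat (r0 choose k) * (of_nat ((r0 - k) choose c) * (poly P (of_nat c) * digit_sum 0 w c)))"
    unfolding digit_functional_def
  proof (rule sum.cong[OF refl])
    fix c assume "c \<in> {..r0}"
    then have c: "c \<le> r0" by simp
    have "poly (binpoly (of_nat r0) k) (of_nat c) = (of_nat ((r0 - c) choose k) :: 'p mod_ring)"
      by (rule poly_binpoly[OF kp]) (simp add: of_nat_diff c)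
    moreover have "(of_nat (r0 choose c) * of_nat ((r0 - c) choose k) :: 'p mod_ring)
        = of_nat (r0 choose k) * of_nat ((r0 - k) choose c)"
      unfolding of_nat_mult[symmetric] nat_id[OF c] ..
    ultimately show "of_nat (r0 choose c) * digit_sum 0 w c * poly (P * binpoly (of_nat r0) k) (of_nat c)
      = of_nat (r0 choose k) * (of_nat ((r0 - k) choose c) * (poly P (of_nat c) * digit_sum 0 w c))"
      by (simp add: mult_ac)
  qed
  also have "\<dots> = of_nat (r0 choose k) *
      (\<Sum>c\<le>r0. of_nat ((r0 - k) choose c) * (poly P (of_nat c) * digit_sum 0 w c))"
    by (simp add: sum_distrib_left)
  also have "(\<Sum>c\<le>r0. of_nat ((r0 - k) choose c) * (poly P (of_nat c) * digit_sum 0 w c))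
      = (\<Sum>c<CARD('p). of_nat ((r0 - k) choose c) * (poly P (of_nat c) * digit_sum 0 w c))"
    by (rule sum.mono_neutral_left) (use r_digits(2) in \<open>auto simp: binomial_eq_0\<close>)
  finally show ?thesis unfolding row_digits r_minus_low(1)[OF k] ds .
qed

text \<open>
  The polynomials \<open>binpoly r0 k\<close>, \<open>k \<le> i\<close>, span the polynomials of degree at most \<open>i\<close>.
\<close>

lemma digit_orthogonality:
  fixes P R :: "'p mod_ring poly"
  assumes ir0: "i \<le> r0" and P: "cut_poly r i w P \<in> annih r (relations r i)" and R: "degree R \<le> i"
  shows "digit_functional w (P * R) = 0"
proof (rule linear_on_binpolys[where L = "\<lambda>f. digit_functional w (P * f)" and d = "i + 1" and c = "of_nat r0"])
  show "digit_functional w (P * (f + g)) = digit_functional w (P * f) + digit_functional w (P * g)" for f g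
    by (simp add: distrib_left digit_functional_add)
  show "digit_functional w (P * smult k f) = k * digit_functional w (P * f)" for k f
    by (simp add: digit_functional_smult)
  show "i + 1 \<le> CARD('p)" using i_less_p by simp
  show "digit_functional w (P * binpoly (of_nat r0) k) = 0" if "k < i + 1" for k
    using digit_functional_binpoly[of k w P] cut_poly_rows[OF P, of k] that ir0 by simp
  show "coeff R n = 0" if "i + 1 \<le> n" for n using R that by (simp add: coeff_eq_0)
qed

text \<open>
  If the weight is supported on at most \<open>i + 1\<close> digits, some \<open>R\<close> of degree at most \<open>i\<close> vanishes on all of the
  support except \<open>c\<close>, and orthogonality to \<open>R\<close> isolates the value of \<open>P\<close> at \<open>c\<close>.
\<close>

lemma vanish_on_support:
  fixes P :: "'p mod_ring poly"
  assumes ir0: "i \<le> r0" and P: "cut_poly r i w P \<in> annih r (relations r i)"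
    and S: "S \<subseteq> {..r0}" "card S \<le> i + 1" "\<And>c. c \<le> r0 \<Longrightarrow> c \<notin> S \<Longrightarrow> digit_sum 0 w c = (0 :: 'p mod_ring)"
    and c: "c \<le> r0" "digit_sum 0 w c \<noteq> (0 :: 'p mod_ring)"
  shows "poly P (of_nat c) = 0"
proof -
  have fin: "finite S" using S(1) finite_subset by blast
  have cS: "c \<in> S" using S(3) c by blast
  define R :: "'p mod_ring poly" where "R = (\<Prod>x\<in>S - {c}. [:- of_nat x, 1:])"
  have polyR: "poly R y = (\<Prod>x\<in>S - {c}. y - of_nat x)" for y by (simp add: R_def poly_prod)
  have "degree R \<le> (\<Sum>x\<in>S - {c}. degree [:- of_nat x, 1 :: 'p mod_ring:])"
    unfolding R_def using degree_prod_sum_le[of "S - {c}" "\<lambda>x. [:- of_nat x, 1 :: 'p mod_ring:]"] fin by (simp add: o_def)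
  also have "\<dots> = card S - 1" using fin cS by simp
  finally have dR: "degree R \<le> i" using S(2) by linarith
  have "0 = digit_functional w (P * R)" using digit_orthogonality[OF ir0 P dR] by simp
  also have "\<dots> = of_nat (r0 choose c) * digit_sum 0 w c * poly (P * R) (of_nat c)
      + (\<Sum>x\<in>{..r0} - {c}. of_nat (r0 choose x) * digit_sum 0 w x * poly (P * R) (of_nat x))"
    unfolding digit_functional_def by (rule sum.remove) (use c in auto)
  also have "(\<Sum>x\<in>{..r0} - {c}. of_nat (r0 choose x) * digit_sum 0 w x * poly (P * R) (of_nat x)) = 0"
  proof (rule sum.neutral, rule ballI)
    fix x assume x: "x \<in> {..r0} - {c}"
    show "of_nat (r0 choose x) * digit_sum 0 w x * poly (P * R) (of_nat x) = 0"
    proof (cases "x \<in> S")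
      case True
      then have "poly R (of_nat x) = 0" unfolding polyR using x fin by (intro prod_zero) auto
      then show ?thesis by simp
    next
      case False
      then show ?thesis using S(3)[of x] x by simp
    qed
  qed
  finally have "of_nat (r0 choose c) * digit_sum 0 w c * (poly P (of_nat c) * poly R (of_nat c)) = 0" by simp
  moreover have "(of_nat (r0 choose c) :: 'p mod_ring) \<noteq> 0"
    by (rule of_nat_binomial_neq_0) (use c r_digits(2) in auto)
  moreover have "poly R (of_nat c) \<noteq> 0"
  proof
    assume "poly R (of_nat c) = 0"
    then obtain x where x: "x \<in> S - {c}" "(of_nat c :: 'p mod_ring) = of_nat x"
      unfolding polyR using fin by auto
    then have "x < CARD('p)" "c < CARD('p)" using S(1) c(1) r_digits(2) by auto
    then show False using x unfolding of_nat_mod_ring_eq_iff by simp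
  qed
  ultimately show ?thesis using c(2) by simp
qed

text \<open>
  If the weight kills degrees below \<open>a\<close> and not degree \<open>a\<close>, then \<open>P\<close> cannot be orthogonal to a
  polynomial of the complementary degree \<open>a - degree P\<close>.
\<close>

lemma degree_from_constant_rows:
  fixes P :: "'p mod_ring poly"
  assumes ar0: "a \<le> r0" and ia: "i \<le> a"
    and low: "\<And>j. j < a \<Longrightarrow> (\<Sum>n\<le>r - j. of_nat ((r - j) choose n) * cut_poly r i w (1 :: 'p mod_ring poly) n) = 0"
    and top: "(\<Sum>n\<le>r - a. of_nat ((r - a) choose n) * cut_poly r i w (1 :: 'p mod_ring poly) n) \<noteq> 0"
    and P: "cut_poly r i w P \<in> annih r (relations r i)" "degree P \<le> i" "P \<noteq> 0"
  shows "i + degree P < a"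
proof (rule ccontr)
  assume n: "\<not> ?thesis"
  define R :: "'p mod_ring poly" where "R = monom 1 (a - degree P)"
  have R: "degree R = a - degree P" "R \<noteq> 0" by (simp_all add: R_def degree_monom_eq)
  have aP: "a < CARD('p)" using ar0 r_digits(2) by linarith
  have "digit_functional w (P * R) = 0"
    by (rule digit_orthogonality[OF _ P(1)]) (use n R ar0 ia in linarith)+
  moreover have "digit_functional w (P * R) \<noteq> 0"
  proof (rule linear_on_binpolys_top[where c = "of_nat r0" and d = a, OF digit_functional_add digit_functional_smult aP])
    show "digit_functional w (binpoly (of_nat r0) k) = 0" if "k < a" for k
      using digit_functional_binpoly[of k w 1] low[OF that] that ar0 by simp
    have "(of_nat (r0 choose a) :: 'p mod_ring) \<noteq> 0"
      by (rule of_nat_binomial_neq_0) (use ar0 r_digits(2) in auto)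
    then show "digit_functional w (binpoly (of_nat r0) a) \<noteq> 0"
      using digit_functional_binpoly[OF ar0, of w 1] top by simp
    show "degree (P * R) = a" using P(2,3) R ia by (simp add: degree_mult_eq)
    show "P * R \<noteq> 0" using P(3) R(2) by simp
  qed
  ultimately show False by simp
qed

text \<open>
  The number \<open>p - 1 + a - r0\<close> is the representative of \<open>rq\<close> modulo \<open>p - 1\<close> for which class sums
  become single binomial coefficients.
\<close>

lemma quotient_digit_cong:
  assumes "a \<le> r0"
  shows "[rq = CARD('p) - 1 + a - r0] (mod CARD('p) - 1)"
    "a \<le> CARD('p) - 1 + a - r0" "CARD('p) - 1 + a - r0 < CARD('p)"
proof -
  have r0p: "r0 \<le> CARD('p) - 1" using r_digits(2) by linarith
  then have "(CARD('p) - 1 + a - r0) + r0 = a + (CARD('p) - 1)" by linarith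
  then have "[(CARD('p) - 1 + a - r0) + r0 = a] (mod CARD('p) - 1)" by (rule cong_add_period)
  from cong_trans[OF rq_cong cong_sym[OF this]] show "[rq = CARD('p) - 1 + a - r0] (mod CARD('p) - 1)"
    by (simp only: cong_add_rcancel_nat)
  show "a \<le> CARD('p) - 1 + a - r0" using r0p by linarith
  show "CARD('p) - 1 + a - r0 < CARD('p)" using assms p3 by linarith
qed

lemma digit_sum_0_eval:
  assumes c: "c \<le> r0" and v: "[c + v = w] (mod (CARD('p) - 1))"
  shows "digit_sum 0 w c = (bsum rq v
    - (if [v = 0] (mod (CARD('p) - 1)) \<and> c \<le> i then 1 else 0)
    - (if [rq = v] (mod (CARD('p) - 1)) \<and> r0 \<le> c + i then 1 else 0) :: 'p mod_ring)"
proof -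
  have "r \<le> c + CARD('p) * rq + i \<longleftrightarrow> r0 \<le> c + i" using r_digits(1) by linarith
  then show ?thesis using digit_sum_eval[of 0 c v w] r_minus_low[of 0] c v by simp
qed

text \<open>
  With \<open>b = p - 1 + a - r0\<close>, the weight at \<open>c > w\<close> is \<open>(b choose v)\<close> for \<open>v = p - 1 - (c - w)\<close>, up
  to end terms.  In the given range \<open>v \<ge> b\<close>, and the value \<open>1\<close> for \<open>v = b\<close> is removed as the upper end term; at
  \<open>c = w\<close> both end terms are removed.
\<close>

lemma digit_sum_0_zero:
  assumes ar0: "a \<le> r0" and w: "w \<le> a" "w \<le> i" "a \<le> w + i" and c: "w \<le> c" "c \<le> r0 - a + w"
  shows "digit_sum 0 w c = (0 :: 'p mod_ring)"
proof -
  define b where "b = CARD('p) - 1 + a - r0"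
  have b: "[rq = b] (mod CARD('p) - 1)" "a \<le> b" "b < CARD('p)" unfolding b_def using quotient_digit_cong[OF ar0] by auto
  have cr: "c \<le> r0" using c w ar0 by linarith
  have r0p: "r0 \<le> CARD('p) - 1" using r_digits(2) by linarith
  have rq1: "1 \<le> rq" using rq_ge by linarith
  show ?thesis
  proof (cases "c = w")
    case True
    have z: "bsum rq 0 = (1 + (if [rq = 0] (mod CARD('p) - 1) then 1 else 0) :: 'p mod_ring)" by (rule bsum_zero_value[OF rq1])
    have e: "r0 \<le> c + i" if r: "[rq = 0] (mod CARD('p) - 1)"
    proof -
      have "[b = 0] (mod CARD('p) - 1)" using cong_trans[OF cong_sym[OF b(1)] r] .
      then have "(CARD('p) - 1) dvd b" by (simp add: cong_0_iff)
      then have "CARD('p) - 1 \<le> b" by (rule dvd_imp_le) (use b(2) a1 in linarith)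
      then have "r0 \<le> a" unfolding b_def using ar0 r0p by linarith
      then show ?thesis using w True by linarith
    qed
    have cv: "[c + 0 = w] (mod CARD('p) - 1)" using True by simp
    have ci: "c \<le> i" using True w by simp
    show ?thesis
    proof (cases "[rq = 0] (mod CARD('p) - 1)")
      case True
      then show ?thesis unfolding digit_sum_0_eval[OF cr cv] z using e ci by simp
    next
      case False
      then show ?thesis unfolding digit_sum_0_eval[OF cr cv] z using ci by simp
    qed
  next
    case False
    define v where "v = CARD('p) - 1 - (c - w)"
    have v: "b \<le> v" "0 < v" "v < CARD('p) - 1" unfolding v_def b_def using False c ar0 r0p a1 by linarith+
    have "c + v = w + (CARD('p) - 1)" unfolding v_def using c r0p ar0 by linarith
    then have cv: "[c + v = w] (mod CARD('p) - 1)" by (rule cong_add_period)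
    have bs: "bsum rq v = (of_nat (b choose v) :: 'p mod_ring)"
      by (rule bsum_value[OF rq1 _ b(3,1) v(2,3)]) (use b a1 in linarith)
    have v0: "\<not> [v = 0] (mod CARD('p) - 1)" using v cong_small_iff[of v 0] by simp
    have eq: "[rq = v] (mod CARD('p) - 1) \<longleftrightarrow> v = b"
    proof
      assume "[rq = v] (mod CARD('p) - 1)"
      then have "[b = v] (mod CARD('p) - 1)" by (rule cong_trans[OF cong_sym[OF b(1)]])
      moreover have "b < CARD('p) - 1" using v by linarith
      ultimately show "v = b" using cong_small_iff[of b v] v by simp
    qed (use b in simp)
    have e: "r0 \<le> c + i" if "v = b"
    proof -
      have "c = r0 - a + w" using that c r0p ar0 unfolding v_def b_def by linarith
      then show ?thesis using w ar0 by linarith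
    qed
    show ?thesis
    proof (cases "v = b")
      case True
      then show ?thesis unfolding digit_sum_0_eval[OF cr cv] bs eq using v0 e by simp
    next
      case False
      then have "b < v" using v by linarith
      then show ?thesis unfolding digit_sum_0_eval[OF cr cv] bs eq using v0 False by (simp add: binomial_eq_0)
    qed
  qed
qed

text \<open>
  To the left of \<open>w\<close> the weight is \<open>(b choose w-c)\<close>, to the right of \<open>r0 - a + w\<close> it is
  \<open>(b choose p-1-(c-w))\<close> with \<open>b = p - 1 + a - r0\<close>, in both cases with a lower index between \<open>1\<close> and \<open>b\<close> and without end
  terms.  The pair \<open>w = 0\<close>, \<open>c = p - 1\<close> is exceptional, as \<open>c\<close> then lies in the class of \<open>w\<close>.
\<close>

lemma digit_sum_0_nonzero:
  assumes ar0: "a \<le> r0" and w: "w \<le> a" "w < CARD('p) - 1" and ia: "i \<le> a"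
    and c: "c \<le> r0" "c < w \<or> r0 - a + w < c" and ex: "\<not> (w = 0 \<and> c = CARD('p) - 1 \<and> i = CARD('p) - 1)"
  shows "digit_sum 0 w c \<noteq> (0 :: 'p mod_ring)"
proof -
  define b where "b = CARD('p) - 1 + a - r0"
  have b: "[rq = b] (mod CARD('p) - 1)" "a \<le> b" "b < CARD('p)" unfolding b_def using quotient_digit_cong[OF ar0] by auto
  have r0p: "r0 \<le> CARD('p) - 1" using r_digits(2) by linarith
  have rq1: "1 \<le> rq" using rq_ge by linarith
  have interior: "digit_sum 0 w c \<noteq> (0 :: 'p mod_ring)"
    if v: "0 < v" "v < CARD('p) - 1" "v \<le> b" "v \<noteq> b \<or> c + i < r0" and cv: "[c + v = w] (mod CARD('p) - 1)" for v
  proof -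
    have bs: "bsum rq v = (of_nat (b choose v) :: 'p mod_ring)"
      by (rule bsum_value[OF rq1 _ b(3,1) v(1,2)]) (use b a1 in linarith)
    have v0: "\<not> [v = 0] (mod CARD('p) - 1)" using v cong_small_iff[of v 0] by simp
    have e: "\<not> ([rq = v] (mod CARD('p) - 1) \<and> r0 \<le> c + i)"
    proof
      assume h: "[rq = v] (mod CARD('p) - 1) \<and> r0 \<le> c + i"
      then have bv: "[b = v] (mod CARD('p) - 1)" using cong_trans[OF cong_sym[OF b(1)]] by blast
      have "b < CARD('p) - 1"
      proof (rule ccontr)
        assume "\<not> ?thesis"
        then have "b = 0 + (CARD('p) - 1)" using b(3) by linarith
        then have "[b = 0] (mod CARD('p) - 1)" by (rule cong_add_period)
        then have "[v = 0] (mod CARD('p) - 1)" using cong_trans[OF cong_sym[OF bv]] by blast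
        then show False using v0 by simp
      qed
      then have "v = b" using cong_small_iff[of b v] v(2) bv by simp
      then show False using v(4) h by linarith
    qed
    have "(of_nat (b choose v) :: 'p mod_ring) \<noteq> 0" by (rule of_nat_binomial_neq_0[OF b(3) v(3)])
    then show ?thesis unfolding digit_sum_0_eval[OF c(1) cv] bs if_not_P[OF e] using v0 by simp
  qed
  consider "c < w" | "r0 - a + w < c" "c - w < CARD('p) - 1" | "w = 0" "c = CARD('p) - 1" "i < CARD('p) - 1"
    using c r0p ex ip by linarith
  then show ?thesis
  proof cases
    case 1
    show ?thesis
    proof (rule interior[of "w - c"])
      show "0 < w - c" "w - c < CARD('p) - 1" "w - c \<le> b" using 1 w b by linarith+
      show "[c + (w - c) = w] (mod CARD('p) - 1)" using 1 by simp
      show "w - c \<noteq> b \<or> c + i < r0"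
      proof (cases "w - c = b")
        case True
        then have "b = a" "c = 0" "w = a" using w b(2) 1 by linarith+
        then have "r0 = CARD('p) - 1" unfolding b_def using r0p by linarith
        then show ?thesis using ia \<open>c = 0\<close> \<open>w = a\<close> w by linarith
      qed simp
    qed
  next
    case 2
    have e: "c + (CARD('p) - 1 - (c - w)) = w + (CARD('p) - 1)" using 2 by linarith
    show ?thesis
      by (rule interior[of "CARD('p) - 1 - (c - w)", OF _ _ _ _ cong_add_period[OF e]])
        (use 2 ar0 r0p in \<open>unfold b_def, linarith+\<close>)
  next
    case 3
    have cv: "[c + 0 = w] (mod CARD('p) - 1)" unfolding add_0_right by (rule cong_add_period) (use 3 in linarith)
    have "r0 \<le> c + i" using 3 r0p by linarith
    then show ?thesis unfolding digit_sum_0_eval[OF c(1) cv] bsum_zero_value[OF rq1] using 3 by simp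
  qed
qed

text \<open>
  The support of the weight has exactly \<open>w + (a - w) = a \<le> i + 1\<close> digits.
\<close>

lemma vanish_outside_interval:
  fixes P :: "'p mod_ring poly"
  assumes ar0: "a \<le> r0" and ia: "i \<le> a" and w: "w \<le> a" "w < CARD('p) - 1" "w \<le> i" "a \<le> w + i"
    and ai: "a \<le> i + 1" and iP: "i < CARD('p) - 1"
    and P: "cut_poly r i w P \<in> annih r (relations r i)"
    and c: "c \<le> r0" "c < w \<or> r0 - a + w < c"
  shows "poly P (of_nat c) = 0"
proof (rule vanish_on_support[where S = "{..<w} \<union> {r0 - a + w<..r0}", OF _ P _ _ _ c(1)])
  show "i \<le> r0" using ia ar0 by linarith
  show "{..<w} \<union> {r0 - a + w<..r0} \<subseteq> {..r0}" using w ar0 by auto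
  have "card ({..<w} \<union> {r0 - a + w<..r0}) \<le> card {..<w} + card {r0 - a + w<..r0}" by (rule card_Un_le)
  also have "\<dots> = a" using w ar0 by simp
  finally show "card ({..<w} \<union> {r0 - a + w<..r0}) \<le> i + 1" using ai by linarith
  show "digit_sum 0 w x = (0 :: 'p mod_ring)" if "x \<le> r0" "x \<notin> {..<w} \<union> {r0 - a + w<..r0}" for x
    by (rule digit_sum_0_zero[OF ar0 w(1,3,4)]) (use that in auto)
  show "digit_sum 0 w c \<noteq> (0 :: 'p mod_ring)"
    by (rule digit_sum_0_nonzero[OF ar0 w(1,2) ia c]) (use iP in simp)
qed

end

lemma card_of_nat_image:
  assumes "S \<subseteq> {..<CARD('p::prime_card)}"
  shows "card ((of_nat :: nat \<Rightarrow> 'p mod_ring) ` S) = card S"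
proof (rule card_image, rule inj_onI)
  fix x y assume "x \<in> S" "y \<in> S" and e: "(of_nat x :: 'p mod_ring) = of_nat y"
  then have "x < CARD('p)" "y < CARD('p)" using assms by auto
  then show "x = y" using e unfolding of_nat_mod_ring_eq_iff by simp
qed

lemma poly_eq_on_digits:
  fixes P Q :: "'p::prime_card mod_ring poly"
  assumes "degree P < CARD('p)" "degree Q < CARD('p)"
    and "\<And>c. c < CARD('p) \<Longrightarrow> poly P (of_nat c) = poly Q (of_nat c)"
  shows "P = Q"
proof (rule poly_eqI_degree[where A = "of_nat ` {..<CARD('p)}"])
  show "poly P x = poly Q x" if "x \<in> of_nat ` {..<CARD('p)}" for x using that assms(3) by auto
qed (use assms card_of_nat_image[of "{..<CARD('p)}", where 'p='p] in simp_all)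

lemma root_product:
  fixes f :: "nat \<Rightarrow> 'a::field"
  assumes "finite S"
  shows "degree (\<Prod>x\<in>S. [:- f x, 1:]) = card S \<and> lead_coeff (\<Prod>x\<in>S. [:- f x, 1:]) = 1"
  using assms
proof (induction S rule: finite_induct)
  case (insert x S)
  let ?Q = "\<Prod>x\<in>S. [:- f x, 1:]"
  have nz: "?Q \<noteq> 0" using insert.hyps by simp
  have p: "(\<Prod>x\<in>insert x S. [:- f x, 1:]) = [:- f x, 1:] * ?Q" using insert.hyps by simp
  have "degree ([:- f x, 1:] * ?Q) = degree [:- f x, 1:] + degree ?Q" by (rule degree_mult_eq) (use nz in simp_all)
  moreover have "lead_coeff ([:- f x, 1:] * ?Q) = lead_coeff [:- f x, 1:] * lead_coeff ?Q" by (rule lead_coeff_mult)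
  moreover have "degree ?Q = card S" "lead_coeff ?Q = 1" using insert.IH by blast+
  ultimately show ?case unfolding p using insert.hyps by (simp del: mult_pCons_left)
qed simp

context quotient_parameters begin

section \<open>Moving to the next residue class\<close>

text \<open>
  In base \<open>p\<close>, with \<open>n = n0 + p n1\<close>, Lucas's theorem only admits \<open>m\<close> whose digits lie below those of \<open>n\<close>.  The
  value at \<open>n\<close> of the image under the upper triangular matrix is nonzero as soon as exactly one such \<open>m\<close> is in the support of the
  given function.
\<close>

lemma up_step:
  fixes P :: "'p mod_ring poly"
  assumes n: "n0 < CARD('p)" "n1 < CARD('p)" "n0 + CARD('p) * n1 \<le> r" "[n0 + n1 = v] (mod CARD('p) - 1)"
    and m: "m0 \<le> n0" "m1 \<le> n1" "i < m0 + CARD('p) * m1" "m0 + CARD('p) * m1 + i < r"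
      "[m0 + m1 = w] (mod CARD('p) - 1)" "poly P (of_nat m0) \<noteq> 0"
    and uniq: "\<And>x0 x1. x0 \<le> n0 \<Longrightarrow> x1 \<le> n1 \<Longrightarrow> i < x0 + CARD('p) * x1 \<Longrightarrow> [x0 + x1 = w] (mod CARD('p) - 1) \<Longrightarrow>
      poly P (of_nat x0) \<noteq> 0 \<Longrightarrow> x0 = m0 \<and> x1 = m1"
  shows "\<exists>n\<le>r. [n = v] (mod CARD('p) - 1) \<and> (\<Sum>m\<le>n. of_nat (n choose m) * cut_poly r i w P m) \<noteq> 0"
proof -
  define N where "N = n0 + CARD('p) * n1"
  define M where "M = m0 + CARD('p) * m1"
  have dsum: "[x = x mod CARD('p) + x div CARD('p)] (mod CARD('p) - 1)" for x
  proof -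
    have "CARD('p) * (x div CARD('p)) = x div CARD('p) + (CARD('p) - 1) * (x div CARD('p))"
      using p3 by (cases "CARD('p)") auto
    then have "x = x mod CARD('p) + x div CARD('p) + (CARD('p) - 1) * (x div CARD('p))"
      using mod_mult_div_eq[of x "CARD('p)"] by linarith
    then show ?thesis by (metis cong_def mod_mult_self2)
  qed
  have Nd: "N mod CARD('p) = n0" "N div CARD('p) = n1" unfolding N_def using n by simp_all
  have m0p: "m0 < CARD('p)" using m n by linarith
  have Md: "M mod CARD('p) = m0" "M div CARD('p) = m1" unfolding M_def using m0p by simp_all
  have MN: "M \<le> N" unfolding M_def N_def using m by (intro add_mono mult_le_mono) auto
  have pM: "poly P (of_nat x) = poly P (of_nat (x mod CARD('p)))" for x
    using of_nat_mod_ring_eq_iff[of x "x mod CARD('p)", where 'p='p] by simp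
  have "(\<Sum>m\<le>N. of_nat (N choose m) * cut_poly r i w P m)
      = of_nat (N choose M) * cut_poly r i w P M + (\<Sum>m\<in>{..N} - {M}. of_nat (N choose m) * cut_poly r i w P m)"
    by (rule sum.remove) (use MN in auto)
  also have "(\<Sum>m\<in>{..N} - {M}. of_nat (N choose m) * cut_poly r i w P m) = 0"
  proof (rule sum.neutral, rule ballI, rule ccontr)
    fix m assume mN: "m \<in> {..N} - {M}" and nz: "of_nat (N choose m) * cut_poly r i w P m \<noteq> 0"
    have b: "(of_nat (N choose m) :: 'p mod_ring) \<noteq> 0" and c: "cut_poly r i w P m \<noteq> 0" using nz by auto
    have x0: "m mod CARD('p) \<le> n0"
    proof (rule ccontr)
      assume "\<not> ?thesis"
      then show False using b unfolding lucas_theorem[of N m] Nd by (simp add: binomial_eq_0)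
    qed
    have x1: "m div CARD('p) \<le> n1"
    proof (rule ccontr)
      assume "\<not> ?thesis"
      then show False using b unfolding lucas_theorem[of N m] Nd by (simp add: binomial_eq_0)
    qed
    have im: "i < m" "[m = w] (mod CARD('p) - 1)" "poly P (of_nat m) \<noteq> 0"
      using c unfolding cut_poly_def by (auto split: if_splits)
    have "m mod CARD('p) = m0 \<and> m div CARD('p) = m1"
    proof (rule uniq[OF x0 x1])
      show "i < m mod CARD('p) + CARD('p) * (m div CARD('p))" using im(1) by simp
      show "[m mod CARD('p) + m div CARD('p) = w] (mod CARD('p) - 1)"
        by (rule cong_trans[OF cong_sym[OF dsum] im(2)])
      show "poly P (of_nat (m mod CARD('p))) \<noteq> 0" using im(3) pM[of m] by simp
    qed
    then have "m = M" unfolding M_def using mod_mult_div_eq[of m "CARD('p)"] by simp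
    then show False using mN by simp
  qed
  finally have S: "(\<Sum>m\<le>N. of_nat (N choose m) * cut_poly r i w P m) = of_nat (N choose M) * cut_poly r i w P M" by simp
  have "(of_nat (N choose M) :: 'p mod_ring) \<noteq> 0"
    unfolding lucas_theorem[of N M] Nd Md using of_nat_binomial_neq_0[OF n(1) m(1)]
      of_nat_binomial_neq_0[OF n(2) m(2)] by simp
  moreover have "cut_poly r i w P M \<noteq> 0"
  proof -
    have "i < M \<and> M + i < r \<and> [M = w] (mod CARD('p) - 1)"
      using m(3,4) cong_trans[OF dsum[of M, unfolded Md] m(5)] unfolding M_def by blast
    moreover have "poly P (of_nat M) \<noteq> 0" using pM[of M] m(6) unfolding Md by simp
    ultimately show ?thesis unfolding cut_poly_def by simp
  qed
  moreover have "[N = v] (mod CARD('p) - 1)" using cong_trans[OF dsum[of N, unfolded Nd] n(4)] .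
  ultimately show ?thesis using n(3) S unfolding N_def by (metis mult_eq_0_iff)
qed

lemma low_edge_sum:
  assumes "i < w" "w \<le> CARD('p) - 1"
  shows "(\<Sum>n\<le>i. if [n = w] (mod (CARD('p) - 1)) then of_nat (N choose n) else 0)
    = (if w = CARD('p) - 1 then 1 else 0 :: 'p mod_ring)"
proof -
  have e: "[n = w] (mod (CARD('p) - 1)) \<longleftrightarrow> n = 0 \<and> w = CARD('p) - 1" if n: "n \<le> i" for n
  proof (cases "w = CARD('p) - 1")
    case True
    have w0: "[w = 0] (mod (CARD('p) - 1))" unfolding True by (simp add: cong_def)
    have "[n = 0] (mod (CARD('p) - 1)) \<longleftrightarrow> n = 0" by (rule cong_small_iff) (use n assms in linarith)+
    then show ?thesis using True w0 cong_trans cong_sym by blast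
  next
    case False
    have "[n = w] (mod (CARD('p) - 1)) \<longleftrightarrow> n = w" by (rule cong_small_iff) (use n assms False in linarith)+
    then show ?thesis using False n assms by simp
  qed
  have "(\<Sum>n\<le>i. if [n = w] (mod (CARD('p) - 1)) then of_nat (N choose n) else 0)
      = (\<Sum>n\<le>i. if n = 0 then (if w = CARD('p) - 1 then 1 else 0) else 0 :: 'p mod_ring)"
    by (rule sum.cong[OF refl]) (use e in simp)
  also have "\<dots> = (if w = CARD('p) - 1 then 1 else 0)" by (simp add: sum.delta)
  finally show ?thesis .
qed

text \<open>
  For the constant polynomial the \<open>j\<close>-th row is \<open>bsum (r-j) w\<close>, that is \<open>(a-j choose w)\<close>, less end
  terms.  As \<open>w \<ge> a\<close>, this is nonzero only for \<open>w = a\<close>, \<open>j = 0\<close>, or in the class of \<open>0\<close>, represented by \<open>w = p - 1\<close>, and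
  then the end terms compensate.
\<close>

lemma constant_row_below_a:
  assumes w: "i < w" "a \<le> w" "w \<le> CARD('p) - 1" "w = CARD('p) - 1 \<Longrightarrow> i + 1 = a"
    and ia: "i \<le> a" "a \<le> i + 1" and j: "j < a"
  shows "(\<Sum>n\<le>r - j. of_nat ((r - j) choose n) * cut_poly r i w (1 :: 'p mod_ring poly) n) = 0"
proof -
  have ji: "j \<le> i" using j ia by linarith
  have jr: "j \<le> r" using ji i_le_r by linarith
  have up: "[r - j - k = w] (mod (CARD('p) - 1)) \<longleftrightarrow> k = 0 \<and> w = a \<and> j = 0" if k: "k \<le> i - j" for k
  proof
    assume h: "[r - j - k = w] (mod (CARD('p) - 1))"
    have "j + k \<le> r" using k ji i_le_r by linarith
    then have "[w + j + k = a] (mod (CARD('p) - 1))" using upper_edge_cong h by blast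
    then have "[w + j + k = r] (mod (CARD('p) - 1))" using r_cong cong_trans cong_sym by blast
    moreover have "w + j + k < a + 2 * (CARD('p) - 1)" using w k ji ia a1 p3 by linarith
    ultimately consider "w + j + k = a" | "w + j + k = a + (CARD('p) - 1)" | "w + j + k = 0"
      by (rule cong_r_cases) blast+
    then show "k = 0 \<and> w = a \<and> j = 0"
    proof cases
      case 1
      then show ?thesis using w by linarith
    next
      case 2
      then have "w = CARD('p) - 1" "a \<le> i" using w k ji ia by linarith+
      then show ?thesis using w(4) by linarith
    next
      case 3
      then show ?thesis using w by linarith
    qed
  next
    assume "k = 0 \<and> w = a \<and> j = 0"
    then show "[r - j - k = w] (mod (CARD('p) - 1))" using r_cong by simp
  qed
  have s3: "(\<Sum>k\<le>i - j. if [r - j - k = w] (mod (CARD('p) - 1))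
         then of_nat ((r - j) choose k) * of_nat ((j + k + 0) choose 0) else 0)
      = (if w = a \<and> j = 0 then 1 else 0 :: 'p mod_ring)"
  proof -
    have "(\<Sum>k\<le>i - j. if [r - j - k = w] (mod (CARD('p) - 1))
         then of_nat ((r - j) choose k) * of_nat ((j + k + 0) choose 0) else 0)
      = (\<Sum>k\<le>i - j. if k = 0 then (if w = a \<and> j = 0 then 1 else 0) else 0 :: 'p mod_ring)"
      by (rule sum.cong[OF refl]) (use up in simp)
    also have "\<dots> = (if w = a \<and> j = 0 then 1 else 0)" by (simp add: sum.delta)
    finally show ?thesis .
  qed
  have b: "bsum (r - j) w = (if w = CARD('p) - 1 then 1 else 0) + (if w = a \<and> j = 0 then 1 else 0 :: 'p mod_ring)"
  proof (cases "w = CARD('p) - 1")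
    case True
    have "[w = 0] (mod (CARD('p) - 1))" unfolding True by (simp add: cong_def)
    then have "bsum (r - j) w = (bsum (r - j) 0 :: 'p mod_ring)" by (rule bsum_cong_class)
    also have "\<dots> = 1 + (if [r - j = 0] (mod CARD('p) - 1) then 1 else 0)"
      by (rule bsum_zero_value) (use ji two_i_less_r i1 in linarith)
    also have "[r - j = 0] (mod CARD('p) - 1) \<longleftrightarrow> w = a \<and> j = 0"
    proof -
      have "[r - j = 0] (mod CARD('p) - 1) \<longleftrightarrow> [j = a] (mod CARD('p) - 1)"
        using upper_edge_cong[of j 0 0] jr by simp
      also have "\<dots> \<longleftrightarrow> w = a \<and> j = 0"
      proof (cases "a = CARD('p) - 1")
        case aq: True
        have "[a = 0] (mod CARD('p) - 1)" unfolding aq by (simp add: cong_def)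
        then have "[j = a] (mod CARD('p) - 1) \<longleftrightarrow> [j = 0] (mod CARD('p) - 1)" using cong_trans cong_sym by blast
        also have "\<dots> \<longleftrightarrow> j = 0" by (rule cong_small_iff) (use j aq in linarith)+
        finally show ?thesis using True aq by simp
      next
        case False
        have "[j = a] (mod CARD('p) - 1) \<longleftrightarrow> j = a" by (rule cong_small_iff) (use j ap False in linarith)+
        then show ?thesis using j True False by simp
      qed
      finally show ?thesis .
    qed
    finally show ?thesis using True by simp
  next
    case False
    have "bsum (r - j - 0) w = (of_nat ((a - j) choose w) :: 'p mod_ring)"
    proof (rule bsum_row_value)
      show "[a - j + j + 0 = a] (mod CARD('p) - 1)" using j by simp
      show "a - j < CARD('p)" using ap p3 by linarith
    qed (use False w j ji two_i_less_r in linarith)+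
    moreover have "(a - j) choose w = (if w = a \<and> j = 0 then 1 else 0)"
      using w j by (auto simp: binomial_eq_0)
    ultimately show ?thesis using False by simp
  qed
  have s2: "(\<Sum>n\<le>i. if [n = w] (mod (CARD('p) - 1))
         then of_nat ((r - j) choose n) * of_nat ((r - n + 0) choose 0) else 0)
      = (if w = CARD('p) - 1 then 1 else 0 :: 'p mod_ring)"
  proof -
    have "(\<Sum>n\<le>i. if [n = w] (mod (CARD('p) - 1))
         then of_nat ((r - j) choose n) * of_nat ((r - n + 0) choose 0) else 0)
      = (\<Sum>n\<le>i. if [n = w] (mod (CARD('p) - 1)) then of_nat ((r - j) choose n) else 0 :: 'p mod_ring)"
      by (rule sum.cong[OF refl]) simp
    then show ?thesis using low_edge_sum[OF w(1,3), of "r - j"] by simp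
  qed
  have "(1 :: 'p mod_ring poly) = binpoly (of_nat (r + 0)) 0" by (simp add: binpoly_def)
  then have "(\<Sum>n\<le>r - j. of_nat ((r - j) choose n) * cut_poly r i w (1 :: 'p mod_ring poly) n)
      = (\<Sum>n\<le>r - j. of_nat ((r - j) choose n) * cut_poly r i w (binpoly (of_nat (r + 0)) 0 :: 'p mod_ring poly) n)" by simp
  also have "\<dots> = (\<Sum>k\<le>0. of_nat ((j + 0) choose (0 - k)) * of_nat ((r - j) choose k) * (bsum (r - j - k) w :: 'p mod_ring))
    - (\<Sum>n\<le>i. if [n = w] (mod (CARD('p) - 1))
         then of_nat ((r - j) choose n) * of_nat ((r - n + 0) choose 0) else 0)
    - (\<Sum>k\<le>i - j. if [r - j - k = w] (mod (CARD('p) - 1))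
         then of_nat ((r - j) choose k) * of_nat ((j + k + 0) choose 0) else 0)"
    by (rule interior_sum[OF two_i_less_r _ ji]) (use p3 in linarith)
  also have "\<dots> = 0" unfolding s2 s3 using b by simp
  finally show ?thesis .
qed

text \<open>
  As \<open>r - a\<close> is divisible by \<open>p - 1\<close>, the class sum is \<open>(p-1 choose w)\<close>, which is nonzero.  The
  row \<open>a\<close> may be beyond the rows that elements of the annihilator satisfy, whence the separate treatment of the end terms.
\<close>

lemma constant_row_at_a:
  assumes w: "i < w" "a \<le> w" "w \<le> CARD('p) - 1" "w = CARD('p) - 1 \<Longrightarrow> i + 1 = a"
    and ia: "i \<le> a" "a \<le> i + 1"
  shows "(\<Sum>n\<le>r - a. of_nat ((r - a) choose n) * cut_poly r i w (1 :: 'p mod_ring poly) n) \<noteq> 0"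
proof -
  have ar: "a + i < r" using two_i_less_r r_ge i1 ia p3 ap
  proof -
    have "i * 3 \<le> i * CARD('p)" using p3 by (rule mult_le_mono2)
    then show ?thesis using r_ge ia p3 unfolding distrib_left by linarith
  qed
  have ra0: "[r - a = 0] (mod (CARD('p) - 1))" using upper_edge_cong[of a 0 0] ar by simp
  let ?b = "\<lambda>n. if [n = w] (mod (CARD('p) - 1)) then of_nat ((r - a) choose n) else 0 :: 'p mod_ring"
  have "(\<Sum>n\<le>r - a. of_nat ((r - a) choose n) * cut_poly r i w (1 :: 'p mod_ring poly) n)
      = (\<Sum>n\<le>r - a. ?b n - (if n \<le> i then ?b n else 0))"
  proof (rule sum.cong[OF refl])
    fix n assume "n \<in> {..r - a}"
    then have n: "n \<le> r - a" by simp
    have "n + i < r" if nw: "[n = w] (mod (CARD('p) - 1))"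
    proof (cases "n = r - a \<and> i = a")
      case True
      have "[0 = w] (mod (CARD('p) - 1))" using cong_trans[OF cong_sym[OF ra0]] nw True by blast
      moreover have "w < CARD('p) - 1" using w True by linarith
      ultimately have "w = 0" using cong_small_iff[of 0 w] by simp
      then show ?thesis using w by simp
    next
      case False
      then show ?thesis using n ia ar by linarith
    qed
    then show "of_nat ((r - a) choose n) * cut_poly r i w (1 :: 'p mod_ring poly) n = ?b n - (if n \<le> i then ?b n else 0)"
      by (auto simp: cut_poly_def)
  qed
  also have "\<dots> = bsum (r - a) w - (\<Sum>n\<le>r - a. if n \<le> i then ?b n else 0)"
    unfolding sum_subtractf bsum_def ..
  also have "(\<Sum>n\<le>r - a. if n \<le> i then ?b n else 0) = (\<Sum>n\<le>i. ?b n)"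
    by (rule sum.mono_neutral_cong_right) (use ar in auto)
  also have "\<dots> = (if w = CARD('p) - 1 then 1 else 0)" by (rule low_edge_sum[OF w(1,3)])
  finally have S: "(\<Sum>n\<le>r - a. of_nat ((r - a) choose n) * cut_poly r i w (1 :: 'p mod_ring poly) n)
      = bsum (r - a) w - (if w = CARD('p) - 1 then 1 else 0)" .
  show ?thesis
  proof (cases "w = CARD('p) - 1")
    case True
    have "[w = 0] (mod (CARD('p) - 1))" unfolding True by (simp add: cong_def)
    then have "bsum (r - a) w = (bsum (r - a) 0 :: 'p mod_ring)" by (rule bsum_cong_class)
    also have "\<dots> = 1 + (if [r - a = 0] (mod CARD('p) - 1) then 1 else 0)"
      by (rule bsum_zero_value) (use ar in linarith)
    finally show ?thesis unfolding S using True ra0 by simp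
  next
    case False
    have "bsum (r - a - 0) w = (of_nat ((CARD('p) - 1) choose w) :: 'p mod_ring)"
    proof (rule bsum_row_value)
      show "[CARD('p) - 1 + a + 0 = a] (mod CARD('p) - 1)" by (rule cong_add_period) simp
    qed (use False w ar p3 in linarith)+
    moreover have "(of_nat ((CARD('p) - 1) choose w) :: 'p mod_ring) \<noteq> 0"
      by (rule of_nat_binomial_neq_0) (use w p3 in linarith)+
    ultimately show ?thesis unfolding S using False by simp
  qed
qed

section \<open>Irreducible quotients with i = a - 1 or i = a\<close>

lemma card_excluded_digits:
  assumes "c \<le> a" "a \<le> r0"
  shows "card ((of_nat :: nat \<Rightarrow> 'p mod_ring) ` ({..<c} \<union> {r0 - a + c<..r0})) = a"
proof -
  have "card ((of_nat :: nat \<Rightarrow> 'p mod_ring) ` ({..<c} \<union> {r0 - a + c<..r0})) = card ({..<c} \<union> {r0 - a + c<..r0})"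
    by (rule card_of_nat_image) (use assms r_digits(2) in auto)
  also have "\<dots> = card {..<c} + card {r0 - a + c<..r0}" by (rule card_Un_disjoint) auto
  also have "\<dots> = a" using assms by simp
  finally show ?thesis .
qed

text \<open>
  Classes \<open>1, ..., a - 1\<close> carry nothing, because \<open>P\<close> has \<open>a\<close> zeros and degree below \<open>a\<close>.  Classes
  \<open>a, ..., p - 1\<close> only carry constants, because \<open>i + degree P < a\<close>.
\<close>

lemma irreducible_i_eq_a_minus_1:
  assumes ia: "i + 1 = a" and ar0: "a \<le> r0"
  shows "girreducible Fp GL2 quotient_module"
proof -
  have f: "cut_poly r i 0 (binpoly (of_nat (r + 0)) 0 :: 'p mod_ring poly) \<in> annih r (relations r i)"
    using ia by (intro annih_low_degree) simp_all
  obtain n where n: "n \<le> r" "cut_poly r i 0 (binpoly (of_nat (r + 0)) 0 :: 'p mod_ring poly) n \<noteq> 0"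
    using cut_poly_nonzero[of "binpoly (of_nat (r + 0)) 0 :: 'p mod_ring poly" 0] by (auto simp: binpoly_def)
  show ?thesis
  proof (rule irreducible_by_chain[OF f n, where F = "\<lambda>c. 1" and lo = a and hi = "CARD('p) - 1"])
    show "(1 :: 'p mod_ring poly) \<noteq> 0" "degree (1 :: 'p mod_ring poly) \<le> i" by simp_all
    show "a \<le> CARD('p) - 1" by (rule ap)
    show "CARD('p) - 1 - a < CARD('p) - 1" using a1 p3 by linarith
    show "[a + (CARD('p) - 1) = a] (mod CARD('p) - 1)" by (rule cong_add_period) simp
  next
    fix w and P :: "'p mod_ring poly"
    assume P: "degree P \<le> i" "cut_poly r i w P \<in> annih r (relations r i)" "P \<noteq> 0"
    define v where "v = (if w mod (CARD('p) - 1) = 0 then CARD('p) - 1 else w mod (CARD('p) - 1))"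
    have "w mod (CARD('p) - 1) < CARD('p) - 1" using p3 by simp
    then have v: "1 \<le> v" "v \<le> CARD('p) - 1" unfolding v_def using p3 by auto
    have wv: "[w = v] (mod CARD('p) - 1)" unfolding v_def by (simp add: cong_def)
    have Pv: "cut_poly r i v P \<in> annih r (relations r i)" using P(2) unfolding cut_poly_cong_class[OF wv] .
    have av: "a \<le> v"
    proof (rule ccontr)
      assume "\<not> a \<le> v"
      then have va: "v < a" by simp
      let ?S = "{..<v} \<union> {r0 - a + v<..r0}"
      have z: "poly P (of_nat c) = 0" if c: "c \<in> ?S" for c
      proof (rule vanish_outside_interval[OF ar0 _ _ _ _ _ _ _ Pv])
        show "c \<le> r0" using c va ar0 by auto
        show "c < v \<or> r0 - a + v < c" using c by auto
      qed (use ia va v ap in linarith)+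
      have "P = 0"
      proof (rule poly_eqI_degree[where A = "of_nat ` ?S"])
        show "poly P x = poly 0 x" if "x \<in> of_nat ` ?S" for x using that z by auto
      qed (use card_excluded_digits[of v] va ar0 P(1) ia a1 in simp_all)
      then show False using P(3) by simp
    qed
    have row: "i < v" "a \<le> v" "v \<le> CARD('p) - 1" "v = CARD('p) - 1 \<Longrightarrow> i + 1 = a" "i \<le> a" "a \<le> i + 1"
      using av ia v by linarith+
    have "i + degree P < a"
      by (rule degree_from_constant_rows[OF ar0 row(5) constant_row_below_a[OF row] constant_row_at_a[OF row] Pv P(1,3)])
    then have "degree P = 0" using ia by linarith
    then obtain k where "P = [:k:]" by (rule degree_eq_zeroE)
    then have "P = smult k 1" by simp
    then show "\<exists>c k. a \<le> c \<and> c \<le> CARD('p) - 1 \<and> [w = c] (mod CARD('p) - 1) \<and> P = smult k 1"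
      using av v wv by blast
  next
    fix c assume c: "a \<le> c" "c < CARD('p) - 1"
    have cr: "c + i < r"
    proof -
      have "i * 3 \<le> i * CARD('p)" using p3 by (rule mult_le_mono2)
      then show ?thesis using r_ge c unfolding distrib_left by linarith
    qed
    show "\<exists>n\<le>r. [n = c + 1] (mod CARD('p) - 1) \<and> (\<Sum>m\<le>n. of_nat (n choose m) * cut_poly r i c (1 :: 'p mod_ring poly) m) \<noteq> 0"
    proof (rule up_step[where ?n0.0 = "c + 1" and ?n1.0 = 0 and ?m0.0 = c and ?m1.0 = 0])
      show "c + 1 + CARD('p) * 0 \<le> r" using cr i1 by simp
      show "x0 = c \<and> x1 = 0" if x: "x0 \<le> c + 1" "x1 \<le> 0" "[x0 + x1 = c] (mod CARD('p) - 1)" for x0 x1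
      proof -
        have x1: "x1 = 0" using x(2) by simp
        have "x0 \<noteq> c + 1"
        proof
          assume "x0 = c + 1"
          then have "[c + 1 = c + 0] (mod CARD('p) - 1)" using x(3) x1 by simp
          then have "[1 = 0] (mod CARD('p) - 1)" by (simp only: cong_add_lcancel_nat)
          moreover have "1 < CARD('p) - 1" "0 < CARD('p) - 1" using p3 by linarith+
          ultimately show False using cong_small_iff zero_neq_one by metis
        qed
        then have "x0 < CARD('p) - 1" using x(1) c by linarith
        then show ?thesis using cong_small_iff[of x0 c] c(2) x(3) x1 by simp
      qed
    qed (use c ia cr p3 in simp_all)
  qed
qed

text \<open>
  The monic polynomial of degree \<open>a\<close> whose roots are the digits where a solution in class \<open>c\<close> must vanish.
\<close>

definition root_poly :: "nat \<Rightarrow> 'p mod_ring poly" where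
  "root_poly c = (\<Prod>x\<in>{..<c} \<union> {r0 - a + c<..r0}. [:- of_nat x, 1:])"

lemma root_poly_leading:
  assumes "c \<le> a" "a \<le> r0"
  shows "degree (root_poly c) = a" "coeff (root_poly c) a = 1"
proof -
  have "card ({..<c} \<union> {r0 - a + c<..r0}) = card {..<c} + card {r0 - a + c<..r0}" by (rule card_Un_disjoint) auto
  then have "card ({..<c} \<union> {r0 - a + c<..r0}) = a" using assms by simp
  then show d: "degree (root_poly c) = a"
    using root_product[of "{..<c} \<union> {r0 - a + c<..r0}" "of_nat :: nat \<Rightarrow> 'p mod_ring"] unfolding root_poly_def by simp
  have "lead_coeff (root_poly c) = 1"
    using root_product[of "{..<c} \<union> {r0 - a + c<..r0}" "of_nat :: nat \<Rightarrow> 'p mod_ring"] unfolding root_poly_def by blast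
  then show "coeff (root_poly c) a = 1" unfolding d .
qed

lemma root_poly_eq_0_iff:
  assumes "x < CARD('p)" "c \<le> a" "a \<le> r0"
  shows "poly (root_poly c) (of_nat x) = 0 \<longleftrightarrow> x \<in> {..<c} \<union> {r0 - a + c<..r0}"
proof -
  have e: "(of_nat x :: 'p mod_ring) = of_nat y \<longleftrightarrow> x = y" if "y \<in> {..<c} \<union> {r0 - a + c<..r0}" for y
  proof -
    have "y < CARD('p)" using that assms r_digits(2) by auto
    then show ?thesis unfolding of_nat_mod_ring_eq_iff using assms(1) by simp
  qed
  have "poly (root_poly c) (of_nat x) = (\<Prod>y\<in>{..<c} \<union> {r0 - a + c<..r0}. of_nat x - of_nat y)"
    by (simp add: root_poly_def poly_prod)
  also have "\<dots> = 0 \<longleftrightarrow> (\<exists>y\<in>{..<c} \<union> {r0 - a + c<..r0}. (of_nat x :: 'p mod_ring) = of_nat y)"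
    by (subst prod_zero_iff) auto
  also have "\<dots> \<longleftrightarrow> x \<in> {..<c} \<union> {r0 - a + c<..r0}" using e by blast
  finally show ?thesis .
qed

lemma cong_below_two_periods:
  assumes "[s = w] (mod CARD('p) - 1)" "w < CARD('p) - 1" "s < w + 2 * (CARD('p) - 1)"
  shows "s = w \<or> s = w + (CARD('p) - 1)"
proof (cases "w \<le> s")
  case True
  then obtain q where q: "s = q * (CARD('p) - 1) + w" using assms(1) by (auto simp: cong_le_nat)
  have "q < 2"
  proof (rule ccontr)
    assume "\<not> q < 2"
    then have "2 * (CARD('p) - 1) \<le> q * (CARD('p) - 1)" by (intro mult_le_mono1) simp
    then show False using q assms(3) by linarith
  qed
  then have "q = 0 \<or> q = 1" by linarith
  then show ?thesis using q by auto
next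
  case False
  then have "s < CARD('p) - 1" using assms(2) by linarith
  then show ?thesis using cong_small_iff[of s w] assms by blast
qed

text \<open>
  The zeros of \<open>root_poly c\<close> leave few admissible digit pairs \<open>(x0, x1)\<close>.  Their sum is \<open>c\<close> or \<open>c + p - 1\<close>; the
  first only occurs for \<open>x0 = c\<close>, \<open>x1 = 0\<close>, and that point has been cut off.  The target \<open>n\<close> has digit sum
  \<open>c + p\<close>, so in the second case exactly one digit of \<open>n\<close> is lowered by one, and a zero of \<open>root_poly c\<close> decides which.
\<close>

lemma root_poly_up:
  assumes ia: "i = a" and ar0: "a \<le> r0" and aq: "a < CARD('p) - 1" and c: "c < a"
  shows "\<exists>n\<le>r. [n = c + 1] (mod CARD('p) - 1) \<and>
    (\<Sum>m\<le>n. of_nat (n choose m) * cut_poly r i c (root_poly c) m) \<noteq> 0"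
proof -
  define b where "b = CARD('p) - 1 + a - r0"
  have b: "[rq = b] (mod CARD('p) - 1)" "a \<le> b" "b < CARD('p)" unfolding b_def using quotient_digit_cong[OF ar0] by auto
  have r0p: "r0 \<le> CARD('p) - 1" using r_digits(2) by linarith
  have ca: "c \<le> a" using c by simp
  show ?thesis
  proof (cases "r0 = CARD('p) - 1")
    case True
    have p_le: "CARD('p) * 1 \<le> CARD('p) * a" using a1 by (rule mult_le_mono2)
    have "CARD('p) * (a + 1) \<le> CARD('p) * rq" using rq_ge ia by (intro mult_le_mono2) simp
    then have r_big: "CARD('p) * a + CARD('p) + r0 \<le> r" using r_digits(1) by simp
    show ?thesis
    \<comment> \<open>the digit \<open>r0 - a + c + 1\<close> is the first root above the gap, so the last digit has to drop\<close>
    proof (rule up_step[where ?n0.0 = "r0 - a + c + 1" and ?n1.0 = a and ?m0.0 = "r0 - a + c" and ?m1.0 = a])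
      have e: "r0 - a + c + a = c + (CARD('p) - 1)" using True ar0 by linarith
      show "[r0 - a + c + a = c] (mod CARD('p) - 1)" by (rule cong_add_period[OF e])
      have "r0 - a + c + 1 + a = c + 1 + (CARD('p) - 1)" using True ar0 by linarith
      then show "[r0 - a + c + 1 + a = c + 1] (mod CARD('p) - 1)" by (rule cong_add_period)
      show "r0 - a + c + 1 < CARD('p)" "a < CARD('p)" using True c ar0 r_digits(2) aq by linarith+
      show "r0 - a + c + 1 + CARD('p) * a \<le> r" using r_big c ar0 by linarith
      show "i < r0 - a + c + CARD('p) * a" using p_le i_less_p by linarith
      show "r0 - a + c + CARD('p) * a + i < r" using r_big c ar0 ia aq by linarith
      show "poly (root_poly c) (of_nat (r0 - a + c)) \<noteq> 0"
        by (subst root_poly_eq_0_iff[OF _ ca ar0]) (use c ar0 r_digits(2) in auto)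
    next
      fix x0 x1
      assume x: "x0 \<le> r0 - a + c + 1" "x1 \<le> a" "i < x0 + CARD('p) * x1" "[x0 + x1 = c] (mod CARD('p) - 1)"
        "poly (root_poly c) (of_nat x0) \<noteq> 0"
      have "x0 < CARD('p)" using x(1) c ar0 r_digits(2) by linarith
      then have "x0 \<notin> {..<c} \<union> {r0 - a + c<..r0}" using root_poly_eq_0_iff[OF _ ca ar0] x(5) by blast
      moreover have "x0 \<le> r0" using x(1) c ar0 by linarith
      ultimately have x0: "c \<le> x0" "x0 \<le> r0 - a + c" by auto
      have "x0 + x1 = c \<or> x0 + x1 = c + (CARD('p) - 1)"
        by (rule cong_below_two_periods[OF x(4)]) (use x0 x(2) c ar0 True aq in linarith)+
      then show "x0 = r0 - a + c \<and> x1 = a"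
      proof
        assume "x0 + x1 = c"
        then have "x0 = c" "x1 = 0" using x0 by linarith+
        then show ?thesis using x(3) c ia by simp
      next
        assume "x0 + x1 = c + (CARD('p) - 1)"
        then show ?thesis using x0 x(2) True ar0 by linarith
      qed
    qed simp_all
  next
    case False
    then have r0q: "r0 < CARD('p) - 1" using r0p by linarith
    have rqb: "b \<le> rq"
    proof (rule ccontr)
      assume n: "\<not> b \<le> rq"
      then have "[b = rq] (mod CARD('p) - 1)" using b(1) cong_sym by blast
      then obtain q where q: "b = q * (CARD('p) - 1) + rq" using n cong_le_nat[of rq b] by auto
      have "q \<noteq> 0" using q n by auto
      then have "1 * (CARD('p) - 1) \<le> q * (CARD('p) - 1)" by (intro mult_le_mono1) simp
      then show False using q b(3) rq_ge i1 by linarith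
    qed
    define t where "t = CARD('p) - 2 - r0 + c"
    have tb: "t + 2 \<le> b" unfolding t_def b_def using r0q c by linarith
    have "CARD('p) * (t + 2) \<le> CARD('p) * rq" using tb rqb by (intro mult_le_mono2) simp
    then have r_big: "CARD('p) * t + 2 * CARD('p) + r0 \<le> r" using r_digits(1) by simp
    show ?thesis
    \<comment> \<open>the digit \<open>r0 + 1\<close> is no root, but \<open>r0\<close> is one, so the higher digit has to drop\<close>
    proof (rule up_step[where ?n0.0 = "r0 + 1" and ?n1.0 = "t + 1" and ?m0.0 = "r0 + 1" and ?m1.0 = t])
      have e: "r0 + 1 + t = c + (CARD('p) - 1)" unfolding t_def using r0q by linarith
      show "[r0 + 1 + t = c] (mod CARD('p) - 1)" by (rule cong_add_period[OF e])
      have "r0 + 1 + (t + 1) = c + 1 + (CARD('p) - 1)" using e by linarith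
      then show "[r0 + 1 + (t + 1) = c + 1] (mod CARD('p) - 1)" by (rule cong_add_period)
      show "r0 + 1 < CARD('p)" "t + 1 < CARD('p)" using r0q tb b(3) by linarith+
      show "r0 + 1 + CARD('p) * (t + 1) \<le> r" using r_big p3 unfolding distrib_left by linarith
      show "i < r0 + 1 + CARD('p) * t" using ia ar0 by linarith
      show "r0 + 1 + CARD('p) * t + i < r" using r_big i_less_p p3 by linarith
      show "poly (root_poly c) (of_nat (r0 + 1)) \<noteq> 0"
        by (subst root_poly_eq_0_iff[OF _ ca ar0]) (use c ar0 r0q in auto)
    next
      fix x0 x1
      assume x: "x0 \<le> r0 + 1" "x1 \<le> t + 1" "i < x0 + CARD('p) * x1" "[x0 + x1 = c] (mod CARD('p) - 1)"
        "poly (root_poly c) (of_nat x0) \<noteq> 0"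
      have "x0 < CARD('p)" using x(1) r0q by linarith
      then have "x0 \<notin> {..<c} \<union> {r0 - a + c<..r0}" using root_poly_eq_0_iff[OF _ ca ar0] x(5) by blast
      then have x0: "c \<le> x0" "x0 \<noteq> r0" using c ar0 by auto
      have "x0 + x1 = c \<or> x0 + x1 = c + (CARD('p) - 1)"
        by (rule cong_below_two_periods[OF x(4)]) (use x(1,2) c aq r0q p3 in \<open>unfold t_def, linarith+\<close>)
      then show "x0 = r0 + 1 \<and> x1 = t"
      proof
        assume "x0 + x1 = c"
        then have "x0 = c" "x1 = 0" using x0 by linarith+
        then show ?thesis using x(3) c ia by simp
      next
        assume "x0 + x1 = c + (CARD('p) - 1)"
        then show ?thesis using x0 x(1,2) r0q unfolding t_def by linarith
      qed
    qed simp_all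
  qed
qed

text \<open>
  Classes \<open>a + 1, ..., p - 2\<close> carry nothing, because \<open>i + degree P < a\<close> is impossible for \<open>i = a\<close>.  In the classes
  \<open>0, ..., a\<close> a solution has degree at most \<open>a\<close> and \<open>a\<close> prescribed zeros.
\<close>

lemma irreducible_i_eq_a:
  assumes ia: "i = a" and ar0: "a \<le> r0" and aq: "a < CARD('p) - 1"
  shows "girreducible Fp GL2 quotient_module"
proof -
  have aP: "a < CARD('p)" using aq by linarith
  have f: "cut_poly r i 0 (binpoly (of_nat (r + 0)) a :: 'p mod_ring poly) \<in> annih r (relations r i)"
    using ia aq by (intro annih_degree_a) linarith+
  have "degree (binpoly (of_nat (r + 0)) a :: 'p mod_ring poly) \<le> i" unfolding degree_binpoly[OF aP] using ia by simp
  then obtain n where n: "n \<le> r" "cut_poly r i 0 (binpoly (of_nat (r + 0)) a :: 'p mod_ring poly) n \<noteq> 0"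
    using cut_poly_nonzero[OF _ degree_binpoly_neq_0[OF aP]] by blast
  show ?thesis
  proof (rule irreducible_by_chain[OF f n, where F = root_poly and lo = 0 and hi = a])
    show "root_poly a \<noteq> 0" using root_poly_leading(2)[of a] ar0 by auto
    show "degree (root_poly a) \<le> i" using root_poly_leading(1)[of a] ar0 ia by simp
    show "0 \<le> a" "a - 0 < CARD('p) - 1" "[0 + a = a] (mod CARD('p) - 1)" using aq by simp_all
  next
    fix c assume "c < a"
    then show "\<exists>n\<le>r. [n = c + 1] (mod CARD('p) - 1) \<and> (\<Sum>m\<le>n. of_nat (n choose m) * cut_poly r i c (root_poly c) m) \<noteq> 0"
      by (rule root_poly_up[OF ia ar0 aq])
  next
    fix w and P :: "'p mod_ring poly"
    assume P: "degree P \<le> i" "cut_poly r i w P \<in> annih r (relations r i)" "P \<noteq> 0"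
    define v where "v = w mod (CARD('p) - 1)"
    have v: "v < CARD('p) - 1" unfolding v_def using p3 by simp
    have wv: "[w = v] (mod CARD('p) - 1)" unfolding v_def by (simp add: cong_def)
    have Pv: "cut_poly r i v P \<in> annih r (relations r i)" using P(2) unfolding cut_poly_cong_class[OF wv] .
    have va: "v \<le> a"
    proof (rule ccontr)
      assume "\<not> v \<le> a"
      then have row: "i < v" "a \<le> v" "v \<le> CARD('p) - 1" "v = CARD('p) - 1 \<Longrightarrow> i + 1 = a" "i \<le> a" "a \<le> i + 1"
        using ia v by linarith+
      have "i + degree P < a"
        by (rule degree_from_constant_rows[OF ar0 row(5) constant_row_below_a[OF row] constant_row_at_a[OF row] Pv P(1,3)])
      then show False using ia by simp
    qed
    let ?S = "{..<v} \<union> {r0 - a + v<..r0}"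
    have z: "poly P (of_nat c) = 0" if c: "c \<in> ?S" for c
    proof (rule vanish_outside_interval[OF ar0 _ _ _ _ _ _ _ Pv])
      show "c \<le> r0" using c va ar0 by auto
      show "c < v \<or> r0 - a + v < c" using c by auto
    qed (use ia va v aq in linarith)+
    have "P = smult (coeff P a) (root_poly v)"
    proof (rule poly_eqI_degree_lead_coeff[where A = "of_nat ` ?S" and n = a])
      show "coeff P a = coeff (smult (coeff P a) (root_poly v)) a" using root_poly_leading(2)[OF va ar0] by simp
      show "a \<le> card ((of_nat :: nat \<Rightarrow> 'p mod_ring) ` ?S)" using card_excluded_digits[OF va ar0] by simp
      show "degree P \<le> a" using P(1) ia by simp
      show "degree (smult (coeff P a) (root_poly v)) \<le> a" using root_poly_leading(1)[OF va ar0] degree_smult_le by metis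
      show "poly P x = poly (smult (coeff P a) (root_poly v)) x" if x: "x \<in> of_nat ` ?S" for x
      proof -
        obtain c where c: "c \<in> ?S" "x = of_nat c" using x by blast
        then have "c < CARD('p)" using va ar0 r_digits(2) by auto
        then show ?thesis using z[OF c(1)] root_poly_eq_0_iff[OF _ va ar0] c by simp
      qed
    qed
    then show "\<exists>c k. 0 \<le> c \<and> c \<le> a \<and> [w = c] (mod CARD('p) - 1) \<and> P = smult k (root_poly c)"
      using va wv by blast
  qed
qed

section \<open>Irreducible quotients with i = p - 1\<close>

lemma delta_poly_neq_0: "(delta_poly c :: 'p mod_ring poly) \<noteq> 0"
  using degree_delta_poly[of c, where 'p='p] p3 by force

lemma poly_delta_poly_digit:
  "c < CARD('p) \<Longrightarrow> x < CARD('p) \<Longrightarrow> poly (delta_poly c) (of_nat x) = (if x = c then 1 else 0 :: 'p mod_ring)"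
  by (simp add: poly_delta_poly)

lemma eq_smult_delta_poly:
  fixes P :: "'p mod_ring poly"
  assumes "degree P < CARD('p)" "w < CARD('p)" and z: "\<And>c. c < CARD('p) \<Longrightarrow> c \<noteq> w \<Longrightarrow> poly P (of_nat c) = 0"
  shows "P = smult (poly P (of_nat w)) (delta_poly w)"
proof (rule poly_eq_on_digits[OF assms(1)])
  show "degree (smult (poly P (of_nat w)) (delta_poly w)) < CARD('p)"
    using degree_smult_le[of "poly P (of_nat w)" "delta_poly w"] p3 unfolding degree_delta_poly by linarith
  show "poly P (of_nat c) = poly (smult (poly P (of_nat w)) (delta_poly w)) (of_nat c)" if "c < CARD('p)" for c
    using z[OF that] poly_delta_poly_digit[OF assms(2) that] by auto
qed

text \<open>
  The target is \<open>n = (c + 1) + p (p - 1)\<close> and the only contribution comes from \<open>c + p (p - 1)\<close>: the other candidate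
  \<open>c\<close> lies at the lower end.
\<close>

lemma delta_poly_up:
  assumes i: "i = CARD('p) - 1" and c: "c < CARD('p) - 1"
    and P: "poly P (of_nat c) \<noteq> (0 :: 'p mod_ring)"
      "\<And>x. x \<le> c + 1 \<Longrightarrow> x \<noteq> c \<Longrightarrow> poly P (of_nat x) = 0 \<or> (c = 0 \<and> x = CARD('p) - 1)"
  shows "\<exists>n\<le>r. [n = c + 1] (mod CARD('p) - 1) \<and> (\<Sum>m\<le>n. of_nat (n choose m) * cut_poly r i c P m) \<noteq> 0"
proof -
  have "(CARD('p) - 1) * (CARD('p) + 1) = CARD('p) * (CARD('p) - 1) + (CARD('p) - 1)" by (simp add: algebra_simps)
  then have rb: "CARD('p) * (CARD('p) - 1) + 2 * CARD('p) - 1 \<le> r" using r_ge[unfolded i] p3 by linarith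
  have pp: "CARD('p) * 2 \<le> CARD('p) * (CARD('p) - 1)" using p3 by (intro mult_le_mono2) linarith
  show ?thesis
  proof (rule up_step[where ?n0.0 = "c + 1" and ?n1.0 = "CARD('p) - 1" and ?m0.0 = c and ?m1.0 = "CARD('p) - 1"])
    show "[c + (CARD('p) - 1) = c] (mod CARD('p) - 1)" by (rule cong_add_period) simp
    show "[c + 1 + (CARD('p) - 1) = c + 1] (mod CARD('p) - 1)" by (rule cong_add_period) simp
    show "c + 1 < CARD('p)" "CARD('p) - 1 < CARD('p)" using c by linarith+
    show "c + 1 + CARD('p) * (CARD('p) - 1) \<le> r" using rb c by linarith
    show "i < c + CARD('p) * (CARD('p) - 1)" using pp i p3 by linarith
    show "c + CARD('p) * (CARD('p) - 1) + i < r" using rb c i by linarith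
    show "x0 = c \<and> x1 = CARD('p) - 1"
      if x: "x0 \<le> c + 1" "x1 \<le> CARD('p) - 1" "i < x0 + CARD('p) * x1" "[x0 + x1 = c] (mod CARD('p) - 1)"
        "poly P (of_nat x0) \<noteq> 0" for x0 x1
    proof -
      have x0: "x0 = c"
      proof (rule ccontr)
        assume "x0 \<noteq> c"
        then have "c = 0" "x0 = CARD('p) - 1" using P(2)[OF x(1)] x(5) by auto
        then show False using x(1) p3 by linarith
      qed
      have "c + x1 = c \<or> c + x1 = c + (CARD('p) - 1)"
        by (rule cong_below_two_periods[OF x(4)[unfolded x0] c]) (use x(2) p3 in linarith)
      moreover have "x1 \<noteq> 0"
      proof
        assume "x1 = 0"
        then have "i < c" using x(3) x0 by simp
        then show False using c i by linarith
      qed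
      ultimately show ?thesis using x0 by linarith
    qed
  qed (use P(1) in simp_all)
qed

text \<open>
  As \<open>r0 = 0\<close>, the last digit of \<open>r - j\<close> is \<open>p - j\<close>, and the rows \<open>j \<ge> 1\<close> say that the numbers
  \<open>x c = P c * digit_sum 1 w c\<close> satisfy \<open>\<Sum>c\<le>d. (d choose c) x c = 0\<close> for \<open>1 \<le> d < p\<close>.  So \<open>x c = (-1)^c x 0\<close>; one
  of them is \<open>0\<close>, namely that of the digit in the class itself, and thus all are.  Hence the solutions are the multiples of
  indicator functions.
\<close>

lemma irreducible_a_eq_1_r0_eq_0:
  assumes i: "i = CARD('p) - 1" and a: "a = 1" and r0z: "r0 = 0"
  shows "girreducible Fp GL2 quotient_module"
proof -
  have f: "cut_poly r i 1 (delta_poly 1 :: 'p mod_ring poly) \<in> annih r (relations r i)"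
    using p3 r0z by (intro annih_delta[OF i]) linarith+
  have dd: "degree (delta_poly c :: 'p mod_ring poly) \<le> i" for c using i by (simp add: degree_delta_poly)
  obtain n where n: "n \<le> r" "cut_poly r i 1 (delta_poly 1 :: 'p mod_ring poly) n \<noteq> 0"
    using cut_poly_nonzero[OF dd delta_poly_neq_0] by blast
  show ?thesis
  proof (rule irreducible_by_chain[OF f n, where F = delta_poly and lo = 1 and hi = "CARD('p) - 1"])
    show "delta_poly (CARD('p) - 1) \<noteq> (0 :: 'p mod_ring poly)" by (rule delta_poly_neq_0)
    show "degree (delta_poly (CARD('p) - 1) :: 'p mod_ring poly) \<le> i" by (rule dd)
    show "1 \<le> CARD('p) - 1" "CARD('p) - 1 - 1 < CARD('p) - 1" using p3 by linarith+
    show "[1 + (CARD('p) - 1) = a] (mod CARD('p) - 1)" by (rule cong_add_period) (simp add: a)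
  next
    fix c assume c: "1 \<le> c" "c < CARD('p) - 1"
    show "\<exists>n\<le>r. [n = c + 1] (mod CARD('p) - 1) \<and> (\<Sum>m\<le>n. of_nat (n choose m) * cut_poly r i c (delta_poly c :: 'p mod_ring poly) m) \<noteq> 0"
    proof (rule delta_poly_up[OF i c(2)])
      have cp: "c < CARD('p)" using c by linarith
      show "poly (delta_poly c) (of_nat c) \<noteq> (0 :: 'p mod_ring)" using poly_delta_poly_digit[OF cp cp] by simp
      show "poly (delta_poly c) (of_nat x) = (0 :: 'p mod_ring) \<or> c = 0 \<and> x = CARD('p) - 1"
        if "x \<le> c + 1" "x \<noteq> c" for x
        using poly_delta_poly_digit[OF cp, of x] that c by simp
    qed
  next
    fix w and P :: "'p mod_ring poly"
    assume P: "degree P \<le> i" "cut_poly r i w P \<in> annih r (relations r i)" "P \<noteq> 0"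
    define v where "v = (if w mod (CARD('p) - 1) = 0 then CARD('p) - 1 else w mod (CARD('p) - 1))"
    have "w mod (CARD('p) - 1) < CARD('p) - 1" using p3 by simp
    then have v: "1 \<le> v" "v \<le> CARD('p) - 1" unfolding v_def using p3 by auto
    have wv: "[w = v] (mod CARD('p) - 1)" unfolding v_def by (simp add: cong_def)
    have Pv: "cut_poly r i v P \<in> annih r (relations r i)" using P(2) unfolding cut_poly_cong_class[OF wv] .
    define x where "x c = poly P (of_nat c) * digit_sum 1 v c" for c
    have dv: "(r - j) div CARD('p) = rq - 1" "(r - j) mod CARD('p) = CARD('p) - j" if "1 \<le> j" "j \<le> i" for j
      using row_quotient(1,2)[of j] that r0z by simp_all
    have row: "(\<Sum>c<CARD('p). of_nat (d choose c) * x c) = 0" if d: "1 \<le> d" "d \<le> CARD('p) - 1" for d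
    proof -
      define j where "j = CARD('p) - d"
      have j: "1 \<le> j" "j \<le> i" "CARD('p) - j = d" unfolding j_def using d i by linarith+
      have "digit_sum j v c = (digit_sum 1 v c :: 'p mod_ring)" for c
        unfolding digit_sum_def using dv(1)[OF j(1,2)] dv(1)[of 1] i1 by simp
      then show ?thesis
        using cut_poly_rows[OF Pv j(2)] unfolding row_digits dv(2)[OF j(1,2)] j(3) x_def by simp
    qed
    have alt: "x c = (- 1) ^ c * x 0" if "c < CARD('p)" for c
      using that
    proof (induction c rule: less_induct)
      case (less c)
      show ?case
      proof (cases "c = 0")
        case False
        have "0 = (\<Sum>e<CARD('p). of_nat (c choose e) * x e)" using row[of c] False less.prems by simp
        also have "\<dots> = (\<Sum>e\<le>c. of_nat (c choose e) * x e)"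
          by (rule sum.mono_neutral_right) (use less.prems in \<open>auto simp: binomial_eq_0\<close>)
        also have "\<dots> = (\<Sum>e<c. of_nat (c choose e) * x e) + x c" by (simp add: lessThan_Suc_atMost[symmetric])
        also have "(\<Sum>e<c. of_nat (c choose e) * x e) = (\<Sum>e<c. (- 1) ^ e * of_nat (c choose e)) * x 0"
          unfolding sum_distrib_right
        proof (rule sum.cong[OF refl])
          fix e assume "e \<in> {..<c}"
          then have "x e = (- 1) ^ e * x 0" using less.prems by (intro less.IH) auto
          then show "of_nat (c choose e) * x e = (- 1) ^ e * of_nat (c choose e) * x 0" by (simp only: mult_ac)
        qed
        also have "(\<Sum>e<c. (- 1) ^ e * of_nat (c choose e)) = - ((- 1) ^ c :: 'p mod_ring)"
        proof -
          have "(\<Sum>e\<le>c. (- 1) ^ e * of_nat (c choose e)) = (0 :: 'p mod_ring)"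
            by (rule choose_alternating_sum) (use False in simp)
          then show ?thesis by (simp add: lessThan_Suc_atMost[symmetric] eq_neg_iff_add_eq_0)
        qed
        finally show ?thesis by simp
      qed simp
    qed
    have vp: "v < CARD('p)" using v p3 by linarith
    have ri: "r \<le> c + CARD('p) * (rq - 1) + i \<longleftrightarrow> 1 \<le> c" for c
    proof -
      have "CARD('p) * rq = CARD('p) * (rq - 1) + CARD('p)" using rq_ge by (cases rq) auto
      then show ?thesis using r_digits(1) r0z i p3 by linarith
    qed
    have rq1: "[rq - 1 = 0] (mod CARD('p) - 1)"
    proof -
      have "[(rq - 1) + 1 = 0 + 1] (mod CARD('p) - 1)" using rq_cong rq_ge a r0z by simp
      then show ?thesis by (simp only: cong_add_rcancel_nat)
    qed
    have rqpos: "1 \<le> rq - 1" using rq_ge_2 by linarith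
    have mod1: "(r - 1) mod CARD('p) = CARD('p) - 1" "(r - 1) div CARD('p) = rq - 1" using dv[of 1] i1 by simp_all
    have "digit_sum 1 v v = (0 :: 'p mod_ring)"
      by (rule digit_sum_same_class[OF i1]) (use v i mod1 ri in simp_all)
    then have "x v = 0" by (simp add: x_def)
    then have "x 0 = 0" using alt[OF vp] by simp
    then have xz: "x c = 0" if "c < CARD('p)" for c using alt[OF that] by simp
    have nz: "digit_sum 1 v c \<noteq> (0 :: 'p mod_ring)" if c: "c < CARD('p)" "c \<noteq> v" for c
    proof -
      have cm: "c \<le> (r - 1) mod CARD('p)" using c mod1 by linarith
      have interior: ?thesis if u: "0 < u" "u < CARD('p) - 1" "[c + u = v] (mod CARD('p) - 1)" for u
      proof -
        have "[rq - 1 = CARD('p) - 1] (mod CARD('p) - 1)" using rq1 by (simp add: cong_def)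
        then have bs: "bsum (rq - 1) u = (of_nat ((CARD('p) - 1) choose u) :: 'p mod_ring)"
          by (intro bsum_value[OF rqpos]) (use u p3 in linarith)+
        have u0: "\<not> [u = 0] (mod CARD('p) - 1)" using u cong_small_iff[of u 0] by simp
        then have e: "\<not> [rq - 1 = u] (mod CARD('p) - 1)" using rq1 cong_trans cong_sym by blast
        have "(of_nat ((CARD('p) - 1) choose u) :: 'p mod_ring) \<noteq> 0"
          by (rule of_nat_binomial_neq_0) (use u in linarith)+
        then show ?thesis unfolding digit_sum_eval[OF i1 cm u(3)] mod1 bs using u0 e by simp
      qed
      consider "c < v" "v - c < CARD('p) - 1" | "v < c" | "c = 0" "v = CARD('p) - 1" using c v by linarith
      then show ?thesis
      proof cases
        case 1
        then show ?thesis by (intro interior[of "v - c"]) simp_all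
      next
        case 2
        have "c + (v + (CARD('p) - 1) - c) = v + (CARD('p) - 1)" using c by linarith
        from cong_add_period[OF this] show ?thesis by (intro interior[of "v + (CARD('p) - 1) - c"]) (use 2 c v in linarith)+
      next
        case 3
        have cv: "[c + 0 = v] (mod CARD('p) - 1)" unfolding 3 by (simp add: cong_def)
        have nle: "\<not> r \<le> c + CARD('p) * (rq - 1) + i" unfolding ri using 3 by simp
        show ?thesis unfolding digit_sum_eval[OF i1 cm cv] mod1 bsum_zero_value[OF rqpos]
          using rq1 nle 3 by simp
      qed
    qed
    have "P = smult (poly P (of_nat v)) (delta_poly v)"
    proof (rule eq_smult_delta_poly[OF _ vp])
      show "degree P < CARD('p)" using P(1) i_less_p by linarith
      show "poly P (of_nat c) = 0" if "c < CARD('p)" "c \<noteq> v" for c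
        using xz[OF that(1)] nz[OF that] by (simp add: x_def)
    qed
    then show "\<exists>c k. 1 \<le> c \<and> c \<le> CARD('p) - 1 \<and> [w = c] (mod CARD('p) - 1) \<and> P = smult k (delta_poly c)"
      using v wv by blast
  qed
qed

text \<open>
  Here \<open>i + 1 = p\<close>, so that any support is small enough for \<open>vanish_on_support\<close>.
\<close>

lemma annih_eq_top_roots:
  fixes P :: "'p mod_ring poly"
  assumes top: "i = CARD('p) - 1" "a = CARD('p) - 1" "r0 = CARD('p) - 1"
    and P: "cut_poly r i w P \<in> annih r (relations r i)" and w: "w < CARD('p) - 1"
    and c: "c < CARD('p)" "c \<noteq> w" "\<not> (w = 0 \<and> c = CARD('p) - 1)"
  shows "poly P (of_nat c) = 0"
proof (rule vanish_on_support[where S = "{..r0}", OF _ P])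
  show "i \<le> r0" "{..r0} \<subseteq> {..r0}" "card {..r0} \<le> i + 1" using top by simp_all
  show "c \<le> r0" using c(1) top by linarith
  show "digit_sum 0 w c \<noteq> (0 :: 'p mod_ring)"
    by (rule digit_sum_0_nonzero) (use top w c in linarith)+
qed simp

lemma annih_top_interior:
  fixes P :: "'p mod_ring poly"
  assumes top: "i = CARD('p) - 1" "a = CARD('p) - 1" "r0 = CARD('p) - 1"
    and P: "degree P \<le> i" "cut_poly r i w P \<in> annih r (relations r i)" and w: "1 \<le> w" "w < CARD('p) - 1"
  shows "P = smult (poly P (of_nat w)) (delta_poly w)"
proof (rule eq_smult_delta_poly)
  show "degree P < CARD('p)" using P(1) i_less_p by linarith
  show "w < CARD('p)" using w by linarith
  show "poly P (of_nat c) = 0" if "c < CARD('p)" "c \<noteq> w" for c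
    by (rule annih_eq_top_roots[OF top P(2) w(2) that]) (use w in linarith)
qed

text \<open>
  The class of \<open>0\<close> contains the two digits \<open>0\<close> and \<open>p - 1\<close>, and its solutions form a plane.
\<close>

lemma annih_top_class_zero:
  fixes P :: "'p mod_ring poly"
  assumes top: "i = CARD('p) - 1" "a = CARD('p) - 1" "r0 = CARD('p) - 1"
    and P: "degree P \<le> i" "cut_poly r i 0 P \<in> annih r (relations r i)"
  shows "P = smult (poly P 0) (delta_poly 0) + smult (poly P (of_nat (CARD('p) - 1))) (delta_poly (CARD('p) - 1))"
proof (rule poly_eq_on_digits)
  let ?Q = "smult (poly P 0) (delta_poly 0) + smult (poly P (of_nat (CARD('p) - 1))) (delta_poly (CARD('p) - 1))"
  show "degree P < CARD('p)" using P(1) i_less_p by linarith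
  have "degree (smult k (delta_poly c) :: 'p mod_ring poly) \<le> CARD('p) - 1" for k c
    using degree_smult_le[of k "delta_poly c :: 'p mod_ring poly"] unfolding degree_delta_poly by simp
  then have "degree ?Q \<le> CARD('p) - 1" by (intro degree_add_le)
  then show "degree ?Q < CARD('p)" using p3 by linarith
  fix c assume c: "c < CARD('p)"
  have d0: "poly (delta_poly 0) (of_nat c) = (if c = 0 then 1 else 0 :: 'p mod_ring)"
    by (rule poly_delta_poly_digit) (use c p3 in simp_all)
  have d1: "poly (delta_poly (CARD('p) - 1)) (of_nat c) = (if c = CARD('p) - 1 then 1 else 0 :: 'p mod_ring)"
    by (rule poly_delta_poly_digit) (use c p3 in simp_all)
  consider "c = 0" | "c = CARD('p) - 1" | "c \<noteq> 0" "c \<noteq> CARD('p) - 1" by blast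
  then show "poly P (of_nat c) = poly ?Q (of_nat c)"
  proof cases
    case 1
    moreover have "(0 :: nat) \<noteq> CARD('p) - 1" using p3 by linarith
    ultimately show ?thesis unfolding poly_add poly_smult d0 d1 by simp
  next
    case 2
    moreover have "CARD('p) - 1 \<noteq> (0 :: nat)" using p3 by linarith
    ultimately show ?thesis unfolding poly_add poly_smult d0 d1 by simp
  next
    case 3
    have "poly P (of_nat c) = 0"
      by (rule annih_eq_top_roots[OF top P(2) _ c 3(1)]) (use 3 p3 in linarith)+
    then show ?thesis unfolding poly_add poly_smult d0 d1 using 3 by simp
  qed
qed

text \<open>
  Since \<open>r0 = p - 1\<close>, replacing \<open>n\<close> by \<open>r - n\<close> turns the last digit \<open>c\<close> into \<open>p - 1 - c\<close>.
\<close>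

lemma swap_delta_poly:
  assumes top: "i = CARD('p) - 1" "a = CARD('p) - 1" "r0 = CARD('p) - 1" and n: "n \<le> r"
  shows "cut_poly r i 0 (delta_poly (CARD('p) - 1)) (r - n) = (cut_poly r i 0 (delta_poly 0) n :: 'p mod_ring)"
proof -
  have cls: "[r - n = 0] (mod CARD('p) - 1) \<longleftrightarrow> [n = 0] (mod CARD('p) - 1)"
  proof -
    have r0': "[r = 0] (mod CARD('p) - 1)" using r_cong top(2) by (simp add: cong_def)
    have "[r - n = 0] (mod CARD('p) - 1) \<longleftrightarrow> [(r - n) + n = 0 + n] (mod CARD('p) - 1)"
      by (simp only: cong_add_rcancel_nat)
    also have "\<dots> \<longleftrightarrow> [r = n] (mod CARD('p) - 1)" using n by simp
    also have "\<dots> \<longleftrightarrow> [n = 0] (mod CARD('p) - 1)" using r0' cong_trans cong_sym by blast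
    finally show ?thesis .
  qed
  have dig: "(r - n) mod CARD('p) = CARD('p) - 1 \<longleftrightarrow> n mod CARD('p) = 0"
  proof -
    have "(of_nat r :: 'p mod_ring) = of_nat (CARD('p) - 1)"
      unfolding of_nat_mod_ring_eq_iff using top(3) r0 p3 by simp
    moreover have "(of_nat (r - n) :: 'p mod_ring) = of_nat r - of_nat n" using n by (simp add: of_nat_diff)
    ultimately have "(of_nat (r - n) :: 'p mod_ring) = of_nat (CARD('p) - 1) \<longleftrightarrow> (of_nat n :: 'p mod_ring) = of_nat 0"
      by simp
    then show ?thesis unfolding of_nat_mod_ring_eq_iff using p3 by simp
  qed
  have rng: "i < r - n \<and> r - n + i < r \<longleftrightarrow> i < n \<and> n + i < r" using n by linarith
  have q: "(CARD('p) - 1) mod CARD('p) = CARD('p) - 1" using p3 by simp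
  have "i < r - n \<and> r - n + i < r \<and> C \<longleftrightarrow> i < n \<and> n + i < r \<and> C" for C using rng by blast
  then show ?thesis unfolding cut_poly_def poly_delta_poly cls q dig by simp
qed

text \<open>
  Write \<open>D c\<close> for the membership of the indicator of \<open>c\<close> in the annihilator of \<open>H\<close>.  Moving up gives
  \<open>D c \<Longrightarrow> D (c + 1)\<close> for \<open>c + 1 < p - 1\<close>, and from \<open>D (p - 2)\<close> an element of class \<open>0\<close> that vanishes at the digit \<open>0\<close>.  In that class an element with a nonzero value at the digit
  \<open>0\<close> leads to \<open>D 1\<close>, and one that vanishes there is a multiple of the indicator of \<open>p - 1\<close>.  So \<open>D (p - 1)\<close> holds in any
  case; the exchange of \<open>X\<close> and \<open>Y\<close> gives \<open>D 0\<close>, and everything follows by moving up from there.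
\<close>

lemma irreducible_i_eq_a_eq_p_minus_1:
  assumes top: "i = CARD('p) - 1" "a = CARD('p) - 1" "r0 = CARD('p) - 1"
  shows "girreducible Fp GL2 quotient_module"
proof -
  have f: "cut_poly r i 1 (delta_poly 1 :: 'p mod_ring poly) \<in> annih r (relations r i)"
    using p3 top by (intro annih_delta[OF top(1)]) linarith+
  have dd: "degree (delta_poly c :: 'p mod_ring poly) \<le> i" for c using top by (simp add: degree_delta_poly)
  obtain n1 where n1: "n1 \<le> r" "cut_poly r i 1 (delta_poly 1 :: 'p mod_ring poly) n1 \<noteq> 0"
    using cut_poly_nonzero[OF dd delta_poly_neq_0] by blast
  have qz: "[CARD('p) - 1 = 0] (mod CARD('p) - 1)" by (simp add: cong_def)
  show ?thesis
  proof (rule irreducibleI[OF f n1])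
    fix H :: "'p mod_ring poly poly set" and g :: "nat \<Rightarrow> 'p mod_ring" and n
    assume H: "stable_subspace r H" "relations r i \<subseteq> H" and g: "g \<in> annih r H" "n \<le> r" "g n \<noteq> 0"
    define D where "D c \<longleftrightarrow> cut_poly r i c (delta_poly c :: 'p mod_ring poly) \<in> annih r H" for c
    have scale: "D c" if "cut_poly r i w (smult k (delta_poly c) :: 'p mod_ring poly) \<in> annih r H" "k \<noteq> 0"
      "[w = c] (mod CARD('p) - 1)" for w k c
    proof -
      have "(\<lambda>m. (1 / k) * cut_poly r i w (smult k (delta_poly c)) m) \<in> annih r H" by (rule annih_scale[OF that(1)])
      also have "(\<lambda>m. (1 / k) * cut_poly r i w (smult k (delta_poly c)) m) = cut_poly r i c (delta_poly c)"
        unfolding cut_poly_cong_class[OF that(3)] cut_poly_smult using that(2) by simp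
      finally show ?thesis unfolding D_def .
    qed
    have sub: "annih r H \<subseteq> annih r (relations r i)" by (rule annih_antimono[OF H(2)])
    have class_part: "\<exists>P. degree P \<le> i \<and> cut_poly r i w P \<in> annih r H \<and> P \<noteq> 0 \<and>
        (\<forall>m\<le>r. [m = w] (mod CARD('p) - 1) \<longrightarrow> h m = cut_poly r i w P m)"
      if h: "h \<in> annih r H" "m \<le> r" "h m \<noteq> 0" and m: "[m = w] (mod CARD('p) - 1)" for h m w
    proof -
      obtain P where P: "degree P \<le> i" "cut_poly r i w P \<in> annih r H"
        "\<And>m. m \<le> r \<Longrightarrow> [m = w] (mod (CARD('p) - 1)) \<Longrightarrow> h m = cut_poly r i w P m"
        using annih_class_cut_poly[OF H h(1), of w] by metis
      have "P \<noteq> 0"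
      proof
        assume "P = 0"
        then have "cut_poly r i w P m = 0" by (simp add: cut_poly_def)
        then show False using P(3)[OF h(2) m] h(3) by simp
      qed
      then show ?thesis using P by blast
    qed
    have interior: "D w" if h: "h \<in> annih r H" "m \<le> r" "h m \<noteq> 0" and w: "[m = w] (mod CARD('p) - 1)" "1 \<le> w" "w < CARD('p) - 1" for h m w
    proof -
      obtain P where P: "degree P \<le> i" "cut_poly r i w P \<in> annih r H" "P \<noteq> 0" using class_part[OF h w(1)] by blast
      have e: "P = smult (poly P (of_nat w)) (delta_poly w)"
        by (rule annih_top_interior[OF top P(1) _ w(2,3)]) (use P(2) sub in blast)
      then have "poly P (of_nat w) \<noteq> 0" using P(3) by auto
      moreover have "cut_poly r i w (smult (poly P (of_nat w)) (delta_poly w)) \<in> annih r H" using P(2) e by simp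
      ultimately show ?thesis using scale cong_refl by blast
    qed
    have up0: "D 1" if P: "cut_poly r i 0 P \<in> annih r H" "poly P 0 \<noteq> 0" for P
    proof -
      have root: "poly P (of_nat x) = 0 \<or> (0 :: nat) = 0 \<and> x = CARD('p) - 1" if x: "x \<le> 0 + 1" "x \<noteq> 0" for x
      proof (cases "x = CARD('p) - 1")
        case False
        have "poly P (of_nat x) = 0"
          by (rule annih_eq_top_roots[OF top _ _ _ x(2)]) (use P(1) sub x p3 False in \<open>auto\<close>)
        then show ?thesis by simp
      qed simp
      have "\<exists>n\<le>r. [n = 0 + 1] (mod CARD('p) - 1) \<and> (\<Sum>m\<le>n. of_nat (n choose m) * cut_poly r i 0 P m) \<noteq> 0"
        by (rule delta_poly_up[OF top(1) _ _ root]) (use P(2) p3 in simp_all)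
      then obtain N where N: "N \<le> r" "[N = 1] (mod CARD('p) - 1)" "(\<Sum>m\<le>N. of_nat (N choose m) * cut_poly r i 0 P m) \<noteq> 0"
        by auto
      show ?thesis by (rule interior[OF annih_up[OF H(1) P(1)] N(1,3,2)]) (use p3 in linarith)+
    qed
    have step: "\<exists>N\<le>r. [N = c + 1] (mod CARD('p) - 1) \<and> (\<Sum>m\<le>N. of_nat (N choose m) * cut_poly r i c (delta_poly c :: 'p mod_ring poly) m) \<noteq> 0"
      if c: "c < CARD('p) - 1" for c
    proof (rule delta_poly_up[OF top(1) c])
      have cp: "c < CARD('p)" using c by linarith
      show "poly (delta_poly c) (of_nat c) \<noteq> (0 :: 'p mod_ring)" using poly_delta_poly_digit[OF cp cp] by simp
      show "poly (delta_poly c) (of_nat x) = (0 :: 'p mod_ring) \<or> c = 0 \<and> x = CARD('p) - 1" if x: "x \<le> c + 1" "x \<noteq> c" for x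
      proof -
        have "x < CARD('p)" using x c by linarith
        then show ?thesis using poly_delta_poly_digit[OF cp] x(2) by simp
      qed
    qed
    have climb1: "D (c + 1)" if c: "D c" "c + 1 < CARD('p) - 1" for c
    proof -
      have "c < CARD('p) - 1" using c by linarith
      then obtain N where N: "N \<le> r" "[N = c + 1] (mod CARD('p) - 1)"
        "(\<Sum>m\<le>N. of_nat (N choose m) * cut_poly r i c (delta_poly c :: 'p mod_ring poly) m) \<noteq> 0" using step by blast
      show ?thesis by (rule interior[OF annih_up[OF H(1) c(1)[unfolded D_def]] N(1,3,2) _ c(2)]) simp
    qed
    have climb: "D d" if c: "D c" "c \<le> d" "d < CARD('p) - 1" for c d
      using c(2,3)
    proof (induction d rule: dec_induct)
      case base
      show ?case by (rule c(1))
    next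
      case (step m)
      then show ?case using climb1[of m] by simp
    qed
    have last: "D (CARD('p) - 1)" if "D (CARD('p) - 2)"
    proof -
      let ?c = "CARD('p) - 2"
      let ?h = "\<lambda>N. \<Sum>m\<le>N. of_nat (N choose m) * cut_poly r i ?c (delta_poly ?c :: 'p mod_ring poly) m"
      have hH: "?h \<in> annih r H" by (rule annih_up[OF H(1) that[unfolded D_def]])
      have c1: "?c + 1 = CARD('p) - 1" "?c < CARD('p) - 1" using p3 by linarith+
      obtain N where N: "N \<le> r" "[N = ?c + 1] (mod CARD('p) - 1)" "?h N \<noteq> 0" using step[OF c1(2)] by blast
      have N0: "[N = 0] (mod CARD('p) - 1)" by (rule cong_trans[OF N(2)[unfolded c1] qz])
      obtain P where P: "degree P \<le> i" "cut_poly r i 0 P \<in> annih r H" "P \<noteq> 0"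
        "\<forall>m\<le>r. [m = 0] (mod CARD('p) - 1) \<longrightarrow> ?h m = cut_poly r i 0 P m"
        using class_part[OF hH N(1,3) N0] by blast
      \<comment> \<open>an interior point of class \<open>0\<close> with last digit \<open>0\<close>, where the image \<open>?h\<close> vanishes by Lucas\<close>
      define M where "M = CARD('p) * (CARD('p) - 1)"
      have pp: "CARD('p) * 2 \<le> M" unfolding M_def using p3 by (intro mult_le_mono2) linarith
      have "(CARD('p) - 1) * (CARD('p) + 1) = M + (CARD('p) - 1)" unfolding M_def by (simp add: algebra_simps)
      then have rb: "M + 2 * CARD('p) - 1 \<le> r" using r_ge[unfolded top(1)] p3 by linarith
      have M: "M \<le> r" "[M = 0] (mod CARD('p) - 1)" "i < M" "M + i < r"
      proof -
        show "M \<le> r" "M + i < r" "i < M" using rb pp i_less_p p3 by linarith+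
        show "[M = 0] (mod CARD('p) - 1)" unfolding M_def by (simp add: cong_0_iff)
      qed
      have "?h M = 0"
      proof (rule sum.neutral, rule ballI, rule ccontr)
        fix m assume "of_nat (M choose m) * cut_poly r i ?c (delta_poly ?c :: 'p mod_ring poly) m \<noteq> 0"
        then have b: "(of_nat (M choose m) :: 'p mod_ring) \<noteq> 0"
          and d: "poly (delta_poly ?c) (of_nat m) \<noteq> (0 :: 'p mod_ring)" by (auto simp: cut_poly_def split: if_splits)
        have "m mod CARD('p) = ?c mod CARD('p)" using d unfolding poly_delta_poly by (auto split: if_splits)
        also have "\<dots> = ?c" by (rule mod_less) (use p3 in linarith)
        finally have "0 < m mod CARD('p)" using p3 by linarith
        moreover have "M mod CARD('p) = 0" by (simp add: M_def)
        ultimately show False using b unfolding lucas_theorem[of M m] by (simp add: binomial_eq_0)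
      qed
      then have "cut_poly r i 0 P M = 0" using P(4) M by simp
      then have "poly P (of_nat M) = 0" unfolding cut_poly_def using M by simp
      moreover have "(of_nat M :: 'p mod_ring) = 0" by (simp add: of_nat_mod_ring_eq_0_iff M_def)
      ultimately have P0: "poly P 0 = 0" by simp
      have e: "P = smult (poly P (of_nat (CARD('p) - 1))) (delta_poly (CARD('p) - 1))"
        using annih_top_class_zero[OF top P(1)] P(2) sub P0 by auto
      then have "poly P (of_nat (CARD('p) - 1)) \<noteq> 0" using P(3) by auto
      moreover have "cut_poly r i 0 (smult (poly P (of_nat (CARD('p) - 1))) (delta_poly (CARD('p) - 1))) \<in> annih r H"
        using P(2) e by simp
      ultimately show ?thesis using scale cong_sym[OF qz] by blast
    qed
    have up_last: "D (CARD('p) - 1)" if "D c" "c < CARD('p) - 1" for c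
      by (rule last, rule climb[OF that(1)]) (use that(2) p3 in linarith)+
    have D_last: "D (CARD('p) - 1)"
    proof -
      define w where "w = n mod (CARD('p) - 1)"
      have w: "w < CARD('p) - 1" "[n = w] (mod CARD('p) - 1)" unfolding w_def using p3 by (simp_all add: cong_def)
      show ?thesis
      proof (cases "w = 0")
        case False
        then have "D w" by (intro interior[OF g w(2)]) (use w in linarith)+
        then show ?thesis by (rule up_last[OF _ w(1)])
      next
        case True
        obtain P where P: "degree P \<le> i" "cut_poly r i 0 P \<in> annih r H" "P \<noteq> 0"
          using class_part[OF g w(2)[unfolded True]] by blast
        show ?thesis
        proof (cases "poly P 0 = 0")
          case False
          show ?thesis by (rule up_last[OF up0[OF P(2) False]]) (use p3 in linarith)
        next
          case P0: True
          have e: "P = smult (poly P (of_nat (CARD('p) - 1))) (delta_poly (CARD('p) - 1))"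
            using annih_top_class_zero[OF top P(1)] P(2) sub P0 by auto
          then have "poly P (of_nat (CARD('p) - 1)) \<noteq> 0" using P(3) by auto
          moreover have "cut_poly r i 0 (smult (poly P (of_nat (CARD('p) - 1))) (delta_poly (CARD('p) - 1))) \<in> annih r H"
            using P(2) e by simp
          ultimately show ?thesis using scale cong_sym[OF qz] by blast
        qed
      qed
    qed
    have last0: "cut_poly r i 0 (delta_poly (CARD('p) - 1) :: 'p mod_ring poly) \<in> annih r H"
      using D_last unfolding D_def cut_poly_cong_class[OF qz] .
    have D0: "D 0" unfolding D_def
      by (rule annih_cong[OF annih_swap[OF H(1) last0]]) (rule swap_delta_poly[OF top])
    show "annih r (relations r i) \<subseteq> annih r H"
    proof (rule annih_subset_by_classes[OF H(1)])
      fix w and P :: "'p mod_ring poly"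
      assume w: "w < CARD('p) - 1" and P: "degree P \<le> i" "cut_poly r i w P \<in> annih r (relations r i)"
      show "cut_poly r i w P \<in> annih r H"
      proof (cases "w = 0")
        case False
        then have e: "P = smult (poly P (of_nat w)) (delta_poly w)" by (intro annih_top_interior[OF top P _ w]) simp
        have "(\<lambda>m. poly P (of_nat w) * cut_poly r i w (delta_poly w) m) \<in> annih r H"
          by (rule annih_scale) (use climb[OF D0 _ w] in \<open>simp add: D_def\<close>)
        also have "(\<lambda>m. poly P (of_nat w) * cut_poly r i w (delta_poly w) m)
            = cut_poly r i w (smult (poly P (of_nat w)) (delta_poly w))"
          by (rule ext) (simp only: cut_poly_smult)
        also have "\<dots> = cut_poly r i w P" unfolding e[symmetric] ..
        finally show ?thesis .
      next
        case True
        let ?x = "poly P 0" and ?y = "poly P (of_nat (CARD('p) - 1))"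
        have e: "P = smult ?x (delta_poly 0) + smult ?y (delta_poly (CARD('p) - 1))"
          by (rule annih_top_class_zero[OF top P(1)]) (use P(2) True in simp)
        have "(\<lambda>m. ?x * cut_poly r i 0 (delta_poly 0) m + ?y * cut_poly r i 0 (delta_poly (CARD('p) - 1)) m) \<in> annih r H"
          by (intro annih_add annih_scale last0 D0[unfolded D_def])
        also have "(\<lambda>m. ?x * cut_poly r i 0 (delta_poly 0) m + ?y * cut_poly r i 0 (delta_poly (CARD('p) - 1)) m)
          = cut_poly r i 0 (smult ?x (delta_poly 0) + smult ?y (delta_poly (CARD('p) - 1)))"
          by (simp add: cut_poly_def fun_eq_iff)
        also have "\<dots> = cut_poly r i w P" unfolding True e[symmetric] ..
        finally show ?thesis .
      qed
    qed
  qed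
qed

lemma irreducible_iff:
  "girreducible Fp GL2 quotient_module
    \<longleftrightarrow> ((i + 1 = a \<or> i = a) \<and> a \<le> r0) \<or> (i = CARD('p) - 1 \<and> a = 1 \<and> r0 = 0)" (is "?I \<longleftrightarrow> ?C")
proof
  assume ?I
  then show ?C by (rule irreducible_imp)
next
  assume C: ?C
  have r0p: "r0 \<le> CARD('p) - 1" using r_digits(2) by linarith
  consider "i + 1 = a" "a \<le> r0" | "i = a" "a \<le> r0" "a < CARD('p) - 1"
    | "i = CARD('p) - 1" "a = CARD('p) - 1" "r0 = CARD('p) - 1" | "i = CARD('p) - 1" "a = 1" "r0 = 0"
    using C ap r0p by linarith
  then show ?I
    by cases (fact irreducible_i_eq_a_minus_1 irreducible_i_eq_a irreducible_i_eq_a_eq_p_minus_1 irreducible_a_eq_1_r0_eq_0)+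
qed

end

theorem theorem1p11:
  fixes p i r a r0 :: nat
  assumes "p = CARD('p::prime_card)" and "p \<ge> 3"
    and "1 \<le> i" and "i \<le> p - 1"
    and "r \<ge> i * (p + 1) + p"
    and "[r = a] (mod (p - 1))" and "a \<in> {1..p - 1}"
    and "r0 = r mod p"
  shows "girreducible Fp GL2
           (Qmod r i :: ('p mod_ring, 'p mod_ring ^ 2 ^ 2, 'p mod_ring poly poly set) gmodule)
         \<longleftrightarrow> ((i = a - 1 \<or> i = a) \<and> r0 \<in> {a..p - 1}) \<or> (i = p - 1 \<and> a = 1 \<and> r0 = 0)"
proof -
  interpret quotient_parameters i r a r0 "r div p" "TYPE('p)"
    by unfold_locales (use assms in auto)
  have "i = a - 1 \<longleftrightarrow> i + 1 = a" using assms(3) by linarith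
  moreover have "r0 \<in> {a..p - 1} \<longleftrightarrow> a \<le> r0" using r_digits(2) assms(1) by auto
  ultimately show ?thesis using irreducible_iff assms(1) by simp
qed

end
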